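(* Let $(M=M_1\times_{f_1}M_2,\Pi^{\nu_1},\tilde g^{f_1})$ be a pseudo-Riemannian contravariant warped product space and let $u\in C^\infty(M)$ with $u=u_1^h+u_2^v$, where $u_1^h$ (respectively $u_2^v$) is the horizontal (respectively vertical) lift to $M$ of $u_1\in C^\infty(M_1)$ (respectively $u_2\in C^\infty(M_2)$). Then $$\Delta^{\mathcal D}(u)=\left(\Delta^{\mathcal D^{M_1}}u_1\right)^h+\frac{k_2-2q_2}{f_1^h}\,\tilde g_1(J_1df_1,J_1du_1)^h+(\nu_1^hf_1^h)^2\left(\Delta^{\mathcal D^{M_2}}u_2\right)^v,$$ where $k_2=\dim M_2$ and $q_2$ is the index of $\bar g_2$.
   Context: Everything is smooth. For a bivector field $\Pi$ on a manifold $N$, the sharp map $\sharp_\Pi:T^*N\to TN$ is defined by $\eta(\sharp_\Pi(\omega))=\Pi(\omega,\eta)$, and the bracket on one-forms is $[\omega,\eta]_\Pi=\mathcal L_{\sharp_\Pi(\omega)}\eta-\mathcal L_{\sharp_\Pi(\eta)}\omega-d(\Pi(\omega,\eta))$. $(N,\Pi)$ is a Poisson manifold if the Schouten bracket $[\Pi,\Pi]_S$ vanishes. For a semi-Riemannian metric $\bar g$ on $N$, its cometric $\tilde g$ is the induced metric on $T^*N$. The endomorphism $J$ of $T^*N$ is defined by $\Pi(\omega,\eta)=\tilde g(J\omega,\eta)=-\tilde g(\omega,J\eta)$. A contravariant connection $\mathcal D$ is an $\mathbb R$-bilinear map on one-forms with $\mathcal D_{f\omega}\eta=f\mathcal D_\omega\eta$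 and $\mathcal D_\omega(f\eta)=f\mathcal D_\omega\eta+\sharp_\Pi(\omega)(f)\eta$; on functions, $\mathcal D_\omega u=\sharp_\Pi(\omega)(u)$. The contravariant Levi-Civita connection of $(\tilde g,\Pi)$ is the unique one satisfying $\mathcal D_\omega\eta-\mathcal D_\eta\omega=[\omega,\eta]_\Pi$ and $\sharp_\Pi(\omega)\tilde g(\eta,\gamma)=\tilde g(\mathcal D_\omega\eta,\gamma)+\tilde g(\eta,\mathcal D_\omega\gamma)$. The second order contravariant derivative of a function is $\mathcal D^2_{\omega,\eta}u=\mathcal D_\omega(\mathcal D_\eta u)-\mathcal D_{\mathcal D_\omega\eta}u$. Contravariant warped product space: for $i=1,2$ let $(M_i,\Pi_i)$ be a Poisson manifold of dimension $k_i$ with semi-Riemannian metric $\bar g_i$ of index $q_i$, cometric $\tilde g_i$, endomorphism $J_i$ and contravariant Levi-Civita connection $\mathcal D^{M_i}$ of $(\tilde g_i,\Pi_i)$. Let $f_1$ be a positive smooth function and $\nu_1$ a smooth function on $M_1$. Put $M=M_1\times M_2$ with projections $\pi_1,\pi_2$. The superscript $h$ denotes horizontal lift (pull-back by $\pi_1$) and $v$ denotes vertical lift (pull-back by $\pi_2$). $M$ carries the warped metric $\bar g^{f_1}=\pi_1^*\bar g_1+(f_1^h)^2\pi_2^*\bar g_2$, whose cometric is $\tilde g^{f_1}=\tilde g_1^h+\frac1{(f_1^h)^2}\tilde g_2^v$, and the bivector field $\Pi^{\nu_1}=\Pi_1+\nu_1\Pi_2$, i.e. $\Pi^{\nu_1}(\omega_1^h+\omega_2^v,\gamma_1^h+\gamma_2^v)=\Pi_1(\omega_1,\gamma_1)^h+\nu_1^h\Pi_2(\omega_2,\gamma_2)^v$.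 $\mathcal D$ is the contravariant Levi-Civita connection of $(\tilde g^{f_1},\Pi^{\nu_1})$. Laplacians: let $\{dx_1,\dots,dx_{k_1}\}$ and $\{dy_1,\dots,dy_{k_2}\}$ be local orthonormal bases of one-forms for $\tilde g_1$ and $\tilde g_2$, the first $q_1$ (respectively $q_2$) having square norm $-1$ and the others $+1$. Then $\{dx_1^h,\dots,dx_{k_1}^h,f_1^hdy_1^v,\dots,f_1^hdy_{k_2}^v\}$ is a local $\tilde g^{f_1}$-orthonormal basis, and the contravariant Laplacians are taken with respect to these bases: $$\Delta^{\mathcal D}u=-\sum_{i=1}^{k_1}\mathcal D^2_{dx_i^h,dx_i^h}u-\sum_{j=1}^{k_2}\mathcal D^2_{f_1^hdy_j^v,f_1^hdy_j^v}u,$$ $$\Delta^{\mathcal D^{M_1}}u_1=-\sum_{i}(\mathcal D^{M_1})^2_{dx_i,dx_i}u_1,\qquad \Delta^{\mathcal D^{M_2}}u_2=-\sum_j(\mathcal D^{M_2})^2_{dy_j,dy_j}u_2.$$ *)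

theory Defs
  imports "HOL-Analysis.Analysis"
begin

section \<open>Smooth maps between Euclidean spaces\<close>

primrec Ck_on :: "nat \<Rightarrow> 'a::real_normed_vector set \<Rightarrow> ('a \<Rightarrow> 'b::real_normed_vector) \<Rightarrow> bool" where
  "Ck_on 0 S f \<longleftrightarrow> continuous_on S f"
| "Ck_on (Suc k) S f \<longleftrightarrow>
     f differentiable_on S \<and> (\<forall>v. Ck_on k S (\<lambda>x. frechet_derivative f (at x) v))"

text \<open>Only meant for open \<open>S\<close>: the derivatives are two-sided.\<close>

definition smooth_on :: "'a::real_normed_vector set \<Rightarrow> ('a \<Rightarrow> 'b::real_normed_vector) \<Rightarrow> bool" where
  "smooth_on S f \<longleftrightarrow> (\<forall>k. Ck_on k S f)"


section \<open>Smooth manifolds\<close>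

text \<open>
  A manifold is a whole type \<open>'m\<close> with an atlas modelled on a Euclidean space \<open>'e\<close>, so that its
  dimension is \<open>DIM('e)\<close>. A chart is its domain together with a total function of which only the
  values on the domain matter. The atlas need not be maximal.
\<close>

type_synonym ('m, 'e) chart = "'m set \<times> ('m \<Rightarrow> 'e)"
type_synonym ('m, 'e) atlas = "('m, 'e) chart set"

definition chart_inv :: "('m, 'e) chart \<Rightarrow> 'e \<Rightarrow> 'm" where
  "chart_inv c = inv_into (fst c) (snd c)"

definition smooth_manifold ::
  "('m::{t2_space,second_countable_topology}, 'e::euclidean_space) atlas \<Rightarrow> bool" where
  "smooth_manifold A \<longleftrightarrow>
     (\<forall>c\<in>A. open (fst c) \<and> open (snd c ` fst c) \<and>
            homeomorphism (fst c) (snd c ` fst c) (snd c) (chart_inv c)) \<and>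
     (\<Union>c\<in>A. fst c) = UNIV \<and>
     (\<forall>c\<in>A. \<forall>c'\<in>A. smooth_on (snd c ` (fst c \<inter> fst c')) (snd c' \<circ> chart_inv c))"

definition prod_atlas :: "('m, 'e) atlas \<Rightarrow> ('n, 'd) atlas \<Rightarrow> ('m \<times> 'n, 'e \<times> 'd) atlas" where
  "prod_atlas A B = {(fst a \<times> fst b, \<lambda>x. (snd a (fst x), snd b (snd x))) | a b. a \<in> A \<and> b \<in> B}"

definition smooth_fun_on ::
  "('m::topological_space, 'e::euclidean_space) atlas \<Rightarrow> 'm set \<Rightarrow> ('m \<Rightarrow> real) \<Rightarrow> bool" where
  "smooth_fun_on A W u \<longleftrightarrow> (\<forall>c\<in>A. smooth_on (snd c ` (fst c \<inter> W)) (u \<circ> chart_inv c))"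

definition smooth_at ::
  "('m::topological_space, 'e::euclidean_space) atlas \<Rightarrow> 'm \<Rightarrow> ('m \<Rightarrow> real) \<Rightarrow> bool" where
  "smooth_at A p u \<longleftrightarrow> (\<exists>W. open W \<and> p \<in> W \<and> smooth_fun_on A W u)"


section \<open>Tangent vectors, covectors and tensor fields\<close>

text \<open>
  A tangent vector at \<open>p\<close> is a directional derivative operator on real functions that are smooth
  near \<open>p\<close>. It is set to 0 on all other functions, which makes it independent of the chart; the
  vector space structure is pointwise. A covector at \<open>p\<close> is a linear functional on the tangent
  space at \<open>p\<close>, set to 0 off the tangent space, so that equality of covectors is equality of
  functions and linear combinations are again pointwise.
\<close>

type_synonym 'm tvec = "('m \<Rightarrow> real) \<Rightarrow> real"
type_synonym 'm covec = "'m tvec \<Rightarrow> real"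
type_synonym 'm vfield = "'m \<Rightarrow> 'm tvec"
type_synonym 'm form = "'m \<Rightarrow> 'm covec"
type_synonym 'm bivector = "'m \<Rightarrow> 'm covec \<Rightarrow> 'm covec \<Rightarrow> real"
type_synonym 'm metric = "'m \<Rightarrow> 'm tvec \<Rightarrow> 'm tvec \<Rightarrow> real"

definition coord_vec ::
  "('m::topological_space, 'e::euclidean_space) atlas \<Rightarrow> ('m, 'e) chart \<Rightarrow> 'e \<Rightarrow> 'm vfield" where
  "coord_vec A c v p =
     (\<lambda>u. if smooth_at A p u then frechet_derivative (u \<circ> chart_inv c) (at (snd c p)) v else 0)"

definition tangent_space ::
  "('m::topological_space, 'e::euclidean_space) atlas \<Rightarrow> 'm \<Rightarrow> 'm tvec set" where
  "tangent_space A p = {coord_vec A c v p | c v. c \<in> A \<and> p \<in> fst c}"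

definition cotangent_space ::
  "('m::topological_space, 'e::euclidean_space) atlas \<Rightarrow> 'm \<Rightarrow> 'm covec set" where
  "cotangent_space A p =
     {\<xi>. (\<forall>X\<in>tangent_space A p. \<forall>Y\<in>tangent_space A p. \<forall>a b.
             \<xi> (\<lambda>u. a * X u + b * Y u) = a * \<xi> X + b * \<xi> Y) \<and>
          (\<forall>X. X \<notin> tangent_space A p \<longrightarrow> \<xi> X = 0)}"

definition differential ::
  "('m::topological_space, 'e::euclidean_space) atlas \<Rightarrow> ('m \<Rightarrow> real) \<Rightarrow> 'm form" where
  "differential A u p = (\<lambda>X. if X \<in> tangent_space A p then X u else 0)"

definition coord_form ::
  "('m::topological_space, 'e::euclidean_space) atlas \<Rightarrow> ('m, 'e) chart \<Rightarrow> 'e \<Rightarrow> 'm form" where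
  "coord_form A c b = differential A (\<lambda>x. snd c x \<bullet> b)"

definition smooth_fun :: "('m::topological_space, 'e::euclidean_space) atlas \<Rightarrow> ('m \<Rightarrow> real) \<Rightarrow> bool" where
  "smooth_fun A u \<longleftrightarrow> smooth_fun_on A UNIV u"

definition vfield_on ::
  "('m::topological_space, 'e::euclidean_space) atlas \<Rightarrow> 'm set \<Rightarrow> 'm vfield \<Rightarrow> bool" where
  "vfield_on A W X \<longleftrightarrow>
     (\<forall>p\<in>W. X p \<in> tangent_space A p) \<and>
     (\<forall>c\<in>A. \<forall>b\<in>Basis. smooth_fun_on A (fst c \<inter> W) (\<lambda>p. X p (\<lambda>x. snd c x \<bullet> b)))"

definition oneform_on ::
  "('m::topological_space, 'e::euclidean_space) atlas \<Rightarrow> 'm set \<Rightarrow> 'm form \<Rightarrow> bool" where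
  "oneform_on A W \<omega> \<longleftrightarrow>
     (\<forall>p\<in>W. \<omega> p \<in> cotangent_space A p) \<and>
     (\<forall>c\<in>A. \<forall>b\<in>Basis. smooth_fun_on A (fst c \<inter> W) (\<lambda>p. \<omega> p (coord_vec A c b p)))"

abbreviation oneform ::
  "('m::topological_space, 'e::euclidean_space) atlas \<Rightarrow> 'm form \<Rightarrow> bool" where
  "oneform A \<equiv> oneform_on A UNIV"

definition form_add :: "'m form \<Rightarrow> 'm form \<Rightarrow> 'm form" where
  "form_add \<omega> \<eta> = (\<lambda>p X. \<omega> p X + \<eta> p X)"

definition form_scale :: "('m \<Rightarrow> real) \<Rightarrow> 'm form \<Rightarrow> 'm form" where
  "form_scale f \<omega> = (\<lambda>p X. f p * \<omega> p X)"

definition bivector_field ::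
  "('m::topological_space, 'e::euclidean_space) atlas \<Rightarrow> 'm bivector \<Rightarrow> bool" where
  "bivector_field A P \<longleftrightarrow>
     (\<forall>p. \<forall>\<xi>\<in>cotangent_space A p. \<forall>\<zeta>\<in>cotangent_space A p.
        P p \<xi> \<zeta> = - P p \<zeta> \<xi> \<and>
        (\<forall>\<theta>\<in>cotangent_space A p. \<forall>a b.
           P p (\<lambda>X. a * \<xi> X + b * \<zeta> X) \<theta> = a * P p \<xi> \<theta> + b * P p \<zeta> \<theta>)) \<and>
     (\<forall>c\<in>A. \<forall>i\<in>Basis. \<forall>j\<in>Basis.
        smooth_fun_on A (fst c) (\<lambda>p. P p (coord_form A c i p) (coord_form A c j p)))"

definition form_index :: "('e::euclidean_space \<Rightarrow> 'e \<Rightarrow> real) \<Rightarrow> nat" where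
  "form_index B = Max {dim W | W. subspace W \<and> (\<forall>v\<in>W. v \<noteq> 0 \<longrightarrow> B v v < 0)}"

definition semi_riemannian_metric ::
  "('m::topological_space, 'e::euclidean_space) atlas \<Rightarrow> 'm metric \<Rightarrow> nat \<Rightarrow> bool" where
  "semi_riemannian_metric A g q \<longleftrightarrow>
     (\<forall>p. \<forall>X\<in>tangent_space A p. \<forall>Y\<in>tangent_space A p.
        g p X Y = g p Y X \<and>
        (\<forall>Z\<in>tangent_space A p. \<forall>a b.
           g p (\<lambda>u. a * X u + b * Y u) Z = a * g p X Z + b * g p Y Z)) \<and>
     (\<forall>p. \<forall>X\<in>tangent_space A p.
        (\<forall>Y\<in>tangent_space A p. g p X Y = 0) \<longrightarrow> X = (\<lambda>u. 0)) \<and>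
     (\<forall>c\<in>A. \<forall>i\<in>Basis. \<forall>j\<in>Basis.
        smooth_fun_on A (fst c) (\<lambda>p. g p (coord_vec A c i p) (coord_vec A c j p))) \<and>
     (\<forall>c\<in>A. \<forall>p\<in>fst c. form_index (\<lambda>v w. g p (coord_vec A c v p) (coord_vec A c w p)) = q)"


section \<open>Push-forward and pull-back\<close>

text \<open>
  \<open>B\<close> is the atlas of the target; the case distinction keeps push-forwards at 0 on functions that
  are not smooth near \<open>F p\<close>.
\<close>

definition pushforward ::
  "('n::topological_space, 'd::euclidean_space) atlas \<Rightarrow> ('m \<Rightarrow> 'n) \<Rightarrow> 'm \<Rightarrow> 'm tvec \<Rightarrow> 'n tvec" where
  "pushforward B F p X = (\<lambda>u. if smooth_at B (F p) u then X (u \<circ> F) else 0)"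

definition pullback_covec ::
  "('m::topological_space, 'e::euclidean_space) atlas \<Rightarrow> ('n::topological_space, 'd::euclidean_space) atlas
     \<Rightarrow> ('m \<Rightarrow> 'n) \<Rightarrow> 'm \<Rightarrow> 'n covec \<Rightarrow> 'm covec" where
  "pullback_covec A B F p \<xi> =
     (\<lambda>X. if X \<in> tangent_space A p then \<xi> (pushforward B F p X) else 0)"

definition pullback_form ::
  "('m::topological_space, 'e::euclidean_space) atlas \<Rightarrow> ('n::topological_space, 'd::euclidean_space) atlas
     \<Rightarrow> ('m \<Rightarrow> 'n) \<Rightarrow> 'n form \<Rightarrow> 'm form" where
  "pullback_form A B F \<omega> = (\<lambda>p. pullback_covec A B F p (\<omega> (F p)))"

definition pullback_metric ::
  "('n::topological_space, 'd::euclidean_space) atlas \<Rightarrow> ('m \<Rightarrow> 'n) \<Rightarrow> 'n metric \<Rightarrow> 'm metric" where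
  "pullback_metric B F g = (\<lambda>p X Y. g (F p) (pushforward B F p X) (pushforward B F p Y))"


section \<open>Poisson geometry\<close>

text \<open>
  Components in the chart \<open>c\<close> of the Schouten bracket of two bivector fields,
  \<open>[P,Q]^{ijk} = \<Sum>\<^sub>l (P^{li} \<partial>\<^sub>l Q^{jk} + Q^{li} \<partial>\<^sub>l P^{jk}) + cyclic permutations of (i,j,k)\<close>.
  Sign conventions in the literature differ by an overall sign.
\<close>

definition schouten_bracket ::
  "('m::topological_space, 'e::euclidean_space) atlas \<Rightarrow> 'm bivector \<Rightarrow> 'm bivector
     \<Rightarrow> ('m, 'e) chart \<Rightarrow> 'e \<Rightarrow> 'e \<Rightarrow> 'e \<Rightarrow> 'm \<Rightarrow> real" where
  "schouten_bracket A P Q c i j k p =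
     (let comp = (\<lambda>R a b x. R x (coord_form A c a x) (coord_form A c b x));
          T = (\<lambda>a b d. \<Sum>l\<in>Basis. comp P l a p * coord_vec A c l p (comp Q b d)
                               + comp Q l a p * coord_vec A c l p (comp P b d))
      in T i j k + T j k i + T k i j)"

definition poisson_manifold ::
  "('m::{t2_space,second_countable_topology}, 'e::euclidean_space) atlas \<Rightarrow> 'm bivector \<Rightarrow> bool" where
  "poisson_manifold A P \<longleftrightarrow>
     smooth_manifold A \<and> bivector_field A P \<and>
     (\<forall>c\<in>A. \<forall>p\<in>fst c. \<forall>i\<in>Basis. \<forall>j\<in>Basis. \<forall>k\<in>Basis. schouten_bracket A P P c i j k p = 0)"

definition sharp ::
  "('m::topological_space, 'e::euclidean_space) atlas \<Rightarrow> 'm bivector \<Rightarrow> 'm form \<Rightarrow> 'm vfield" where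
  "sharp A P \<omega> p =
     (THE X. X \<in> tangent_space A p \<and> (\<forall>\<eta>\<in>cotangent_space A p. \<eta> X = P p (\<omega> p) \<eta>))"

definition vfield_bracket ::
  "('m::topological_space, 'e::euclidean_space) atlas \<Rightarrow> 'm vfield \<Rightarrow> 'm vfield \<Rightarrow> 'm vfield" where
  "vfield_bracket A X Y p =
     (\<lambda>u. if smooth_at A p u then X p (\<lambda>x. Y x u) - Y p (\<lambda>x. X x u) else 0)"

text \<open>
  The value at \<open>p\<close> of \<open>(L\<^sub>X \<eta>)(V) = X(\<eta>(V)) - \<eta>([X,V])\<close> does not depend on the extension
  of the tangent vector \<open>v\<close> to a local vector field \<open>V\<close>.
\<close>

definition lie_derivative ::
  "('m::topological_space, 'e::euclidean_space) atlas \<Rightarrow> 'm vfield \<Rightarrow> 'm form \<Rightarrow> 'm form" where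
  "lie_derivative A X \<eta> p =
     (\<lambda>v. if v \<in> tangent_space A p then
        (THE r. \<exists>V W. open W \<and> p \<in> W \<and> vfield_on A W V \<and> V p = v \<and>
                      r = X p (\<lambda>x. \<eta> x (V x)) - \<eta> p (vfield_bracket A X V p))
      else 0)"

definition form_bracket ::
  "('m::topological_space, 'e::euclidean_space) atlas \<Rightarrow> 'm bivector \<Rightarrow> 'm form \<Rightarrow> 'm form \<Rightarrow> 'm form" where
  "form_bracket A P \<omega> \<eta> =
     (\<lambda>p v. lie_derivative A (sharp A P \<omega>) \<eta> p v - lie_derivative A (sharp A P \<eta>) \<omega> p v
            - differential A (\<lambda>x. P x (\<omega> x) (\<eta> x)) p v)"


section \<open>Cometric and the endomorphism J\<close>

definition metric_sharp ::
  "('m::topological_space, 'e::euclidean_space) atlas \<Rightarrow> 'm metric \<Rightarrow> 'm \<Rightarrow> 'm covec \<Rightarrow> 'm tvec" where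
  "metric_sharp A g p \<xi> =
     (THE X. X \<in> tangent_space A p \<and> (\<forall>Y\<in>tangent_space A p. g p X Y = \<xi> Y))"

definition cometric ::
  "('m::topological_space, 'e::euclidean_space) atlas \<Rightarrow> 'm metric \<Rightarrow> 'm \<Rightarrow> 'm covec \<Rightarrow> 'm covec \<Rightarrow> real" where
  "cometric A g p \<xi> \<zeta> = g p (metric_sharp A g p \<xi>) (metric_sharp A g p \<zeta>)"

text \<open>
  Skew-symmetry of \<open>P\<close> turns the defining identity \<open>P(\<omega>,\<eta>) = g(J \<omega>, \<eta>)\<close> of \<open>J\<close> into
  \<open>P(\<omega>,\<eta>) = - g(\<omega>, J \<eta>)\<close>.
\<close>

definition J_endo ::
  "('m::topological_space, 'e::euclidean_space) atlas \<Rightarrow> 'm bivector \<Rightarrow> 'm metric \<Rightarrow> 'm form \<Rightarrow> 'm form" where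
  "J_endo A P g \<omega> p =
     (THE \<xi>. \<xi> \<in> cotangent_space A p \<and>
             (\<forall>\<eta>\<in>cotangent_space A p. P p (\<omega> p) \<eta> = cometric A g p \<xi> \<eta>))"


section \<open>Contravariant connections and Laplacians\<close>

definition contr_deriv_fun ::
  "('m::topological_space, 'e::euclidean_space) atlas \<Rightarrow> 'm bivector \<Rightarrow> 'm form \<Rightarrow> ('m \<Rightarrow> real) \<Rightarrow> 'm \<Rightarrow> real" where
  "contr_deriv_fun A P \<omega> u = (\<lambda>p. sharp A P \<omega> p u)"

definition contravariant_connection ::
  "('m::topological_space, 'e::euclidean_space) atlas \<Rightarrow> 'm bivector \<Rightarrow> ('m form \<Rightarrow> 'm form \<Rightarrow> 'm form) \<Rightarrow> bool" where
  "contravariant_connection A P D \<longleftrightarrow>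
     (\<forall>\<omega> \<eta>. oneform A \<omega> \<longrightarrow> oneform A \<eta> \<longrightarrow> oneform A (D \<omega> \<eta>)) \<and>
     (\<forall>\<omega> \<omega>' \<eta>. oneform A \<omega> \<longrightarrow> oneform A \<omega>' \<longrightarrow> oneform A \<eta> \<longrightarrow>
        D (form_add \<omega> \<omega>') \<eta> = form_add (D \<omega> \<eta>) (D \<omega>' \<eta>) \<and>
        D \<eta> (form_add \<omega> \<omega>') = form_add (D \<eta> \<omega>) (D \<eta> \<omega>')) \<and>
     (\<forall>a \<omega> \<eta>. oneform A \<omega> \<longrightarrow> oneform A \<eta> \<longrightarrow>
        D (form_scale (\<lambda>_. a) \<omega>) \<eta> = form_scale (\<lambda>_. a) (D \<omega> \<eta>) \<and>
        D \<omega> (form_scale (\<lambda>_. a) \<eta>) = form_scale (\<lambda>_. a) (D \<omega> \<eta>)) \<and>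
     (\<forall>f \<omega> \<eta>. smooth_fun A f \<longrightarrow> oneform A \<omega> \<longrightarrow> oneform A \<eta> \<longrightarrow>
        D (form_scale f \<omega>) \<eta> = form_scale f (D \<omega> \<eta>) \<and>
        D \<omega> (form_scale f \<eta>) =
          form_add (form_scale f (D \<omega> \<eta>)) (form_scale (contr_deriv_fun A P \<omega> f) \<eta>))"

definition contravariant_levi_civita ::
  "('m::topological_space, 'e::euclidean_space) atlas \<Rightarrow> 'm bivector \<Rightarrow> 'm metric
     \<Rightarrow> ('m form \<Rightarrow> 'm form \<Rightarrow> 'm form) \<Rightarrow> bool" where
  "contravariant_levi_civita A P g D \<longleftrightarrow>
     contravariant_connection A P D \<and>
     (\<forall>\<omega> \<eta>. oneform A \<omega> \<longrightarrow> oneform A \<eta> \<longrightarrow>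
        (\<lambda>p v. D \<omega> \<eta> p v - D \<eta> \<omega> p v) = form_bracket A P \<omega> \<eta>) \<and>
     (\<forall>\<omega> \<eta> \<gamma> p. oneform A \<omega> \<longrightarrow> oneform A \<eta> \<longrightarrow> oneform A \<gamma> \<longrightarrow>
        contr_deriv_fun A P \<omega> (\<lambda>x. cometric A g x (\<eta> x) (\<gamma> x)) p =
          cometric A g p (D \<omega> \<eta> p) (\<gamma> p) + cometric A g p (\<eta> p) (D \<omega> \<gamma> p))"

text \<open>
  A connection acts on globally defined one-forms. It is a local operator in both arguments, so it
  acts on one-forms that are smooth only near \<open>p\<close> through any global one-forms with the same germs.
\<close>

definition local_conn ::
  "('m::topological_space, 'e::euclidean_space) atlas \<Rightarrow> ('m form \<Rightarrow> 'm form \<Rightarrow> 'm form)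
     \<Rightarrow> 'm form \<Rightarrow> 'm form \<Rightarrow> 'm form" where
  "local_conn A D \<omega> \<eta> p =
     (THE \<xi>. \<exists>\<omega>' \<eta>'. oneform A \<omega>' \<and> oneform A \<eta>' \<and>
              (\<forall>\<^sub>F x in nhds p. \<omega>' x = \<omega> x \<and> \<eta>' x = \<eta> x) \<and> \<xi> = D \<omega>' \<eta>' p)"

definition second_contr_deriv ::
  "('m::topological_space, 'e::euclidean_space) atlas \<Rightarrow> 'm bivector \<Rightarrow> ('m form \<Rightarrow> 'm form \<Rightarrow> 'm form)
     \<Rightarrow> 'm form \<Rightarrow> 'm form \<Rightarrow> ('m \<Rightarrow> real) \<Rightarrow> 'm \<Rightarrow> real" where
  "second_contr_deriv A P D \<omega> \<eta> u =
     (\<lambda>p. contr_deriv_fun A P \<omega> (contr_deriv_fun A P \<eta> u) p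
          - contr_deriv_fun A P (local_conn A D \<omega> \<eta>) u p)"

text \<open>
  The Laplacian with respect to the local basis \<open>(e i)\<close>, \<open>i \<in> I\<close>. The summands carry no signs
  \<open>\<plusminus>1\<close> for the square norms of the basis, so it depends on the basis when the metric is indefinite.
\<close>

definition contr_laplacian ::
  "('m::topological_space, 'e::euclidean_space) atlas \<Rightarrow> 'm bivector \<Rightarrow> ('m form \<Rightarrow> 'm form \<Rightarrow> 'm form)
     \<Rightarrow> 'i set \<Rightarrow> ('i \<Rightarrow> 'm form) \<Rightarrow> ('m \<Rightarrow> real) \<Rightarrow> 'm \<Rightarrow> real" where
  "contr_laplacian A P D I e u = (\<lambda>p. - (\<Sum>i\<in>I. second_contr_deriv A P D (e i) (e i) u p))"

definition orthonormal_coframe_on ::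
  "('m::topological_space, 'e::euclidean_space) atlas \<Rightarrow> 'm metric \<Rightarrow> nat \<Rightarrow> 'm set
     \<Rightarrow> (nat \<Rightarrow> 'm form) \<Rightarrow> bool" where
  "orthonormal_coframe_on A g q U e \<longleftrightarrow>
     open U \<and> (\<forall>i\<in>{1..DIM('e)}. oneform_on A U (e i)) \<and>
     (\<forall>p\<in>U. \<forall>i\<in>{1..DIM('e)}. \<forall>j\<in>{1..DIM('e)}.
        cometric A g p (e i p) (e j p) = (if i \<noteq> j then 0 else if i \<le> q then -1 else 1))"


section \<open>Contravariant warped products\<close>

definition warped_metric ::
  "('m::topological_space, 'e::euclidean_space) atlas \<Rightarrow> ('n::topological_space, 'd::euclidean_space) atlas
     \<Rightarrow> 'm metric \<Rightarrow> 'n metric \<Rightarrow> ('m \<Rightarrow> real) \<Rightarrow> ('m \<times> 'n) metric" where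
  "warped_metric A B g h f =
     (\<lambda>p X Y. pullback_metric A fst g p X Y + (f (fst p))\<^sup>2 * pullback_metric B snd h p X Y)"

text \<open>
  \<open>P + \<nu> Q\<close> at \<open>(x, y)\<close>: the bivectors \<open>P\<close> at \<open>x\<close> and \<open>Q\<close> at \<open>y\<close> are pushed forward along the
  inclusions of the two slices through \<open>(x, y)\<close>, under which \<open>\<omega>\<^sub>1\<^sup>h + \<omega>\<^sub>2\<^sup>v\<close> pulls back to
  \<open>\<omega>\<^sub>1\<close> and \<open>\<omega>\<^sub>2\<close> respectively.
\<close>

definition warped_bivector ::
  "('m::topological_space, 'e::euclidean_space) atlas \<Rightarrow> ('n::topological_space, 'd::euclidean_space) atlas
     \<Rightarrow> 'm bivector \<Rightarrow> 'n bivector \<Rightarrow> ('m \<Rightarrow> real) \<Rightarrow> ('m \<times> 'n) bivector" where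
  "warped_bivector A B P Q \<nu> = (\<lambda>(x, y) \<xi> \<zeta>.
     P x (pullback_covec A (prod_atlas A B) (\<lambda>x'. (x', y)) x \<xi>)
         (pullback_covec A (prod_atlas A B) (\<lambda>x'. (x', y)) x \<zeta>) +
     \<nu> x * Q y (pullback_covec B (prod_atlas A B) (\<lambda>y'. (x, y')) y \<xi>)
               (pullback_covec B (prod_atlas A B) (\<lambda>y'. (x, y')) y \<zeta>))"

abbreviation hlift ::
  "('m::topological_space, 'e::euclidean_space) atlas \<Rightarrow> ('n::topological_space, 'd::euclidean_space) atlas
     \<Rightarrow> 'm form \<Rightarrow> ('m \<times> 'n) form" where
  "hlift A B \<equiv> pullback_form (prod_atlas A B) A fst"

abbreviation vlift ::
  "('m::topological_space, 'e::euclidean_space) atlas \<Rightarrow> ('n::topological_space, 'd::euclidean_space) atlas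
     \<Rightarrow> 'n form \<Rightarrow> ('m \<times> 'n) form" where
  "vlift A B \<equiv> pullback_form (prod_atlas A B) B snd"

definition warped_coframe ::
  "('m::topological_space, 'e::euclidean_space) atlas \<Rightarrow> ('n::topological_space, 'd::euclidean_space) atlas
     \<Rightarrow> ('m \<Rightarrow> real) \<Rightarrow> (nat \<Rightarrow> 'm form) \<Rightarrow> (nat \<Rightarrow> 'n form) \<Rightarrow> nat + nat \<Rightarrow> ('m \<times> 'n) form" where
  "warped_coframe A B f dx dy =
     case_sum (\<lambda>i. hlift A B (dx i)) (\<lambda>j. form_scale (f \<circ> fst) (vlift A B (dy j)))"

end

theory Submission
  imports Defs
begin

text \<open>
  Write \<open>[\<omega>, \<eta>]\<close> for the bracket of one-forms and \<open>#\<close> for the sharp map of the bivector field. The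
  Laplacian sees the connection only through the number \<open>#(D\<^sub>e e) u\<close>, for \<open>e\<close> in an orthonormal
  coframe. Let \<open>e\<^sub>k\<close> be orthonormal near a point, with signs \<open>\<epsilon>\<^sub>k\<close>. All products
  \<open><e\<^sub>i, e\<^sub>k>\<close> are constant there, so metric compatibility and vanishing torsion reduce the Koszul
  formula to \<open><D e\<^sub>i e\<^sub>i, e\<^sub>k> = - <e\<^sub>i, [e\<^sub>i, e\<^sub>k]>\<close>. Expanding \<open>D e\<^sub>i e\<^sub>i\<close> in the coframe gives
  (\<open>second_contr_deriv_frame\<close>)

    \<open>D\<^sup>2(e\<^sub>i, e\<^sub>i) u = #e\<^sub>i (#e\<^sub>i u) + \<Sum>\<^sub>k \<epsilon>\<^sub>k <e\<^sub>i, [e\<^sub>i, e\<^sub>k]> #e\<^sub>k u\<close>.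

  This formula holds on \<open>M\<^sub>1\<close>, on \<open>M\<^sub>2\<close> and on the warped product, and contains no derivative of the
  metric. What remains is to compute the sharps and the brackets of the coframe of lifts \<open>dx\<^sup>h\<close> and
  \<open>f dy\<^sup>v\<close>. One has \<open>#(dx\<^sup>h) = (#dx)\<^sup>h\<close> and \<open>#(f dy\<^sup>v) = f \<nu> (#dy)\<^sup>v\<close>, and

    \<open><dx\<^sub>i\<^sup>h, [dx\<^sub>i\<^sup>h, dx\<^sub>k\<^sup>h]> = <dx\<^sub>i, [dx\<^sub>i, dx\<^sub>k]>\<close>,
    \<open><dx\<^sub>i\<^sup>h, [dx\<^sub>i\<^sup>h, f dy\<^sub>k\<^sup>v]> = 0\<close>,
    \<open><f dy\<^sub>j\<^sup>v, [f dy\<^sub>j\<^sup>v, dx\<^sub>k\<^sup>h]> = - \<epsilon>\<^sub>j (#dx\<^sub>k f) / f\<close>,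
    \<open><f dy\<^sub>j\<^sup>v, [f dy\<^sub>j\<^sup>v, f dy\<^sub>k\<^sup>v]> = f \<nu> <dy\<^sub>j, [dy\<^sub>j, dy\<^sub>k]>\<close>

  (\<open>bracket_hlift_hlift\<close>, \<open>bracket_hlift_wlift\<close>, \<open>bracket_wlift_wlift\<close>). Hence the second derivative
  along \<open>dx\<^sub>i\<^sup>h\<close> is the one on \<open>M\<^sub>1\<close>, while the one along \<open>f dy\<^sub>j\<^sup>v\<close> is \<open>(f \<nu>)\<^sup>2\<close> times the one on \<open>M\<^sub>2\<close>
  minus \<open>(\<epsilon>\<^sub>j / f) \<Sum>\<^sub>k \<epsilon>\<^sub>k (#dx\<^sub>k f) (#dx\<^sub>k u\<^sub>1)\<close>. The last sum is \<open><J df, J du\<^sub>1>\<close>, since the components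
  of \<open>J df\<close> in the coframe are \<open>- #dx\<^sub>k f\<close>; and the signs \<open>\<epsilon>\<^sub>j\<close> of the vertical coframe add up to
  \<open>k\<^sub>2 - 2 q\<^sub>2\<close>.

  Two facts make these computations available for the given definitions. The Lie derivative, which is
  defined through an arbitrary local extension of a tangent vector, equals an expression in the
  components of one chart (\<open>lie_derivative_coord\<close>); this rests on the symmetry of second derivatives.
  The connection, which acts on global one-forms, is a local operator, and every local one-form agrees
  near a point with a global one (\<open>connection_local\<close>, \<open>oneform_extension\<close>); both use smooth bump
  functions.
\<close>

section \<open>Calculus of smooth maps between Euclidean spaces\<close>

lemma Ck_on_cong:
  assumes "open S" "\<And>x. x \<in> S \<Longrightarrow> f x = g x"
  shows "Ck_on k S f \<longleftrightarrow> Ck_on k S g"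
proof -
  have "Ck_on k S f \<Longrightarrow> (\<And>x. x \<in> S \<Longrightarrow> f x = g x) \<Longrightarrow> Ck_on k S g" for f g :: "'a \<Rightarrow> 'b"
  proof (induction k arbitrary: f g)
    case 0
    then show ?case using continuous_on_cong[of S S f g] by simp
  next
    case (Suc k)
    have d: "f differentiable_on S" using Suc.prems by simp
    have dg: "g differentiable_on S"
      using d Suc.prems(2) by (auto simp: differentiable_on_def intro: differentiable_transform_within[of _ _ _ 1])
    have "frechet_derivative f (at x) = frechet_derivative g (at x)" if "x \<in> S" for x
      using frechet_derivative_transform_within_open[of f x S g] d Suc.prems(2) that \<open>open S\<close>
      by (auto simp: differentiable_on_eq_differentiable_at)
    then have "Ck_on k S (\<lambda>x. frechet_derivative g (at x) v)" for v
      using Suc.IH[of "\<lambda>x. frechet_derivative f (at x) v" "\<lambda>x. frechet_derivative g (at x) v"] Suc.prems by simp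
    then show ?case using dg by simp
  qed
  then show ?thesis using assms(2) by metis
qed

lemma Ck_on_subset: "Ck_on k S f \<Longrightarrow> T \<subseteq> S \<Longrightarrow> Ck_on k T f"
  by (induction k arbitrary: f) (auto intro: continuous_on_subset differentiable_on_subset)

lemma Ck_on_Suc_D: "Ck_on (Suc k) S f \<Longrightarrow> Ck_on k S f"
proof (induction k arbitrary: f)
  case 0
  then show ?case by (simp add: differentiable_imp_continuous_on)
next
  case (Suc k)
  have "Ck_on k S (\<lambda>x. frechet_derivative f (at x) v)" for v
    using Suc.IH[of "\<lambda>x. frechet_derivative f (at x) v"] Suc.prems by simp
  moreover have "f differentiable_on S" using Suc.prems by (simp only: Ck_on.simps)
  ultimately show ?case by simp
qed

lemma Ck_on_local:
  assumes "open S" "\<And>x. x \<in> S \<Longrightarrow> \<exists>T. open T \<and> x \<in> T \<and> Ck_on k (T \<inter> S) f"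
  shows "Ck_on k S f"
  using assms(2)
proof (induction k arbitrary: f)
  case 0
  have "continuous (at x) f" if "x \<in> S" for x
  proof -
    obtain T where T: "open T" "x \<in> T" "continuous_on (T \<inter> S) f" using 0 \<open>x \<in> S\<close> by auto
    then show ?thesis using continuous_on_eq_continuous_at[of "T \<inter> S" f] assms(1) that by auto
  qed
  then show ?case by (simp add: continuous_at_imp_continuous_on)
next
  case (Suc k)
  have "f differentiable at x" if "x \<in> S" for x
  proof -
    obtain T where T: "open T" "x \<in> T" "f differentiable_on (T \<inter> S)" using Suc.prems \<open>x \<in> S\<close> by auto
    then show ?thesis using differentiable_on_eq_differentiable_at[of "T \<inter> S" f] assms(1) that by auto
  qed
  then have "f differentiable_on S" by (simp add: differentiable_at_imp_differentiable_on)
  moreover have "Ck_on k S (\<lambda>x. frechet_derivative f (at x) v)" for v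
    by (rule Suc.IH) (use Suc.prems in fastforce)
  ultimately show ?case by simp
qed

text \<open>
  The sum, product and chain rules below rest on this introduction rule: it suffices to name a
  derivative at each point and to show that its directional values are one order less smooth.
\<close>

lemma Ck_on_SucI:
  assumes "open S" "\<And>x. x \<in> S \<Longrightarrow> (f has_derivative f' x) (at x)" "\<And>v. Ck_on k S (\<lambda>x. f' x v)"
  shows "Ck_on (Suc k) S f"
proof -
  have "frechet_derivative f (at x) = f' x" if "x \<in> S" for x
    using frechet_derivative_at[OF assms(2)[OF that]] by simp
  then have "Ck_on k S (\<lambda>x. frechet_derivative f (at x) v)" for v
    using assms(3)[of v] Ck_on_cong[OF assms(1), of "\<lambda>x. f' x v" "\<lambda>x. frechet_derivative f (at x) v"] by simp
  moreover have "f differentiable_on S"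
    using assms(2) by (meson differentiableI differentiable_at_imp_differentiable_on)
  ultimately show ?thesis by simp
qed

lemma Ck_on_SucD:
  assumes "open S" "Ck_on (Suc k) S f" "x \<in> S"
  shows "(f has_derivative frechet_derivative f (at x)) (at x)"
  using assms by (metis Ck_on.simps(2) differentiable_on_eq_differentiable_at frechet_derivative_works)

lemma Ck_on_const: "Ck_on k S (\<lambda>x. c)"
  by (induction k arbitrary: c) simp_all

lemma Ck_on_bounded_linear_comp:
  assumes "open S" "bounded_linear L" "Ck_on k S f"
  shows "Ck_on k S (\<lambda>x. L (f x))"
  using assms(3)
proof (induction k arbitrary: f)
  case 0
  then show ?case using assms(2) by (simp add: linear_continuous_on_compose bounded_linear.continuous_on)
next
  case (Suc k)
  show ?case
  proof (rule Ck_on_SucI[OF assms(1), where f' = "\<lambda>x v. L (frechet_derivative f (at x) v)"])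
    show "((\<lambda>x. L (f x)) has_derivative (\<lambda>v. L (frechet_derivative f (at x) v))) (at x)" if "x \<in> S" for x
      by (rule bounded_linear.has_derivative[OF assms(2)]) (rule Ck_on_SucD[OF assms(1) Suc.prems that])
  qed (use Suc in simp)
qed

lemma Ck_on_add:
  assumes "open S" "Ck_on k S f" "Ck_on k S g"
  shows "Ck_on k S (\<lambda>x. f x + g x)"
  using assms(2,3)
proof (induction k arbitrary: f g)
  case 0
  then show ?case by (simp add: continuous_on_add)
next
  case (Suc k)
  show ?case
  proof (rule Ck_on_SucI[OF assms(1), where f' = "\<lambda>x v. frechet_derivative f (at x) v + frechet_derivative g (at x) v"])
    show "((\<lambda>x. f x + g x) has_derivative (\<lambda>v. frechet_derivative f (at x) v + frechet_derivative g (at x) v)) (at x)"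
      if "x \<in> S" for x
      using Ck_on_SucD[OF assms(1) Suc.prems(1) that] Ck_on_SucD[OF assms(1) Suc.prems(2) that]
      by (rule has_derivative_add)
  qed (use Suc in simp)
qed

text \<open>
  By Leibniz the derivative of \<open>B (f, g)\<close> is a sum of two terms of the same shape, with one factor
  differentiated, so the induction on the order closes on itself.
\<close>

lemma Ck_on_bilinear:
  assumes "open S" "bounded_bilinear B" "Ck_on k S f" "Ck_on k S g"
  shows "Ck_on k S (\<lambda>x. B (f x) (g x))"
  using assms(3,4)
proof (induction k arbitrary: f g)
  case 0
  then show ?case using assms(2) by (simp add: bounded_bilinear.continuous_on)
next
  case (Suc k)
  show ?case
  proof (rule Ck_on_SucI[OF assms(1), where f' = "\<lambda>x v. B (f x) (frechet_derivative g (at x) v) + B (frechet_derivative f (at x) v) (g x)"])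
    show "((\<lambda>x. B (f x) (g x)) has_derivative
        (\<lambda>v. B (f x) (frechet_derivative g (at x) v) + B (frechet_derivative f (at x) v) (g x))) (at x)"
      if "x \<in> S" for x
      using Ck_on_SucD[OF assms(1) Suc.prems(1) that] Ck_on_SucD[OF assms(1) Suc.prems(2) that]
      by (rule bounded_bilinear.FDERIV[OF assms(2)])
    show "Ck_on k S (\<lambda>x. B (f x) (frechet_derivative g (at x) v) + B (frechet_derivative f (at x) v) (g x))" for v
      using Suc.prems Ck_on_Suc_D[OF Suc.prems(1)] Ck_on_Suc_D[OF Suc.prems(2)]
      by (intro Ck_on_add assms(1) Suc.IH) auto
  qed
qed

lemma Ck_on_sum:
  assumes "open S" "\<And>i. i \<in> I \<Longrightarrow> Ck_on k S (f i)"
  shows "Ck_on k S (\<lambda>x. \<Sum>i\<in>I. f i x)"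
  using assms(2)
  by (induction I rule: infinite_finite_induct) (auto intro: Ck_on_const Ck_on_add assms(1))

text \<open>
  The chain rule nests the derivative of \<open>g\<close> inside that of \<open>f\<close>. Expanding the inner value in the
  standard basis turns the derivative of the composition into a sum of products of a derivative of \<open>g\<close>
  with a composition, to which the induction hypothesis applies.
\<close>

lemma Ck_on_compose:
  fixes g :: "'a::euclidean_space \<Rightarrow> 'b::euclidean_space" and f :: "'b \<Rightarrow> 'c::real_normed_vector"
  assumes "open S" "open T" "g ` S \<subseteq> T" "Ck_on k S g" "Ck_on k T f"
  shows "Ck_on k S (\<lambda>x. f (g x))"
  using assms(4,5)
proof (induction k arbitrary: f)
  case 0
  then show ?case using assms(3) continuous_on_compose2[of T f S g] by simp
next
  case (Suc k)
  show ?case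
  proof (rule Ck_on_SucI[OF assms(1), where f' = "\<lambda>x v. \<Sum>b\<in>Basis. (frechet_derivative g (at x) v \<bullet> b) *\<^sub>R frechet_derivative f (at (g x)) b"])
    fix x assume x: "x \<in> S"
    have gx: "g x \<in> T" using x assms(3) by auto
    have df: "(f has_derivative frechet_derivative f (at (g x))) (at (g x))"
      by (rule Ck_on_SucD[OF assms(2) Suc.prems(2) gx])
    have dg: "(g has_derivative frechet_derivative g (at x)) (at x)"
      by (rule Ck_on_SucD[OF assms(1) Suc.prems(1) x])
    have lin: "linear (frechet_derivative f (at (g x)))" using df by (rule has_derivative_linear)
    have ex: "frechet_derivative f (at (g x)) w = (\<Sum>b\<in>Basis. (w \<bullet> b) *\<^sub>R frechet_derivative f (at (g x)) b)" for w
    proof -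
      have "frechet_derivative f (at (g x)) (\<Sum>b\<in>Basis. (w \<bullet> b) *\<^sub>R b) = (\<Sum>b\<in>Basis. (w \<bullet> b) *\<^sub>R frechet_derivative f (at (g x)) b)"
        using lin by (simp add: linear_sum linear_cmul)
      then show ?thesis by (simp add: euclidean_representation)
    qed
    show "((\<lambda>x. f (g x)) has_derivative
       (\<lambda>v. \<Sum>b\<in>Basis. (frechet_derivative g (at x) v \<bullet> b) *\<^sub>R frechet_derivative f (at (g x)) b)) (at x)"
      by (rule has_derivative_eq_rhs[OF has_derivative_compose[OF dg df]]) (rule ext, rule ex)
  next
    fix v
    show "Ck_on k S (\<lambda>x. \<Sum>b\<in>Basis. (frechet_derivative g (at x) v \<bullet> b) *\<^sub>R frechet_derivative f (at (g x)) b)"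
    proof (rule Ck_on_sum[OF assms(1)], rule Ck_on_bilinear[OF assms(1) bounded_bilinear_scaleR])
      fix b :: 'b
      show "Ck_on k S (\<lambda>x. frechet_derivative g (at x) v \<bullet> b)"
        using Suc.prems(1) by (rule_tac Ck_on_bounded_linear_comp[OF assms(1) bounded_linear_inner_left]) simp
      show "Ck_on k S (\<lambda>x. frechet_derivative f (at (g x)) b)"
        by (rule Suc.IH[OF Ck_on_Suc_D[OF Suc.prems(1)]]) (use Suc.prems(2) in simp)
    qed
  qed
qed

lemma Ck_on_bounded_linear:
  assumes "open S" "bounded_linear L"
  shows "Ck_on k S L"
proof (cases k)
  case 0
  then show ?thesis using assms(2) by (simp add: linear_continuous_on)
next
  case (Suc n)
  show ?thesis unfolding Suc
    by (rule Ck_on_SucI[OF assms(1), where f' = "\<lambda>x v. L v"])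
       (simp_all add: Ck_on_const bounded_linear_imp_has_derivative assms)
qed

lemma smooth_on_cong:
  "open S \<Longrightarrow> (\<And>x. x \<in> S \<Longrightarrow> f x = g x) \<Longrightarrow> smooth_on S f \<longleftrightarrow> smooth_on S g"
  using Ck_on_cong[of S f g] by (auto simp: smooth_on_def)

lemma smooth_on_subset: "smooth_on S f \<Longrightarrow> T \<subseteq> S \<Longrightarrow> smooth_on T f"
  by (auto simp: smooth_on_def intro: Ck_on_subset)

lemma smooth_on_local:
  assumes "open S" "\<And>x. x \<in> S \<Longrightarrow> \<exists>T. open T \<and> x \<in> T \<and> smooth_on (T \<inter> S) f"
  shows "smooth_on S f"
  unfolding smooth_on_def using assms(2) by (intro allI Ck_on_local assms(1)) (metis smooth_on_def)

lemma smooth_on_const: "smooth_on S (\<lambda>x. c)"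
  by (simp add: smooth_on_def Ck_on_const)

lemma smooth_on_add: "open S \<Longrightarrow> smooth_on S f \<Longrightarrow> smooth_on S g \<Longrightarrow> smooth_on S (\<lambda>x. f x + g x)"
  by (simp add: smooth_on_def Ck_on_add)

lemma smooth_on_mult:
  fixes f g :: "'a::real_normed_vector \<Rightarrow> real"
  shows "open S \<Longrightarrow> smooth_on S f \<Longrightarrow> smooth_on S g \<Longrightarrow> smooth_on S (\<lambda>x. f x * g x)"
  by (simp add: smooth_on_def Ck_on_bilinear[OF _ bounded_bilinear_mult])

lemma smooth_on_inner:
  "open S \<Longrightarrow> smooth_on S f \<Longrightarrow> smooth_on S g \<Longrightarrow> smooth_on S (\<lambda>x. f x \<bullet> g x)"
  by (simp add: smooth_on_def Ck_on_bilinear[OF _ bounded_bilinear_inner])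

lemma smooth_on_bounded_linear: "open S \<Longrightarrow> bounded_linear L \<Longrightarrow> smooth_on S L"
  by (simp add: smooth_on_def Ck_on_bounded_linear)

lemma smooth_on_bounded_linear_comp:
  "open S \<Longrightarrow> bounded_linear L \<Longrightarrow> smooth_on S f \<Longrightarrow> smooth_on S (\<lambda>x. L (f x))"
  by (simp add: smooth_on_def Ck_on_bounded_linear_comp)

lemma smooth_on_compose:
  fixes g :: "'a::euclidean_space \<Rightarrow> 'b::euclidean_space" and f :: "'b \<Rightarrow> 'c::real_normed_vector"
  assumes "open S" "open T" "g ` S \<subseteq> T" "smooth_on S g" "smooth_on T f"
  shows "smooth_on S (\<lambda>x. f (g x))"
  using assms by (simp add: smooth_on_def Ck_on_compose[of S T g])

lemma smooth_on_Pair: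
  assumes "open S" "smooth_on S f" "smooth_on S g"
  shows "smooth_on S (\<lambda>x. (f x, g x))"
proof -
  have "smooth_on S (\<lambda>x. (f x, 0) + (0, g x))"
  proof (rule smooth_on_add[OF assms(1)])
    show "smooth_on S (\<lambda>x. (f x, 0))"
      by (rule smooth_on_bounded_linear_comp[of S "\<lambda>a. (a, 0)", OF assms(1) _ assms(2)])
         (rule bounded_linear_Pair[OF bounded_linear_ident bounded_linear_zero])
    show "smooth_on S (\<lambda>x. (0, g x))"
      by (rule smooth_on_bounded_linear_comp[of S "\<lambda>a. (0, a)", OF assms(1) _ assms(3)])
         (rule bounded_linear_Pair[OF bounded_linear_zero bounded_linear_ident])
  qed
  then show ?thesis by simp
qed

lemma smooth_on_frechet: "smooth_on S f \<Longrightarrow> smooth_on S (\<lambda>x. frechet_derivative f (at x) v)"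
  unfolding smooth_on_def by (metis Ck_on.simps(2))

lemma smooth_on_has_derivative:
  "open S \<Longrightarrow> smooth_on S f \<Longrightarrow> x \<in> S \<Longrightarrow> (f has_derivative frechet_derivative f (at x)) (at x)"
  unfolding smooth_on_def by (metis Ck_on_SucD)

lemma smooth_on_continuous: "smooth_on S f \<Longrightarrow> continuous_on S f"
  unfolding smooth_on_def by (metis Ck_on.simps(1))

section \<open>Symmetry of second derivatives\<close>

text \<open>
  The second difference of \<open>f\<close> over a parallelogram with edges \<open>t v\<close> and \<open>t w\<close> is a mixed second
  derivative at an intermediate point: two applications of the mean value theorem, one for each edge.
\<close>

lemma second_difference_mvt:
  fixes f :: "'a::real_normed_vector \<Rightarrow> real"
  assumes "open S" "smooth_on S f" "0 < t"
    and sub: "\<And>a b. 0 \<le> a \<Longrightarrow> a \<le> t \<Longrightarrow> 0 \<le> b \<Longrightarrow> b \<le> t \<Longrightarrow> x + a *\<^sub>R v + b *\<^sub>R w \<in> S"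
  shows "\<exists>a b. 0 \<le> a \<and> a \<le> t \<and> 0 \<le> b \<and> b \<le> t \<and>
    f (x + t *\<^sub>R v + t *\<^sub>R w) - f (x + t *\<^sub>R v) - f (x + t *\<^sub>R w) + f x
      = t * t * frechet_derivative (\<lambda>z. frechet_derivative f (at z) v) (at (x + a *\<^sub>R v + b *\<^sub>R w)) w"
proof -
  define fv where "fv = (\<lambda>z. frechet_derivative f (at z) v)"
  have line: "((\<lambda>s. h (y + s *\<^sub>R e)) has_real_derivative frechet_derivative h (at (y + s *\<^sub>R e)) e) (at s)"
    if "smooth_on S h" "y + s *\<^sub>R e \<in> S" for h :: "'a \<Rightarrow> real" and y s e
  proof -
    have h: "(h has_derivative frechet_derivative h (at (y + s *\<^sub>R e))) (at (y + s *\<^sub>R e))"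
      using smooth_on_has_derivative[OF assms(1) that] .
    have l: "((\<lambda>s. y + s *\<^sub>R e) has_derivative (\<lambda>r. r *\<^sub>R e)) (at s)"
      by (auto intro!: derivative_eq_intros)
    have "((\<lambda>s. h (y + s *\<^sub>R e)) has_derivative (\<lambda>r. frechet_derivative h (at (y + s *\<^sub>R e)) (r *\<^sub>R e))) (at s)"
      using has_derivative_compose[OF l h] .
    moreover have "frechet_derivative h (at (y + s *\<^sub>R e)) (r *\<^sub>R e) = frechet_derivative h (at (y + s *\<^sub>R e)) e * r" for r
      using has_derivative_linear[OF h] by (simp add: linear_cmul)
    ultimately show ?thesis by (simp add: has_field_derivative_def)
  qed
  \<comment> \<open>The increment of \<open>f\<close> along \<open>t w\<close>, as a function of the position on the edge \<open>s v\<close>.\<close>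
  define p where "p = (\<lambda>s. f ((x + t *\<^sub>R w) + s *\<^sub>R v) - f (x + s *\<^sub>R v))"
  have "\<exists>a>0. a < t \<and> p t - p 0 = (t - 0) * (fv ((x + t *\<^sub>R w) + a *\<^sub>R v) - fv (x + a *\<^sub>R v))"
    unfolding p_def fv_def
    apply (rule MVT2[OF assms(3)])
    apply (intro DERIV_diff line assms(2))
    subgoal for s using sub[of s t] assms(3) by (simp add: ac_simps)
    subgoal for s using sub[of s 0] assms(3) by simp
    done
  then obtain a where a: "0 < a" "a < t" "p t - p 0 = t * (fv ((x + t *\<^sub>R w) + a *\<^sub>R v) - fv (x + a *\<^sub>R v))"
    by auto
  have sfv: "smooth_on S fv" unfolding fv_def by (rule smooth_on_frechet[OF assms(2)])
  have "\<exists>b>0. b < t \<and> fv ((x + a *\<^sub>R v) + t *\<^sub>R w) - fv ((x + a *\<^sub>R v) + 0 *\<^sub>R w)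
     = (t - 0) * (frechet_derivative fv (at ((x + a *\<^sub>R v) + b *\<^sub>R w)) w)"
    apply (rule MVT2[OF assms(3)])
    apply (intro line sfv)
    subgoal for s using sub[of a s] assms(3) a by simp
    done
  then obtain b where b: "0 < b" "b < t" "fv ((x + a *\<^sub>R v) + t *\<^sub>R w) - fv (x + a *\<^sub>R v)
     = t * (frechet_derivative fv (at ((x + a *\<^sub>R v) + b *\<^sub>R w)) w)" by auto
  have "p t - p 0 = t * (t * (frechet_derivative fv (at ((x + a *\<^sub>R v) + b *\<^sub>R w)) w))"
    unfolding a(3) b(3)[symmetric] by (simp add: ac_simps)
  then show ?thesis
    using a b unfolding p_def fv_def
    by (intro exI[of _ a] exI[of _ b]) (simp add: ac_simps diff_diff_eq2 diff_add_eq)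
qed

text \<open>
  The second difference is symmetric in its two edges. Evaluating it by the mean value theorem in both
  orders yields equal values of the two mixed derivatives at points arbitrarily close to \<open>x\<close>, and
  continuity gives equality at \<open>x\<close>.
\<close>

lemma frechet_derivative_symmetric:
  fixes f :: "'a::real_normed_vector \<Rightarrow> real"
  assumes "open S" "smooth_on S f" "x \<in> S"
  shows "frechet_derivative (\<lambda>z. frechet_derivative f (at z) v) (at x) w
       = frechet_derivative (\<lambda>z. frechet_derivative f (at z) w) (at x) v"
proof -
  define A where "A = (\<lambda>y. frechet_derivative (\<lambda>z. frechet_derivative f (at z) v) (at y) w)"
  define B where "B = (\<lambda>y. frechet_derivative (\<lambda>z. frechet_derivative f (at z) w) (at y) v)"
  have c: "continuous (at x) A" "continuous (at x) B"
    using smooth_on_continuous[OF smooth_on_frechet[OF smooth_on_frechet[OF assms(2)]]] assms(1,3)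
    unfolding A_def B_def by (auto simp: continuous_on_eq_continuous_at)
  have "\<bar>A x - B x\<bar> < e" if "0 < e" for e
  proof -
    obtain d1 where d1: "0 < d1" "\<And>y. dist y x < d1 \<Longrightarrow> dist (A y) (A x) < e/2"
      using c(1) \<open>0 < e\<close> unfolding continuous_at_eps_delta by (metis half_gt_zero)
    obtain d2 where d2: "0 < d2" "\<And>y. dist y x < d2 \<Longrightarrow> dist (B y) (B x) < e/2"
      using c(2) \<open>0 < e\<close> unfolding continuous_at_eps_delta by (metis half_gt_zero)
    obtain d3 where d3: "0 < d3" "ball x d3 \<subseteq> S" using assms(1,3) by (meson open_contains_ball)
    define d where "d = min d1 (min d2 d3)"
    \<comment> \<open>Small enough for the whole parallelogram to stay within distance \<open>d\<close> of \<open>x\<close>.\<close>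
    define t where "t = d / (norm v + norm w + 1)"
    have d: "0 < d" using d1 d2 d3 by (simp add: d_def)
    then have t: "0 < t" by (simp add: t_def add_nonneg_pos)
    have near: "dist (x + a *\<^sub>R v + b *\<^sub>R w) x < d" if "0 \<le> a" "a \<le> t" "0 \<le> b" "b \<le> t" for a b
    proof -
      have "dist (x + a *\<^sub>R v + b *\<^sub>R w) x \<le> norm (a *\<^sub>R v) + norm (b *\<^sub>R w)"
        using norm_triangle_ineq[of "a *\<^sub>R v" "b *\<^sub>R w"] by (simp add: dist_norm add.assoc)
      also have "\<dots> \<le> t * norm v + t * norm w" using that by (simp add: add_mono mult_right_mono)
      also have "\<dots> < t * (norm v + norm w + 1)" using t by (simp add: algebra_simps)
      also have "\<dots> = d" unfolding t_def by (smt (verit) nonzero_divide_eq_eq norm_ge_zero)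
      finally show ?thesis .
    qed
    have inS: "x + a *\<^sub>R v + b *\<^sub>R w \<in> S" if "0 \<le> a" "a \<le> t" "0 \<le> b" "b \<le> t" for a b
      using near[OF that] d3(2) by (auto simp: d_def dist_commute)
    have "\<exists>a b. 0 \<le> a \<and> a \<le> t \<and> 0 \<le> b \<and> b \<le> t \<and>
      f (x + t *\<^sub>R v + t *\<^sub>R w) - f (x + t *\<^sub>R v) - f (x + t *\<^sub>R w) + f x = t * t * A (x + a *\<^sub>R v + b *\<^sub>R w)"
      unfolding A_def by (rule second_difference_mvt[OF assms(1,2) t inS])
    then obtain a b where ab: "0 \<le> a" "a \<le> t" "0 \<le> b" "b \<le> t"
      "f (x + t *\<^sub>R v + t *\<^sub>R w) - f (x + t *\<^sub>R v) - f (x + t *\<^sub>R w) + f x = t * t * A (x + a *\<^sub>R v + b *\<^sub>R w)"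
      by blast
    have inS': "x + a *\<^sub>R w + b *\<^sub>R v \<in> S" if "0 \<le> a" "a \<le> t" "0 \<le> b" "b \<le> t" for a b
      using inS[OF that(3,4,1,2)] by (simp add: ac_simps)
    have "\<exists>a' b'. 0 \<le> a' \<and> a' \<le> t \<and> 0 \<le> b' \<and> b' \<le> t \<and>
      f (x + t *\<^sub>R w + t *\<^sub>R v) - f (x + t *\<^sub>R w) - f (x + t *\<^sub>R v) + f x = t * t * B (x + a' *\<^sub>R w + b' *\<^sub>R v)"
      unfolding B_def by (rule second_difference_mvt[OF assms(1,2) t inS'])
    then obtain a' b' where ab': "0 \<le> a'" "a' \<le> t" "0 \<le> b'" "b' \<le> t"
      "f (x + t *\<^sub>R w + t *\<^sub>R v) - f (x + t *\<^sub>R w) - f (x + t *\<^sub>R v) + f x = t * t * B (x + a' *\<^sub>R w + b' *\<^sub>R v)"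
      by blast
    have "t * t * A (x + a *\<^sub>R v + b *\<^sub>R w) = t * t * B (x + b' *\<^sub>R v + a' *\<^sub>R w)"
      unfolding ab(5)[symmetric] using ab'(5) by (simp add: ac_simps)
    then have eq: "A (x + a *\<^sub>R v + b *\<^sub>R w) = B (x + b' *\<^sub>R v + a' *\<^sub>R w)" using t by simp
    have "dist (A (x + a *\<^sub>R v + b *\<^sub>R w)) (A x) < e/2"
      using d1(2) near[OF ab(1-4)] by (simp add: d_def)
    moreover have "dist (B (x + b' *\<^sub>R v + a' *\<^sub>R w)) (B x) < e/2"
      using d2(2) near[OF ab'(3,4,1,2)] by (simp add: d_def)
    ultimately show ?thesis unfolding eq by (simp add: dist_real_def abs_if split: if_splits)
  qed
  then have "A x - B x = 0" by (metis less_irrefl zero_less_abs_iff)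
  then show ?thesis by (simp add: A_def B_def)
qed

section \<open>Smooth bump functions on a Euclidean space\<close>

text \<open>
  For \<open>m = 0\<close> this is the classical function \<open>exp (-1/t)\<close>, extended by 0. The factors \<open>t\<^sup>-\<^sup>m\<close> make the
  family closed under differentiation up to linear combinations.
\<close>

definition flat_fun :: "nat \<Rightarrow> real \<Rightarrow> real" where
  "flat_fun m t = (if t \<le> 0 then 0 else inverse t ^ m * exp (- inverse t))"

lemma flat_fun_tendsto_0: "(flat_fun m \<longlongrightarrow> 0) (at_right 0)"
proof -
  have "((\<lambda>y::real. y ^ m / exp y) \<longlongrightarrow> 0) at_top" by (rule tendsto_power_div_exp_0)
  then have "((\<lambda>t::real. inverse t ^ m / exp (inverse t)) \<longlongrightarrow> 0) (at_right 0)"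
    by (rule filterlim_compose[OF _ filterlim_inverse_at_top_right])
  moreover have "\<forall>\<^sub>F t in at_right 0. inverse t ^ m / exp (inverse t) = flat_fun m t"
    by (auto simp: eventually_at_right_less flat_fun_def exp_minus divide_inverse
        intro!: eventually_mono[OF eventually_at_right_less])
  ultimately show ?thesis by (rule Lim_transform_eventually)
qed

text \<open>
  At 0 the difference quotient of \<open>flat_fun m\<close> is \<open>flat_fun (Suc m)\<close>, which tends to 0 because the
  exponential beats every power.
\<close>

lemma flat_fun_deriv:
  "(flat_fun m has_real_derivative - real m * flat_fun (Suc m) t + flat_fun (m+2) t) (at t)"
proof -
  consider "t < 0" | "t > 0" | "t = 0" by linarith
  then show ?thesis
  proof cases
    case 1
    have "((\<lambda>t. 0) has_real_derivative 0) (at t)" by simp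
    then have "(flat_fun m has_real_derivative 0) (at t)"
      by (rule has_field_derivative_transform_within_open[where S = "{..<0}"]) (use 1 in \<open>auto simp: flat_fun_def\<close>)
    then show ?thesis using 1 by (simp add: flat_fun_def)
  next
    case 2
    have "((\<lambda>t. inverse t ^ m * exp (- inverse t)) has_real_derivative
        - real m * (inverse t ^ Suc m * exp (- inverse t)) + inverse t ^ (m+2) * exp (- inverse t)) (at t)"
    proof -
      have i: "(inverse has_real_derivative - (inverse t ^ 2)) (at t)"
        using DERIV_inverse[of t] 2 by (simp add: power2_eq_square)
      define y where "y = inverse t"
      have "((\<lambda>t. inverse t ^ m * exp (- inverse t)) has_real_derivative
         real m * (- (y ^ 2) * y ^ (m - Suc 0)) * exp (- y) + exp (- y) * - (- (y ^ 2)) * y ^ m) (at t)"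
        using DERIV_mult[OF DERIV_power[OF i, of m] DERIV_fun_exp[OF DERIV_minus[OF i]]] by (simp add: y_def)
      moreover have "real m * (- (y ^ 2) * y ^ (m - Suc 0)) = - real m * y ^ Suc m"
        by (cases m) (simp_all add: power2_eq_square algebra_simps)
      ultimately have "((\<lambda>t. inverse t ^ m * exp (- inverse t)) has_real_derivative
         - real m * y ^ Suc m * exp (- y) + exp (- y) * - (- (y ^ 2)) * y ^ m) (at t)" by metis
      then show ?thesis
        by (rule DERIV_cong) (simp add: y_def power2_eq_square)
    qed
    then have "(flat_fun m has_real_derivative
        - real m * (inverse t ^ Suc m * exp (- inverse t)) + inverse t ^ (m+2) * exp (- inverse t)) (at t)"
      by (rule has_field_derivative_transform_within_open[where S = "{0<..}"]) (use 2 in \<open>auto simp: flat_fun_def\<close>)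
    then show ?thesis using 2 by (simp add: flat_fun_def)
  next
    case 3
    have "((\<lambda>h. (flat_fun m (0 + h) - flat_fun m 0) / h) \<longlongrightarrow> 0) (at 0)"
    proof (rule filterlim_split_at)
      have "\<forall>\<^sub>F h in at_left 0. (flat_fun m (0 + h) - flat_fun m 0) / h = (0::real)"
        by (auto simp: flat_fun_def eventually_at_filter)
      then show "((\<lambda>h. (flat_fun m (0 + h) - flat_fun m 0) / h) \<longlongrightarrow> 0) (at_left 0)"
        by (rule tendsto_eventually)
      have "\<forall>\<^sub>F h in at_right 0. flat_fun (Suc m) h = (flat_fun m (0 + h) - flat_fun m 0) / h"
        by (auto simp: flat_fun_def eventually_at_filter divide_inverse)
      then show "((\<lambda>h. (flat_fun m (0 + h) - flat_fun m 0) / h) \<longlongrightarrow> 0) (at_right 0)"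
        by (rule Lim_transform_eventually[OF flat_fun_tendsto_0])
    qed
    then show ?thesis unfolding 3 DERIV_def by (simp add: flat_fun_def)
  qed
qed

lemma smooth_on_flat_fun: "smooth_on UNIV (flat_fun m)"
proof -
  have "Ck_on k UNIV (flat_fun m)" for k
  proof (induction k arbitrary: m)
    case 0
    show ?case using flat_fun_deriv DERIV_isCont continuous_at_imp_continuous_on by (metis Ck_on.simps(1))
  next
    case (Suc k)
    show ?case
    proof (rule Ck_on_SucI[where f' = "\<lambda>t v. (- real m * flat_fun (Suc m) t + flat_fun (m+2) t) * v"])
      show "Ck_on k UNIV (\<lambda>x. (- real m * flat_fun (Suc m) x + flat_fun (m + 2) x) * v)" for v
        by (intro Ck_on_bilinear[OF _ bounded_bilinear_mult] Ck_on_add Ck_on_const Suc.IH) auto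
    qed (use flat_fun_deriv in \<open>auto simp: has_field_derivative_def\<close>)
  qed
  then show ?thesis by (simp add: smooth_on_def)
qed

lemma flat_fun_0_eq: "t \<le> 0 \<Longrightarrow> flat_fun m t = 0" by (simp add: flat_fun_def)

text \<open>
  With \<open>h = flat_fun 0\<close>, the function \<open>h (c - h (|z - a|\<^sup>2 - r\<^sup>2/4)) / h c\<close> has the required properties. The
  inner \<open>h\<close> vanishes on the ball of radius \<open>r/2\<close>; outside the ball of radius \<open>r\<close> it is at least
  \<open>c = h (3 r\<^sup>2/4)\<close> by monotonicity, where the outer \<open>h\<close> vanishes. Only a constant is inverted.
\<close>

lemma euclidean_bump:
  fixes a :: "'e::euclidean_space"
  assumes "0 < r"
  obtains \<psi> :: "'e \<Rightarrow> real" where "smooth_on UNIV \<psi>" "\<And>z. z \<notin> cball a r \<Longrightarrow> \<psi> z = 0"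
    "\<And>z. z \<in> ball a (r/2) \<Longrightarrow> \<psi> z = 1"
proof -
  define c where "c = flat_fun 0 (3 * r\<^sup>2 / 4)"
  define \<psi> where "\<psi> = (\<lambda>z::'e. inverse (flat_fun 0 c) * flat_fun 0 (c + (-1) * flat_fun 0 ((z - a) \<bullet> (z - a) + (- (r\<^sup>2 / 4)))))"
  have c: "0 < c" using assms by (simp add: c_def flat_fun_def)
  have m: "flat_fun 0 s \<le> flat_fun 0 t" if "s \<le> t" for s t
    using that by (auto simp: flat_fun_def le_imp_inverse_le)
  have 1: "smooth_on UNIV (\<lambda>z. z + - a)"
    by (intro smooth_on_add smooth_on_const smooth_on_bounded_linear) (auto intro: bounded_linear_ident)
  have "smooth_on UNIV \<psi>" unfolding \<psi>_def diff_conv_add_uminus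
    by (intro smooth_on_mult smooth_on_add smooth_on_const smooth_on_inner 1
          smooth_on_compose[OF _ _ _ _ smooth_on_flat_fun]) auto
  moreover have "\<psi> z = 0" if "z \<notin> cball a r" for z
  proof -
    have "r < norm (z - a)" using that by (simp add: dist_norm norm_minus_commute)
    then have "r\<^sup>2 \<le> (z - a) \<bullet> (z - a)" using assms by (simp add: dot_square_norm power_mono)
    then have "c \<le> flat_fun 0 ((z - a) \<bullet> (z - a) + (- (r\<^sup>2 / 4)))" unfolding c_def by (intro m) simp
    then show ?thesis by (simp add: \<psi>_def flat_fun_0_eq)
  qed
  moreover have "\<psi> z = 1" if "z \<in> ball a (r/2)" for z
  proof -
    have "norm (z - a) < r / 2" using that by (simp add: dist_norm norm_minus_commute)
    then have "(norm (z - a))\<^sup>2 \<le> (r/2)\<^sup>2" by (intro power_mono) auto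
    then have "(z - a) \<bullet> (z - a) \<le> r\<^sup>2/4" by (simp add: dot_square_norm power_divide)
    then have "flat_fun 0 ((z - a) \<bullet> (z - a) + (- (r\<^sup>2 / 4))) = 0" by (intro flat_fun_0_eq) simp
    moreover have "flat_fun 0 c \<noteq> 0" using c by (simp add: flat_fun_def)
    ultimately show ?thesis by (simp add: \<psi>_def)
  qed
  ultimately show ?thesis using that by blast
qed

section \<open>Smooth functions on a manifold\<close>

locale manifold =
  fixes A :: "('m::{t2_space,second_countable_topology}, 'e::euclidean_space) atlas"
  assumes smooth_manifold: "smooth_manifold A"
begin

lemma chart_open: "c \<in> A \<Longrightarrow> open (fst c)"
  using smooth_manifold by (simp add: smooth_manifold_def)

lemma chart_homeo: "c \<in> A \<Longrightarrow> homeomorphism (fst c) (snd c ` fst c) (snd c) (chart_inv c)"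
  using smooth_manifold by (simp add: smooth_manifold_def)

lemma chart_image_open:
  assumes "c \<in> A" "open W"
  shows "open (snd c ` (fst c \<inter> W))"
proof -
  have "open (snd c ` fst c)" using smooth_manifold assms(1) by (simp add: smooth_manifold_def)
  moreover have "openin (top_of_set (fst c)) (fst c \<inter> W)" using assms(2) by (rule openin_open_Int)
  then have "openin (top_of_set (snd c ` fst c)) (snd c ` (fst c \<inter> W))"
    by (rule homeomorphism_imp_open_map[OF chart_homeo[OF assms(1)]])
  ultimately show ?thesis using openin_open_trans by blast
qed

lemma chart_image_open': "c \<in> A \<Longrightarrow> open W \<Longrightarrow> W \<subseteq> fst c \<Longrightarrow> open (snd c ` W)"
  using chart_image_open[of c W] by (simp add: inf.absorb2)

lemma chart_inv_chart [simp]: "c \<in> A \<Longrightarrow> x \<in> fst c \<Longrightarrow> chart_inv c (snd c x) = x"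
  using chart_homeo by (metis homeomorphism_apply1)

lemma chart_cover: obtains c where "c \<in> A" "p \<in> fst c"
proof -
  have "p \<in> (\<Union>c\<in>A. fst c)" using smooth_manifold by (simp add: smooth_manifold_def)
  then show ?thesis using that by blast
qed

lemma transition_smooth:
  "c \<in> A \<Longrightarrow> c' \<in> A \<Longrightarrow> smooth_on (snd c ` (fst c \<inter> fst c')) (\<lambda>z. snd c' (chart_inv c z))"
  using smooth_manifold by (simp add: smooth_manifold_def comp_def)

lemma smooth_fun_onD:
  "smooth_fun_on A W u \<Longrightarrow> c \<in> A \<Longrightarrow> smooth_on (snd c ` (fst c \<inter> W)) (\<lambda>z. u (chart_inv c z))"
  by (simp add: smooth_fun_on_def comp_def)

lemma smooth_fun_on_cong:
  assumes "open W" "\<And>x. x \<in> W \<Longrightarrow> u x = v x"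
  shows "smooth_fun_on A W u \<longleftrightarrow> smooth_fun_on A W v"
proof -
  have "smooth_on (snd c ` (fst c \<inter> W)) (u \<circ> chart_inv c) = smooth_on (snd c ` (fst c \<inter> W)) (v \<circ> chart_inv c)"
    if "c \<in> A" for c
    by (rule smooth_on_cong[OF chart_image_open[OF that assms(1)]]) (use assms(2) that in auto)
  then show ?thesis by (simp add: smooth_fun_on_def)
qed

lemma smooth_fun_on_subset: "smooth_fun_on A W u \<Longrightarrow> W' \<subseteq> W \<Longrightarrow> smooth_fun_on A W' u"
  unfolding smooth_fun_on_def by (meson smooth_on_subset image_mono Int_mono order_refl)

lemma smooth_fun_on_local:
  assumes "open W" "\<And>p. p \<in> W \<Longrightarrow> \<exists>V. open V \<and> p \<in> V \<and> smooth_fun_on A V u"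
  shows "smooth_fun_on A W u"
  unfolding smooth_fun_on_def
proof
  fix c assume c: "c \<in> A"
  show "smooth_on (snd c ` (fst c \<inter> W)) (u \<circ> chart_inv c)"
  proof (rule smooth_on_local[OF chart_image_open[OF c assms(1)]])
    fix z assume "z \<in> snd c ` (fst c \<inter> W)"
    then obtain p where p: "p \<in> fst c" "p \<in> W" "z = snd c p" by auto
    obtain V where V: "open V" "p \<in> V" "smooth_fun_on A V u" using assms(2)[OF p(2)] by auto
    have "smooth_on (snd c ` (fst c \<inter> V)) (u \<circ> chart_inv c)"
      using V(3) c by (simp add: smooth_fun_on_def)
    then show "\<exists>T. open T \<and> z \<in> T \<and> smooth_on (T \<inter> snd c ` (fst c \<inter> W)) (u \<circ> chart_inv c)"
      using chart_image_open[OF c V(1)] V(2) p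
      by (intro exI[of _ "snd c ` (fst c \<inter> V)"]) (auto intro: smooth_on_subset)
  qed
qed

text \<open>
  Smoothness has to be checked in all charts of the atlas; on the domain of one chart the transition
  maps transfer it from that chart to the others.
\<close>

lemma smooth_fun_on_chart:
  assumes c: "c \<in> A" and W: "open W" "W \<subseteq> fst c" and u: "smooth_on (snd c ` W) (\<lambda>z. u (chart_inv c z))"
  shows "smooth_fun_on A W u"
  unfolding smooth_fun_on_def
proof
  fix c' assume c': "c' \<in> A"
  have o: "open (snd c' ` (fst c' \<inter> W))" by (rule chart_image_open[OF c' W(1)])
  have "smooth_on (snd c' ` (fst c' \<inter> W)) (\<lambda>z. (\<lambda>z. u (chart_inv c z)) (snd c (chart_inv c' z)))"
  proof (rule smooth_on_compose[OF o chart_image_open'[OF c W] _ _ u])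
    show "(\<lambda>z. snd c (chart_inv c' z)) ` snd c' ` (fst c' \<inter> W) \<subseteq> snd c ` W" using c' by auto
    show "smooth_on (snd c' ` (fst c' \<inter> W)) (\<lambda>z. snd c (chart_inv c' z))"
      by (rule smooth_on_subset[OF transition_smooth[OF c' c]]) (use W in auto)
  qed
  then show "smooth_on (snd c' ` (fst c' \<inter> W)) (u \<circ> chart_inv c')"
    by (rule smooth_on_cong[OF o, THEN iffD1, rotated]) (use c c' W in auto)
qed

lemma smooth_fun_on_const: "smooth_fun_on A W (\<lambda>x. k)"
  by (simp add: smooth_fun_on_def comp_def smooth_on_const)

lemma smooth_fun_on_add:
  assumes "open W" "smooth_fun_on A W u" "smooth_fun_on A W v"
  shows "smooth_fun_on A W (\<lambda>x. u x + v x)"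
  using assms unfolding smooth_fun_on_def comp_def
  by (auto intro!: smooth_on_add chart_image_open)

lemma smooth_fun_on_mult:
  assumes "open W" "smooth_fun_on A W u" "smooth_fun_on A W v"
  shows "smooth_fun_on A W (\<lambda>x. u x * v x)"
  using assms unfolding smooth_fun_on_def comp_def
  by (auto intro!: smooth_on_mult chart_image_open)

lemma smooth_fun_on_sum:
  assumes "open W" "\<And>i. i \<in> I \<Longrightarrow> smooth_fun_on A W (u i)"
  shows "smooth_fun_on A W (\<lambda>x. \<Sum>i\<in>I. u i x)"
  using assms(2)
  by (induction I rule: infinite_finite_induct) (auto intro: smooth_fun_on_const smooth_fun_on_add assms(1))

lemma smooth_fun_on_coord:
  assumes "c \<in> A" shows "smooth_fun_on A (fst c) (\<lambda>x. snd c x \<bullet> b)"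
proof (rule smooth_fun_on_chart[OF assms chart_open[OF assms] order_refl])
  have o: "open (snd c ` fst c)" using chart_image_open[OF assms open_UNIV] by simp
  have "smooth_on (snd c ` fst c) (\<lambda>z. z \<bullet> b)"
    by (rule smooth_on_bounded_linear[OF o bounded_linear_inner_left])
  then show "smooth_on (snd c ` fst c) (\<lambda>z. snd c (chart_inv c z) \<bullet> b)"
    by (rule smooth_on_cong[OF o, THEN iffD1, rotated]) (use assms in auto)
qed

lemma smooth_atI: "open W \<Longrightarrow> p \<in> W \<Longrightarrow> smooth_fun_on A W u \<Longrightarrow> smooth_at A p u"
  by (auto simp: smooth_at_def)

lemma smooth_funD: "smooth_fun A u \<Longrightarrow> smooth_fun_on A W u"
  unfolding smooth_fun_def by (erule smooth_fun_on_subset) simp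

lemma smooth_fun_smooth_at: "smooth_fun A u \<Longrightarrow> smooth_at A p u"
  unfolding smooth_fun_def smooth_at_def by blast

lemma smooth_at_cong:
  assumes "\<forall>\<^sub>F x in nhds p. u x = v x"
  shows "smooth_at A p u \<longleftrightarrow> smooth_at A p v"
proof -
  have "smooth_at A p u \<Longrightarrow> smooth_at A p v" if "\<forall>\<^sub>F x in nhds p. u x = v x" for u v :: "'m \<Rightarrow> real"
  proof -
    assume "smooth_at A p u"
    then obtain W where W: "open W" "p \<in> W" "smooth_fun_on A W u" by (auto simp: smooth_at_def)
    obtain V where V: "open V" "p \<in> V" "\<And>x. x \<in> V \<Longrightarrow> u x = v x"
      using \<open>\<forall>\<^sub>F x in nhds p. u x = v x\<close> by (auto simp: eventually_nhds)
    have "smooth_fun_on A (W \<inter> V) u" using W(3) by (rule smooth_fun_on_subset) simp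
    then have "smooth_fun_on A (W \<inter> V) v"
      by (rule smooth_fun_on_cong[THEN iffD1, rotated -1]) (use W V in auto)
    then show "smooth_at A p v" by (intro smooth_atI[of "W \<inter> V"]) (use W V in auto)
  qed
  from this[of u v] this[of v u] assms show ?thesis by (auto simp: eq_commute)
qed

lemma smooth_fun_on_of_smooth_at:
  assumes "open W" "\<And>p. p \<in> W \<Longrightarrow> smooth_at A p u"
  shows "smooth_fun_on A W u"
  by (rule smooth_fun_on_local[OF assms(1)]) (use assms(2) in \<open>auto simp: smooth_at_def\<close>)

lemma smooth_at_const: "smooth_at A p (\<lambda>x. k)"
  by (rule smooth_atI[OF open_UNIV _ smooth_fun_on_const]) simp

lemma smooth_at_binop:
  assumes "\<And>W. open W \<Longrightarrow> smooth_fun_on A W u \<Longrightarrow> smooth_fun_on A W v \<Longrightarrow> smooth_fun_on A W w"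
  shows "smooth_at A p u \<Longrightarrow> smooth_at A p v \<Longrightarrow> smooth_at A p w"
proof -
  assume "smooth_at A p u" "smooth_at A p v"
  then obtain W V where "open W" "p \<in> W" "smooth_fun_on A W u" "open V" "p \<in> V" "smooth_fun_on A V v"
    by (auto simp: smooth_at_def)
  then show "smooth_at A p w"
    by (intro smooth_atI[of "W \<inter> V"] assms) (auto intro: smooth_fun_on_subset)
qed

lemma smooth_at_add: "smooth_at A p u \<Longrightarrow> smooth_at A p v \<Longrightarrow> smooth_at A p (\<lambda>x. u x + v x)"
  by (rule smooth_at_binop[of u v]) (rule smooth_fun_on_add)

lemma smooth_at_mult: "smooth_at A p u \<Longrightarrow> smooth_at A p v \<Longrightarrow> smooth_at A p (\<lambda>x. u x * v x)"
  by (rule smooth_at_binop[of u v]) (rule smooth_fun_on_mult)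

lemma smooth_at_sum:
  assumes "\<And>i. i \<in> I \<Longrightarrow> smooth_at A p (u i)"
  shows "smooth_at A p (\<lambda>x. \<Sum>i\<in>I. u i x)"
  using assms
  by (induction I rule: infinite_finite_induct) (auto intro: smooth_at_const smooth_at_add)

lemma smooth_at_coord: "c \<in> A \<Longrightarrow> p \<in> fst c \<Longrightarrow> smooth_at A p (\<lambda>x. snd c x \<bullet> b)"
  by (rule smooth_atI[OF chart_open _ smooth_fun_on_coord])

lemma smooth_at_has_derivative:
  assumes "c \<in> A" "p \<in> fst c" "smooth_at A p u"
  shows "((\<lambda>z. u (chart_inv c z)) has_derivative frechet_derivative (\<lambda>z. u (chart_inv c z)) (at (snd c p))) (at (snd c p))"
proof -
  obtain W where W: "open W" "p \<in> W" "smooth_fun_on A W u" using assms(3) by (auto simp: smooth_at_def)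
  show ?thesis
    by (rule smooth_on_has_derivative[OF chart_image_open[OF assms(1) W(1)] smooth_fun_onD[OF W(3) assms(1)]])
       (use assms W in auto)
qed

section \<open>Tangent vectors\<close>

lemma coord_vec_eq:
  "smooth_at A p u \<Longrightarrow> coord_vec A c v p u = frechet_derivative (\<lambda>z. u (chart_inv c z)) (at (snd c p)) v"
  by (simp add: coord_vec_def comp_def)

lemma coord_vec_eqI:
  "smooth_at A p u \<Longrightarrow> ((\<lambda>z. u (chart_inv c z)) has_derivative D) (at (snd c p)) \<Longrightarrow> coord_vec A c v p u = D v"
  by (simp add: coord_vec_eq frechet_derivative_at[symmetric])

lemma not_smooth_coord_vec: "\<not> smooth_at A p u \<Longrightarrow> coord_vec A c v p u = 0"
  by (simp add: coord_vec_def)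

lemma coord_vec_linear:
  assumes "c \<in> A" "p \<in> fst c"
  shows "coord_vec A c (a *\<^sub>R v + b *\<^sub>R w) p = (\<lambda>u. a * coord_vec A c v p u + b * coord_vec A c w p u)"
proof
  fix u
  show "coord_vec A c (a *\<^sub>R v + b *\<^sub>R w) p u = a * coord_vec A c v p u + b * coord_vec A c w p u"
  proof (cases "smooth_at A p u")
    case True
    have "linear (frechet_derivative (\<lambda>z. u (chart_inv c z)) (at (snd c p)))"
      by (rule has_derivative_linear[OF smooth_at_has_derivative[OF assms True]])
    then show ?thesis using True by (simp add: coord_vec_eq linear_add linear_cmul)
  qed (simp add: not_smooth_coord_vec)
qed

lemma coord_vec_0: "c \<in> A \<Longrightarrow> p \<in> fst c \<Longrightarrow> coord_vec A c 0 p = (\<lambda>u. 0)"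
  using coord_vec_linear[of c p 0 0 0 0] by simp

lemma coord_vec_sum:
  assumes "c \<in> A" "p \<in> fst c"
  shows "coord_vec A c (\<Sum>i\<in>I. a i *\<^sub>R v i) p = (\<lambda>u. \<Sum>i\<in>I. a i * coord_vec A c (v i) p u)"
proof (induction I rule: infinite_finite_induct)
  case (insert i I)
  have "coord_vec A c (\<Sum>i\<in>insert i I. a i *\<^sub>R v i) p = coord_vec A c (a i *\<^sub>R v i + 1 *\<^sub>R (\<Sum>i\<in>I. a i *\<^sub>R v i)) p"
    using insert by simp
  also have "\<dots> = (\<lambda>u. \<Sum>i\<in>insert i I. a i * coord_vec A c (v i) p u)"
    unfolding coord_vec_linear[OF assms] insert.IH using insert.hyps by simp
  finally show ?case .
qed (simp_all add: coord_vec_0 assms)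

lemma coord_vec_coord:
  assumes "c \<in> A" "p \<in> fst c"
  shows "coord_vec A c v p (\<lambda>x. snd c x \<bullet> b) = v \<bullet> b"
proof (rule coord_vec_eqI[OF smooth_at_coord[OF assms]])
  have "((\<lambda>z. z \<bullet> b) has_derivative (\<lambda>v. v \<bullet> b)) (at (snd c p))"
    by (rule bounded_linear_imp_has_derivative[OF bounded_linear_inner_left])
  then show "((\<lambda>z. snd c (chart_inv c z) \<bullet> b) has_derivative (\<lambda>v. v \<bullet> b)) (at (snd c p))"
    by (rule has_derivative_transform_within_open[OF _ chart_image_open'[OF assms(1) chart_open[OF assms(1)] order_refl]])
       (use assms in auto)
qed

text \<open>
  The chain rule, applied to the transition map between the two charts.
\<close>

lemma coord_vec_change_chart:
  assumes "c \<in> A" "p \<in> fst c" "c' \<in> A" "p \<in> fst c'"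
  shows "\<exists>w. coord_vec A c' v p = coord_vec A c w p"
proof -
  define t where "t = (\<lambda>z. snd c (chart_inv c' z))"
  have o: "open (snd c' ` (fst c' \<inter> fst c))" by (rule chart_image_open[OF assms(3) chart_open[OF assms(1)]])
  have t: "(t has_derivative frechet_derivative t (at (snd c' p))) (at (snd c' p))"
    unfolding t_def by (rule smooth_on_has_derivative[OF o transition_smooth]) (use assms in auto)
  have tp: "t (snd c' p) = snd c p" using assms by (simp add: t_def)
  have "coord_vec A c' v p u = coord_vec A c (frechet_derivative t (at (snd c' p)) v) p u" for u
  proof (cases "smooth_at A p u")
    case True
    have "((\<lambda>z. u (chart_inv c z)) has_derivative frechet_derivative (\<lambda>z. u (chart_inv c z)) (at (t (snd c' p)))) (at (t (snd c' p)))"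
      unfolding tp by (rule smooth_at_has_derivative[OF assms(1,2) True])
    from has_derivative_compose[OF t this]
    have "((\<lambda>z. u (chart_inv c' z)) has_derivative
       (\<lambda>v. frechet_derivative (\<lambda>z. u (chart_inv c z)) (at (t (snd c' p))) (frechet_derivative t (at (snd c' p)) v))) (at (snd c' p))"
      by (rule has_derivative_transform_within_open[OF _ o]) (use assms in \<open>auto simp: t_def\<close>)
    from coord_vec_eqI[OF True this] show ?thesis using coord_vec_eq[OF True] by (simp add: tp)
  qed (simp add: not_smooth_coord_vec)
  then show ?thesis by (intro exI[of _ "frechet_derivative t (at (snd c' p)) v"] ext)
qed

text \<open>
  A tangent vector comes with a chart of its own. This lets every argument about several tangent
  vectors at a point use one common chart.
\<close>

lemma tangent_space_eq_range:
  assumes "c \<in> A" "p \<in> fst c"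
  shows "tangent_space A p = range (\<lambda>v. coord_vec A c v p)"
proof
  show "tangent_space A p \<subseteq> range (\<lambda>v. coord_vec A c v p)"
    using coord_vec_change_chart[OF assms] unfolding tangent_space_def by blast
  show "range (\<lambda>v. coord_vec A c v p) \<subseteq> tangent_space A p"
    using assms unfolding tangent_space_def by blast
qed

lemma coord_vec_tangent: "c \<in> A \<Longrightarrow> p \<in> fst c \<Longrightarrow> coord_vec A c v p \<in> tangent_space A p"
  using tangent_space_eq_range by blast

lemma tangentE:
  assumes "X \<in> tangent_space A p"
  obtains c v where "c \<in> A" "p \<in> fst c" "X = coord_vec A c v p"
  using assms by (auto simp: tangent_space_def)

lemma tangent_eq_coord_vec:
  assumes "c \<in> A" "p \<in> fst c" "X \<in> tangent_space A p"
  shows "X = coord_vec A c (\<Sum>b\<in>Basis. X (\<lambda>x. snd c x \<bullet> b) *\<^sub>R b) p"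
proof -
  obtain v where X: "X = coord_vec A c v p" using assms tangent_space_eq_range by auto
  show ?thesis unfolding X coord_vec_coord[OF assms(1,2)] euclidean_representation by simp
qed

lemma tangent_expand:
  assumes "c \<in> A" "p \<in> fst c" "X \<in> tangent_space A p"
  shows "X = (\<lambda>u. \<Sum>b\<in>Basis. X (\<lambda>x. snd c x \<bullet> b) * coord_vec A c b p u)"
  using tangent_eq_coord_vec[OF assms] unfolding coord_vec_sum[OF assms(1,2)] .

lemma tangent_coord_eqI:
  assumes c: "c \<in> A" "p \<in> fst c" and "X \<in> tangent_space A p" "Y \<in> tangent_space A p"
    and "\<And>b. b \<in> Basis \<Longrightarrow> X (\<lambda>x. snd c x \<bullet> b) = Y (\<lambda>x. snd c x \<bullet> b)"
  shows "X = Y"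
proof -
  have "(\<Sum>b\<in>Basis. X (\<lambda>x. snd c x \<bullet> b) *\<^sub>R b) = (\<Sum>b\<in>Basis. Y (\<lambda>x. snd c x \<bullet> b) *\<^sub>R b)"
    using assms(5) by simp
  then show ?thesis using tangent_eq_coord_vec[OF c assms(3)] tangent_eq_coord_vec[OF c assms(4)] by metis
qed

lemma tangent_lincomb:
  assumes "X \<in> tangent_space A p" "Y \<in> tangent_space A p"
  shows "(\<lambda>u. a * X u + b * Y u) \<in> tangent_space A p"
proof -
  obtain c where c: "c \<in> A" "p \<in> fst c" by (rule chart_cover)
  obtain v w where "X = coord_vec A c v p" "Y = coord_vec A c w p"
    using assms tangent_space_eq_range[OF c] by auto
  then show ?thesis using coord_vec_linear[OF c, of a v b w] coord_vec_tangent[OF c] by metis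
qed

lemma tangent_zero: "(\<lambda>u. 0) \<in> tangent_space A p"
proof -
  obtain c where c: "c \<in> A" "p \<in> fst c" by (rule chart_cover)
  show ?thesis using coord_vec_tangent[OF c, of 0] by (simp add: coord_vec_0[OF c])
qed

lemma tangent_scale: "X \<in> tangent_space A p \<Longrightarrow> (\<lambda>u. a * X u) \<in> tangent_space A p"
  using tangent_lincomb[of X p X a 0] by simp

lemma tangent_sum:
  assumes "\<And>i. i \<in> I \<Longrightarrow> X i \<in> tangent_space A p"
  shows "(\<lambda>u. \<Sum>i\<in>I. a i * X i u) \<in> tangent_space A p"
  using assms
proof (induction I rule: infinite_finite_induct)
  case (insert i I)
  then show ?case using tangent_lincomb[of "X i" p "\<lambda>u. \<Sum>i\<in>I. a i * X i u" "a i" 1] by simp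
qed (simp_all add: tangent_zero)

lemma tangent_not_smooth: "X \<in> tangent_space A p \<Longrightarrow> \<not> smooth_at A p u \<Longrightarrow> X u = 0"
  by (auto elim!: tangentE simp: not_smooth_coord_vec)

lemma tangent_cong:
  assumes "X \<in> tangent_space A p" "\<forall>\<^sub>F x in nhds p. u x = v x"
  shows "X u = X v"
proof (cases "smooth_at A p u")
  case True
  then have v: "smooth_at A p v" using smooth_at_cong[OF assms(2)] by simp
  obtain c w where c: "c \<in> A" "p \<in> fst c" "X = coord_vec A c w p" using assms(1) by (rule tangentE)
  obtain V where V: "open V" "p \<in> V" "\<And>x. x \<in> V \<Longrightarrow> u x = v x" using assms(2) by (auto simp: eventually_nhds)
  have "((\<lambda>z. v (chart_inv c z)) has_derivative frechet_derivative (\<lambda>z. u (chart_inv c z)) (at (snd c p))) (at (snd c p))"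
    by (rule has_derivative_transform_within_open[OF smooth_at_has_derivative[OF c(1,2) True] chart_image_open[OF c(1) V(1)]])
       (use c V in auto)
  from coord_vec_eqI[OF v this] show ?thesis unfolding c(3) using coord_vec_eq[OF True] by metis
next
  case False
  then show ?thesis using tangent_not_smooth[OF assms(1)] smooth_at_cong[OF assms(2)] by metis
qed

lemma tangent_const: assumes "X \<in> tangent_space A p" shows "X (\<lambda>x. k) = 0"
proof -
  obtain c w where c: "c \<in> A" "p \<in> fst c" "X = coord_vec A c w p" using assms by (rule tangentE)
  have "coord_vec A c w p (\<lambda>x. k) = (\<lambda>v. 0) w"
    by (rule coord_vec_eqI[OF smooth_at_const]) simp
  then show ?thesis using c by simp
qed

lemma tangent_add:
  assumes "X \<in> tangent_space A p" "smooth_at A p u" "smooth_at A p v"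
  shows "X (\<lambda>x. u x + v x) = X u + X v"
proof -
  obtain c w where c: "c \<in> A" "p \<in> fst c" "X = coord_vec A c w p" using assms(1) by (rule tangentE)
  show ?thesis unfolding c(3)
    using coord_vec_eqI[OF smooth_at_add[OF assms(2,3)] has_derivative_add[OF smooth_at_has_derivative[OF c(1,2) assms(2)]
        smooth_at_has_derivative[OF c(1,2) assms(3)]]] by (simp add: coord_vec_eq assms)
qed

lemma tangent_mult:
  assumes "X \<in> tangent_space A p" "smooth_at A p u" "smooth_at A p v"
  shows "X (\<lambda>x. u x * v x) = X u * v p + u p * X v"
proof -
  obtain c w where c: "c \<in> A" "p \<in> fst c" "X = coord_vec A c w p" using assms(1) by (rule tangentE)
  show ?thesis unfolding c(3)
    using coord_vec_eqI[OF smooth_at_mult[OF assms(2,3)] has_derivative_mult[OF smooth_at_has_derivative[OF c(1,2) assms(2)]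
        smooth_at_has_derivative[OF c(1,2) assms(3)]]] c by (simp add: coord_vec_eq assms)
qed

lemma tangent_cmult:
  assumes "X \<in> tangent_space A p" "smooth_at A p u"
  shows "X (\<lambda>x. k * u x) = k * X u" "X (\<lambda>x. u x * k) = X u * k"
  using tangent_mult[OF assms(1) smooth_at_const assms(2), of k] tangent_mult[OF assms smooth_at_const, of k]
    tangent_const[OF assms(1)] by simp_all

lemma tangent_sum_fun:
  assumes "X \<in> tangent_space A p" "\<And>i. i \<in> I \<Longrightarrow> smooth_at A p (u i)"
  shows "X (\<lambda>x. \<Sum>i\<in>I. u i x) = (\<Sum>i\<in>I. X (u i))"
  using assms(2)
proof (induction I rule: infinite_finite_induct)
  case (insert i I)
  then show ?case using tangent_add[OF assms(1), of "u i" "\<lambda>x. \<Sum>i\<in>I. u i x"] by (simp add: smooth_at_sum)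
qed (simp_all add: tangent_const[OF assms(1)])

section \<open>Covectors\<close>

lemma cotangent_lincomb:
  "\<xi> \<in> cotangent_space A p \<Longrightarrow> X \<in> tangent_space A p \<Longrightarrow> Y \<in> tangent_space A p \<Longrightarrow>
   \<xi> (\<lambda>u. a * X u + b * Y u) = a * \<xi> X + b * \<xi> Y"
  by (simp add: cotangent_space_def)

lemma cotangent_zero_vec: "\<xi> \<in> cotangent_space A p \<Longrightarrow> \<xi> (\<lambda>u. 0) = 0"
  using cotangent_lincomb[of \<xi> p "\<lambda>u. 0" "\<lambda>u. 0" 0 0] tangent_zero by simp

lemma cotangent_scale_vec: "\<xi> \<in> cotangent_space A p \<Longrightarrow> X \<in> tangent_space A p \<Longrightarrow> \<xi> (\<lambda>u. a * X u) = a * \<xi> X"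
  using cotangent_lincomb[of \<xi> p X X a 0] by simp

lemma cotangent_sum:
  assumes "\<xi> \<in> cotangent_space A p" "\<And>i. i \<in> I \<Longrightarrow> X i \<in> tangent_space A p"
  shows "\<xi> (\<lambda>u. \<Sum>i\<in>I. a i * X i u) = (\<Sum>i\<in>I. a i * \<xi> (X i))"
  using assms(2)
proof (induction I rule: infinite_finite_induct)
  case (insert i I)
  then show ?case
    using cotangent_lincomb[OF assms(1), of "X i" "\<lambda>u. \<Sum>i\<in>I. a i * X i u" "a i" 1] by (simp add: tangent_sum)
qed (simp_all add: cotangent_zero_vec[OF assms(1)])

lemma cotangent_apply:
  assumes "c \<in> A" "p \<in> fst c" "\<xi> \<in> cotangent_space A p" "X \<in> tangent_space A p"
  shows "\<xi> X = (\<Sum>b\<in>Basis. X (\<lambda>x. snd c x \<bullet> b) * \<xi> (coord_vec A c b p))"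
  by (subst tangent_expand[OF assms(1,2,4)]) (rule cotangent_sum[OF assms(3) coord_vec_tangent[OF assms(1,2)]])

lemma cotangent_off: "\<xi> \<in> cotangent_space A p \<Longrightarrow> X \<notin> tangent_space A p \<Longrightarrow> \<xi> X = 0"
  by (simp add: cotangent_space_def)

lemma cotangent_eqI:
  assumes "\<xi> \<in> cotangent_space A p" "\<zeta> \<in> cotangent_space A p" "\<And>X. X \<in> tangent_space A p \<Longrightarrow> \<xi> X = \<zeta> X"
  shows "\<xi> = \<zeta>"
  using assms cotangent_off by (intro ext) metis

lemma cotangent_lincomb_mem:
  assumes "\<xi> \<in> cotangent_space A p" "\<zeta> \<in> cotangent_space A p"
  shows "(\<lambda>X. a * \<xi> X + b * \<zeta> X) \<in> cotangent_space A p"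
  using assms by (simp add: cotangent_space_def algebra_simps)

lemma cotangent_zero: "(\<lambda>X. 0) \<in> cotangent_space A p"
  by (simp add: cotangent_space_def)

lemma cotangent_scale: "\<xi> \<in> cotangent_space A p \<Longrightarrow> (\<lambda>X. a * \<xi> X) \<in> cotangent_space A p"
  using cotangent_lincomb_mem[of \<xi> p \<xi> a 0] by simp

lemma cotangent_sum_mem:
  assumes "\<And>i. i \<in> I \<Longrightarrow> \<xi> i \<in> cotangent_space A p"
  shows "(\<lambda>X. \<Sum>i\<in>I. a i * \<xi> i X) \<in> cotangent_space A p"
  using assms
proof (induction I rule: infinite_finite_induct)
  case (insert i I)
  then show ?case using cotangent_lincomb_mem[of "\<xi> i" p "\<lambda>X. \<Sum>i\<in>I. a i * \<xi> i X" "a i" 1] by simp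
qed (simp_all add: cotangent_zero)

lemma differential_mem: "differential A u p \<in> cotangent_space A p"
  by (auto simp: cotangent_space_def differential_def tangent_lincomb)

lemma differential_apply: "X \<in> tangent_space A p \<Longrightarrow> differential A u p X = X u"
  by (simp add: differential_def)

lemma coord_form_mem: "coord_form A c b p \<in> cotangent_space A p"
  by (simp add: coord_form_def differential_mem)

lemma coord_form_apply: "X \<in> tangent_space A p \<Longrightarrow> coord_form A c b p X = X (\<lambda>x. snd c x \<bullet> b)"
  by (simp add: coord_form_def differential_apply)

lemma cotangent_expand:
  assumes "c \<in> A" "p \<in> fst c" "\<xi> \<in> cotangent_space A p"
  shows "\<xi> = (\<lambda>X. \<Sum>b\<in>Basis. \<xi> (coord_vec A c b p) * coord_form A c b p X)"
  by (rule cotangent_eqI[OF assms(3) cotangent_sum_mem[OF coord_form_mem]])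
     (simp add: coord_form_apply cotangent_apply[OF assms] mult.commute)

lemma tangent_eqI:
  assumes "X \<in> tangent_space A p" "Y \<in> tangent_space A p" "\<And>\<xi>. \<xi> \<in> cotangent_space A p \<Longrightarrow> \<xi> X = \<xi> Y"
  shows "X = Y"
proof
  fix u show "X u = Y u" using assms(3)[OF differential_mem[of u p]] assms(1,2) by (simp add: differential_apply)
qed

section \<open>Bump functions on a manifold\<close>

text \<open>
  A Euclidean bump function is transported through a chart around \<open>p\<close> and extended by 0. The
  extension is smooth because it vanishes off the image \<open>K\<close> of a compact ball, which is compact and hence closed
  in the Hausdorff space \<open>'m\<close>: near any point off \<open>K\<close> it is 0.
\<close>

lemma bump_function:
  assumes "open W" "p \<in> W"
  obtains \<phi> K where "smooth_fun A \<phi>" "closed K" "K \<subseteq> W" "\<And>x. x \<notin> K \<Longrightarrow> \<phi> x = 0" "\<forall>\<^sub>F x in nhds p. \<phi> x = 1"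
proof -
  obtain c where c: "c \<in> A" "p \<in> fst c" by (rule chart_cover)
  define U where "U = snd c ` (fst c \<inter> W)"
  have oU: "open U" unfolding U_def by (rule chart_image_open[OF c(1) assms(1)])
  obtain r where r: "0 < r" "cball (snd c p) r \<subseteq> U"
  proof -
    have "snd c p \<in> U" using c(2) assms(2) by (auto simp: U_def)
    then show ?thesis using oU that open_contains_cball[of U] by blast
  qed
  obtain \<psi> :: "'e \<Rightarrow> real" where \<psi>: "smooth_on UNIV \<psi>" "\<And>z. z \<notin> cball (snd c p) r \<Longrightarrow> \<psi> z = 0"
    "\<And>z. z \<in> ball (snd c p) (r/2) \<Longrightarrow> \<psi> z = 1"
    using euclidean_bump[OF r(1), of "snd c p"] by blast
  define K where "K = chart_inv c ` cball (snd c p) r"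
  define \<phi> where "\<phi> = (\<lambda>x. if x \<in> fst c then \<psi> (snd c x) else 0)"
  have "continuous_on (cball (snd c p) r) (chart_inv c)"
    using homeomorphism_cont2[OF chart_homeo[OF c(1)]] by (rule continuous_on_subset) (use r(2) in \<open>auto simp: U_def\<close>)
  then have "compact K" unfolding K_def by (rule compact_continuous_image) simp
  then have K: "closed K" by (rule compact_imp_closed)
  have KW: "K \<subseteq> fst c \<inter> W"
  proof
    fix x assume "x \<in> K"
    then obtain z where "z \<in> U" "x = chart_inv c z" using r(2) by (auto simp: K_def)
    then show "x \<in> fst c \<inter> W" using c by (auto simp: U_def)
  qed
  have off: "\<phi> x = 0" if "x \<notin> K" for x
  proof (cases "x \<in> fst c")
    case True
    then have "snd c x \<notin> cball (snd c p) r" using that c(1) by (force simp: K_def)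
    then show ?thesis using \<psi>(2) by (simp add: \<phi>_def)
  qed (simp add: \<phi>_def)
  have sm: "smooth_fun A \<phi>" unfolding smooth_fun_def
  proof (rule smooth_fun_on_local[OF open_UNIV])
    fix x
    show "\<exists>V. open V \<and> x \<in> V \<and> smooth_fun_on A V \<phi>"
    proof (cases "x \<in> fst c")
      case True
      have o: "open (snd c ` fst c)" using chart_image_open[OF c(1) open_UNIV] by simp
      have "smooth_on (snd c ` fst c) \<psi>" using \<psi>(1) by (rule smooth_on_subset) simp
      then have "smooth_on (snd c ` fst c) (\<lambda>z. \<phi> (chart_inv c z))"
        by (rule smooth_on_cong[OF o, THEN iffD1, rotated]) (use c in \<open>auto simp: \<phi>_def\<close>)
      then have "smooth_fun_on A (fst c) \<phi>" by (rule smooth_fun_on_chart[OF c(1) chart_open[OF c(1)] order_refl])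
      then show ?thesis using True chart_open[OF c(1)] by blast
    next
      case False
      have "smooth_fun_on A (- K) \<phi>"
        by (rule smooth_fun_on_cong[THEN iffD2, OF _ _ smooth_fun_on_const[of _ 0]]) (use K off in auto)
      then show ?thesis using False KW K by (intro exI[of _ "- K"]) auto
    qed
  qed
  have "open (fst c \<inter> snd c -` ball (snd c p) (r/2))"
    using homeomorphism_cont1[OF chart_homeo[OF c(1)]] chart_open[OF c(1)] by (rule continuous_open_preimage) simp
  then have "\<forall>\<^sub>F x in nhds p. \<phi> x = 1"
    unfolding eventually_nhds using r(1) c(2)
    by (intro exI[of _ "fst c \<inter> snd c -` ball (snd c p) (r/2)"]) (auto simp: \<phi>_def \<psi>(3))
  then show ?thesis using that[OF sm K _ off] KW by blast
qed

section \<open>Vector fields and one-forms\<close>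

lemma smooth_fun_on_charts:
  assumes "open W" "\<And>c. c \<in> A \<Longrightarrow> smooth_fun_on A (fst c \<inter> W) u"
  shows "smooth_fun_on A W u"
proof (rule smooth_fun_on_local[OF assms(1)])
  fix p assume "p \<in> W"
  obtain c where c: "c \<in> A" "p \<in> fst c" by (rule chart_cover)
  show "\<exists>V. open V \<and> p \<in> V \<and> smooth_fun_on A V u"
    using assms(2)[OF c(1)] c(2) \<open>p \<in> W\<close> open_Int[OF chart_open[OF c(1)] assms(1)] by blast
qed

lemma coord_vec_smooth:
  assumes c: "c \<in> A" and W: "open W" "W \<subseteq> fst c" and u: "smooth_fun_on A W u"
  shows "smooth_fun_on A W (\<lambda>p. coord_vec A c v p u)"
proof (rule smooth_fun_on_chart[OF c W])
  have o: "open (snd c ` W)" by (rule chart_image_open'[OF c W])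
  have "smooth_on (snd c ` W) (\<lambda>z. u (chart_inv c z))"
    using smooth_fun_onD[OF u c] W(2) by (simp add: inf.absorb2)
  then have "smooth_on (snd c ` W) (\<lambda>z. frechet_derivative (\<lambda>z. u (chart_inv c z)) (at z) v)"
    by (rule smooth_on_frechet)
  then show "smooth_on (snd c ` W) (\<lambda>z. coord_vec A c v (chart_inv c z) u)"
  proof (rule smooth_on_cong[OF o, THEN iffD1, rotated])
    fix z assume "z \<in> snd c ` W"
    then obtain p where p: "p \<in> W" "z = snd c p" by auto
    then have "chart_inv c z = p" using c W(2) by auto
    then show "frechet_derivative (\<lambda>z. u (chart_inv c z)) (at z) v = coord_vec A c v (chart_inv c z) u"
      using coord_vec_eq[OF smooth_atI[OF W(1) p(1) u]] p(2) by simp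
  qed
qed

text \<open>
  Coordinate vectors are partial derivatives in the chart, so this is the symmetry of second
  derivatives.
\<close>

lemma coord_vec_symmetric:
  assumes c: "c \<in> A" "p \<in> fst c" and u: "smooth_at A p u"
  shows "coord_vec A c v p (\<lambda>x. coord_vec A c w x u) = coord_vec A c w p (\<lambda>x. coord_vec A c v x u)"
proof -
  obtain W' where W': "open W'" "p \<in> W'" "smooth_fun_on A W' u" using u by (auto simp: smooth_at_def)
  define W where "W = fst c \<inter> W'"
  have W: "open W" "p \<in> W" "W \<subseteq> fst c" "smooth_fun_on A W u"
    using W' c chart_open[OF c(1)] by (auto simp: W_def intro: smooth_fun_on_subset)
  define f where "f = (\<lambda>z. u (chart_inv c z))"
  have o: "open (snd c ` W)" by (rule chart_image_open'[OF c(1) W(1,3)])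
  have f: "smooth_on (snd c ` W) f" unfolding f_def
    using smooth_fun_onD[OF W(4) c(1)] W(3) by (simp add: inf.absorb2)
  have pW: "snd c p \<in> snd c ` W" using W(2) by simp
  have *: "coord_vec A c v p (\<lambda>x. coord_vec A c w x u)
      = frechet_derivative (\<lambda>z. frechet_derivative f (at z) w) (at (snd c p)) v" for v w
  proof (rule coord_vec_eqI[OF smooth_atI[OF W(1,2) coord_vec_smooth[OF c(1) W(1,3,4)]]])
    show "((\<lambda>z. coord_vec A c w (chart_inv c z) u) has_derivative
      frechet_derivative (\<lambda>z. frechet_derivative f (at z) w) (at (snd c p))) (at (snd c p))"
    proof (rule has_derivative_transform_within_open[OF smooth_on_has_derivative[OF o smooth_on_frechet[OF f] pW] o pW])
      fix z assume "z \<in> snd c ` W"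
      then obtain x where x: "x \<in> W" "z = snd c x" by auto
      then have "chart_inv c z = x" using c W(3) by auto
      then show "frechet_derivative f (at z) w = coord_vec A c w (chart_inv c z) u"
        using coord_vec_eq[OF smooth_atI[OF W(1) x(1) W(4)]] x(2) by (simp add: f_def)
    qed
  qed
  show ?thesis unfolding * by (rule frechet_derivative_symmetric[OF o f pW])
qed

lemma vfield_onD: "vfield_on A W X \<Longrightarrow> p \<in> W \<Longrightarrow> X p \<in> tangent_space A p"
  by (simp add: vfield_on_def)

lemma oneform_onD: "oneform_on A W \<omega> \<Longrightarrow> p \<in> W \<Longrightarrow> \<omega> p \<in> cotangent_space A p"
  by (simp add: oneform_on_def)

lemma vfield_on_subset: "vfield_on A W X \<Longrightarrow> W' \<subseteq> W \<Longrightarrow> vfield_on A W' X"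
  unfolding vfield_on_def by (meson smooth_fun_on_subset Int_mono order_refl subsetD)

lemma oneform_on_subset: "oneform_on A W X \<Longrightarrow> W' \<subseteq> W \<Longrightarrow> oneform_on A W' X"
  unfolding oneform_on_def by (meson smooth_fun_on_subset Int_mono order_refl subsetD)

lemma vfield_apply_smooth:
  assumes "open W" "vfield_on A W X" "smooth_fun_on A W u"
  shows "smooth_fun_on A W (\<lambda>p. X p u)"
proof (rule smooth_fun_on_charts[OF assms(1)])
  fix c assume c: "c \<in> A"
  have o: "open (fst c \<inter> W)" using chart_open[OF c] assms(1) by blast
  have "smooth_fun_on A (fst c \<inter> W) (\<lambda>p. \<Sum>b\<in>Basis. X p (\<lambda>x. snd c x \<bullet> b) * coord_vec A c b p u)"
  proof (rule smooth_fun_on_sum[OF o], rule smooth_fun_on_mult[OF o])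
    fix b :: 'e assume b: "b \<in> Basis"
    show "smooth_fun_on A (fst c \<inter> W) (\<lambda>p. X p (\<lambda>x. snd c x \<bullet> b))"
      using assms(2) c b by (simp add: vfield_on_def)
    show "smooth_fun_on A (fst c \<inter> W) (\<lambda>p. coord_vec A c b p u)"
      by (rule coord_vec_smooth[OF c o _ smooth_fun_on_subset[OF assms(3)]]) auto
  qed
  then show "smooth_fun_on A (fst c \<inter> W) (\<lambda>p. X p u)"
  proof (rule smooth_fun_on_cong[OF o, THEN iffD1, rotated])
    fix p assume p: "p \<in> fst c \<inter> W"
    then have "X p \<in> tangent_space A p" using vfield_onD[OF assms(2)] by simp
    from fun_cong[OF tangent_expand[OF c _ this], of u] p
    show "(\<Sum>b\<in>Basis. X p (\<lambda>x. snd c x \<bullet> b) * coord_vec A c b p u) = X p u" by simp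
  qed
qed

lemma vfield_apply_smooth_at:
  assumes "open W" "p \<in> W" "vfield_on A W X" "smooth_at A p u"
  shows "smooth_at A p (\<lambda>x. X x u)"
proof -
  obtain V where V: "open V" "p \<in> V" "smooth_fun_on A V u" using assms(4) by (auto simp: smooth_at_def)
  show ?thesis
    by (rule smooth_atI[OF _ _ vfield_apply_smooth[of "W \<inter> V"]])
       (use assms V in \<open>auto intro: vfield_on_subset smooth_fun_on_subset\<close>)
qed

lemma coord_vec_vfield: assumes "c \<in> A" shows "vfield_on A (fst c) (coord_vec A c v)"
  unfolding vfield_on_def
proof (intro conjI ballI)
  fix p assume "p \<in> fst c"
  then show "coord_vec A c v p \<in> tangent_space A p" using coord_vec_tangent[OF assms] by simp
next
  fix c' b assume c': "c' \<in> A"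
  show "smooth_fun_on A (fst c' \<inter> fst c) (\<lambda>p. coord_vec A c v p (\<lambda>x. snd c' x \<bullet> b))"
    by (rule coord_vec_smooth[OF assms _ _ smooth_fun_on_subset[OF smooth_fun_on_coord[OF c']]])
       (use chart_open[OF assms] chart_open[OF c'] in auto)
qed

lemma pairing_smooth:
  assumes "open W" "oneform_on A W \<eta>" "vfield_on A W X"
  shows "smooth_fun_on A W (\<lambda>p. \<eta> p (X p))"
proof (rule smooth_fun_on_charts[OF assms(1)])
  fix c assume c: "c \<in> A"
  have o: "open (fst c \<inter> W)" using chart_open[OF c] assms(1) by blast
  have "smooth_fun_on A (fst c \<inter> W) (\<lambda>p. \<Sum>b\<in>Basis. X p (\<lambda>x. snd c x \<bullet> b) * \<eta> p (coord_vec A c b p))"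
    by (rule smooth_fun_on_sum[OF o], rule smooth_fun_on_mult[OF o])
       (use assms(2,3) c in \<open>simp_all add: vfield_on_def oneform_on_def\<close>)
  then show "smooth_fun_on A (fst c \<inter> W) (\<lambda>p. \<eta> p (X p))"
    by (rule smooth_fun_on_cong[OF o, THEN iffD1, rotated])
       (use cotangent_apply[OF c] vfield_onD[OF assms(3)] oneform_onD[OF assms(2)] in auto)
qed

lemma differential_oneform:
  assumes "open W" "smooth_fun_on A W u"
  shows "oneform_on A W (differential A u)"
  unfolding oneform_on_def
proof (intro conjI ballI)
  fix p show "differential A u p \<in> cotangent_space A p" by (rule differential_mem)
next
  fix c and b :: 'e assume c: "c \<in> A" and "b \<in> Basis"
  have o: "open (fst c \<inter> W)" using chart_open[OF c] assms(1) by blast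
  have "smooth_fun_on A (fst c \<inter> W) (\<lambda>p. coord_vec A c b p u)"
    by (rule coord_vec_smooth[OF c o _ smooth_fun_on_subset[OF assms(2)]]) auto
  then show "smooth_fun_on A (fst c \<inter> W) (\<lambda>p. differential A u p (coord_vec A c b p))"
    by (rule smooth_fun_on_cong[OF o, THEN iffD1, rotated]) (use differential_apply[OF coord_vec_tangent[OF c]] in auto)
qed

lemma coord_form_oneform: "c \<in> A \<Longrightarrow> oneform_on A (fst c) (coord_form A c b)"
  unfolding coord_form_def by (rule differential_oneform[OF chart_open smooth_fun_on_coord])

lemma form_scale_oneform:
  assumes "open W" "smooth_fun_on A W f" "oneform_on A W \<omega>"
  shows "oneform_on A W (form_scale f \<omega>)"
  using assms chart_open unfolding oneform_on_def form_scale_def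
  by (auto intro!: cotangent_scale smooth_fun_on_mult intro: smooth_fun_on_subset)

section \<open>Lie derivatives in coordinates\<close>

text \<open>
  The expression \<open>X (V u)\<close> in coordinates. Its second line, which involves second derivatives of \<open>u\<close>,
  is symmetric under exchange of the components of \<open>X\<close> and \<open>V\<close>.
\<close>

lemma vfield_comp_expand:
  assumes c: "c \<in> A" "p \<in> fst c" and W: "open W" "p \<in> W"
    and X: "X \<in> tangent_space A p" and V: "vfield_on A W V" and u: "smooth_at A p u"
  shows "X (\<lambda>x. V x u) = (\<Sum>b\<in>Basis. X (\<lambda>x. V x (\<lambda>x. snd c x \<bullet> b)) * coord_vec A c b p u)
    + (\<Sum>b\<in>Basis. \<Sum>a\<in>Basis. V p (\<lambda>x. snd c x \<bullet> b) * X (\<lambda>x. snd c x \<bullet> a) * coord_vec A c a p (\<lambda>x. coord_vec A c b x u))"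
proof -
  have s1: "smooth_at A p (\<lambda>x. V x (\<lambda>x. snd c x \<bullet> b))" for b
    by (rule vfield_apply_smooth_at[OF W V smooth_at_coord[OF c]])
  have s2: "smooth_at A p (\<lambda>x. coord_vec A c b x u)" for b
    by (rule vfield_apply_smooth_at[OF chart_open[OF c(1)] c(2) coord_vec_vfield[OF c(1)] u])
  have "\<forall>\<^sub>F x in nhds p. x \<in> fst c \<inter> W"
    using c W chart_open[OF c(1)] by (intro eventually_nhds_in_open) auto
  then have "\<forall>\<^sub>F x in nhds p. V x u = (\<Sum>b\<in>Basis. V x (\<lambda>x. snd c x \<bullet> b) * coord_vec A c b x u)"
  proof (rule eventually_mono)
    fix x assume x: "x \<in> fst c \<inter> W"
    from fun_cong[OF tangent_expand[OF c(1) _ vfield_onD[OF V]], of x u] x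
    show "V x u = (\<Sum>b\<in>Basis. V x (\<lambda>x. snd c x \<bullet> b) * coord_vec A c b x u)" by simp
  qed
  then have "X (\<lambda>x. V x u) = X (\<lambda>x. \<Sum>b\<in>Basis. V x (\<lambda>x. snd c x \<bullet> b) * coord_vec A c b x u)"
    by (rule tangent_cong[OF X])
  also have "\<dots> = (\<Sum>b\<in>Basis. X (\<lambda>x. V x (\<lambda>x. snd c x \<bullet> b) * coord_vec A c b x u))"
    by (rule tangent_sum_fun[OF X smooth_at_mult[OF s1 s2]])
  also have "\<dots> = (\<Sum>b\<in>Basis. X (\<lambda>x. V x (\<lambda>x. snd c x \<bullet> b)) * coord_vec A c b p u
      + V p (\<lambda>x. snd c x \<bullet> b) * X (\<lambda>x. coord_vec A c b x u))"
    using tangent_mult[OF X s1 s2] by simp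
  also have "\<dots> = (\<Sum>b\<in>Basis. X (\<lambda>x. V x (\<lambda>x. snd c x \<bullet> b)) * coord_vec A c b p u
      + (\<Sum>a\<in>Basis. V p (\<lambda>x. snd c x \<bullet> b) * X (\<lambda>x. snd c x \<bullet> a) * coord_vec A c a p (\<lambda>x. coord_vec A c b x u)))"
  proof (rule sum.cong[OF refl])
    fix b :: 'e
    have "X (\<lambda>x. coord_vec A c b x u) = (\<Sum>a\<in>Basis. X (\<lambda>x. snd c x \<bullet> a) * coord_vec A c a p (\<lambda>x. coord_vec A c b x u))"
      using fun_cong[OF tangent_expand[OF c X], of "\<lambda>x. coord_vec A c b x u"] .
    then show "X (\<lambda>x. V x (\<lambda>x. snd c x \<bullet> b)) * coord_vec A c b p u + V p (\<lambda>x. snd c x \<bullet> b) * X (\<lambda>x. coord_vec A c b x u)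
      = X (\<lambda>x. V x (\<lambda>x. snd c x \<bullet> b)) * coord_vec A c b p u
      + (\<Sum>a\<in>Basis. V p (\<lambda>x. snd c x \<bullet> b) * X (\<lambda>x. snd c x \<bullet> a) * coord_vec A c a p (\<lambda>x. coord_vec A c b x u))"
      by (simp only: sum_distrib_left mult.assoc)
  qed
  finally show ?thesis by (simp only: sum.distrib)
qed

text \<open>
  In \<open>X (V u) - V (X u)\<close> the second derivatives of \<open>u\<close> cancel by symmetry. In particular the bracket is
  a combination of coordinate vectors, hence a tangent vector on which one-forms can be evaluated
  linearly.
\<close>

lemma vfield_bracket_coord:
  assumes c: "c \<in> A" "p \<in> fst c" and W: "open W" "p \<in> W"
    and X: "vfield_on A W X" and V: "vfield_on A W V"
  shows "vfield_bracket A X V p = (\<lambda>u. \<Sum>b\<in>Basis.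
     (X p (\<lambda>x. V x (\<lambda>x. snd c x \<bullet> b)) - V p (\<lambda>x. X x (\<lambda>x. snd c x \<bullet> b))) * coord_vec A c b p u)"
proof
  fix u
  show "vfield_bracket A X V p u = (\<Sum>b\<in>Basis.
     (X p (\<lambda>x. V x (\<lambda>x. snd c x \<bullet> b)) - V p (\<lambda>x. X x (\<lambda>x. snd c x \<bullet> b))) * coord_vec A c b p u)"
  proof (cases "smooth_at A p u")
    case True
    have "(\<Sum>b\<in>Basis. \<Sum>a\<in>Basis. V p (\<lambda>x. snd c x \<bullet> b) * X p (\<lambda>x. snd c x \<bullet> a) * coord_vec A c a p (\<lambda>x. coord_vec A c b x u))
       = (\<Sum>a\<in>Basis. \<Sum>b\<in>Basis. X p (\<lambda>x. snd c x \<bullet> a) * V p (\<lambda>x. snd c x \<bullet> b) * coord_vec A c b p (\<lambda>x. coord_vec A c a x u))"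
      using coord_vec_symmetric[OF c True] by (subst sum.swap) (simp add: mult.commute)
    then show ?thesis
      using vfield_comp_expand[OF c W vfield_onD[OF X W(2)] V True]
        vfield_comp_expand[OF c W vfield_onD[OF V W(2)] X True] True
      by (simp add: vfield_bracket_def sum_subtractf left_diff_distrib)
  qed (simp add: vfield_bracket_def not_smooth_coord_vec)
qed

end

text \<open>
  The coordinate expression \<open>\<Sum>\<^sub>b (X(\<eta>\<^sub>b) v\<^sup>b + \<eta>\<^sub>b v(X\<^sup>b))\<close> of the Lie derivative of \<open>\<eta>\<close> along \<open>X\<close>,
  evaluated at \<open>v\<close>. It mentions the vector \<open>v\<close> at \<open>p\<close> only, and no extension of it.
\<close>

definition lie_coord ::
  "('m::topological_space, 'e::euclidean_space) atlas \<Rightarrow> ('m, 'e) chart \<Rightarrow> 'm vfield \<Rightarrow> 'm form \<Rightarrow> 'm \<Rightarrow> 'm tvec \<Rightarrow> real"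
  where "lie_coord A c X \<eta> p v = (\<Sum>b\<in>Basis. X p (\<lambda>x. \<eta> x (coord_vec A c b x)) * v (\<lambda>x. snd c x \<bullet> b)
      + \<eta> p (coord_vec A c b p) * v (\<lambda>x. X x (\<lambda>x. snd c x \<bullet> b)))"

context manifold begin

text \<open>
  For any extension \<open>V\<close> of \<open>v\<close>, Leibniz and the coordinate expression of \<open>[X, V]\<close> make the terms with
  \<open>X(V\<^sup>b)\<close> cancel, so the value is the same for all extensions. The constant-coefficient field in the
  chart is one extension, so the value exists.
\<close>

lemma lie_derivative_coord:
  assumes c: "c \<in> A" "p \<in> fst c" and W: "open W" "p \<in> W"
    and X: "vfield_on A W X" and \<eta>: "oneform_on A W \<eta>" and v: "v \<in> tangent_space A p"
  shows "lie_derivative A X \<eta> p v = lie_coord A c X \<eta> p v"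
    (is "_ = ?r")
proof -
  have eq: "X p (\<lambda>x. \<eta> x (V x)) - \<eta> p (vfield_bracket A X V p) = ?r"
    if "open W'" "p \<in> W'" and V': "vfield_on A W' V" and Vp: "V p = v" for V W'
  proof -
    define N where "N = W \<inter> W' \<inter> fst c"
    have N: "open N" "p \<in> N" "N \<subseteq> fst c" using that W c chart_open[OF c(1)] by (auto simp: N_def)
    have XN: "vfield_on A N X" and VN: "vfield_on A N V" and \<eta>N: "oneform_on A N \<eta>"
      using X V' \<eta> by (auto simp: N_def intro: vfield_on_subset oneform_on_subset)
    have Xp: "X p \<in> tangent_space A p" by (rule vfield_onD[OF X W(2)])
    have \<eta>p: "\<eta> p \<in> cotangent_space A p" by (rule oneform_onD[OF \<eta> W(2)])
    have s1: "smooth_at A p (\<lambda>x. V x (\<lambda>x. snd c x \<bullet> b))" for b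
      by (rule vfield_apply_smooth_at[OF N(1,2) VN smooth_at_coord[OF c]])
    have s2: "smooth_at A p (\<lambda>x. \<eta> x (coord_vec A c b x))" for b
      by (rule smooth_atI[OF N(1,2) pairing_smooth[OF N(1) \<eta>N vfield_on_subset[OF coord_vec_vfield[OF c(1)] N(3)]]])
    have "\<forall>\<^sub>F x in nhds p. \<eta> x (V x) = (\<Sum>b\<in>Basis. V x (\<lambda>x. snd c x \<bullet> b) * \<eta> x (coord_vec A c b x))"
      using eventually_nhds_in_open[OF N(1,2)]
      by (rule eventually_mono) (use cotangent_apply[OF c(1) _ oneform_onD[OF \<eta>N] vfield_onD[OF VN]] N(3) in auto)
    then have "X p (\<lambda>x. \<eta> x (V x)) = X p (\<lambda>x. \<Sum>b\<in>Basis. V x (\<lambda>x. snd c x \<bullet> b) * \<eta> x (coord_vec A c b x))"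
      by (rule tangent_cong[OF Xp])
    also have "\<dots> = (\<Sum>b\<in>Basis. X p (\<lambda>x. V x (\<lambda>x. snd c x \<bullet> b) * \<eta> x (coord_vec A c b x)))"
      by (rule tangent_sum_fun[OF Xp smooth_at_mult[OF s1 s2]])
    also have "\<dots> = (\<Sum>b\<in>Basis. X p (\<lambda>x. V x (\<lambda>x. snd c x \<bullet> b)) * \<eta> p (coord_vec A c b p)
      + V p (\<lambda>x. snd c x \<bullet> b) * X p (\<lambda>x. \<eta> x (coord_vec A c b x)))"
      using tangent_mult[OF Xp s1 s2] by simp
    finally have 1: "X p (\<lambda>x. \<eta> x (V x)) = \<dots>" .
    have 2: "\<eta> p (vfield_bracket A X V p) = (\<Sum>b\<in>Basis.
        (X p (\<lambda>x. V x (\<lambda>x. snd c x \<bullet> b)) - V p (\<lambda>x. X x (\<lambda>x. snd c x \<bullet> b))) * \<eta> p (coord_vec A c b p))"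
      unfolding vfield_bracket_coord[OF c N(1,2) XN VN]
      by (rule cotangent_sum[OF \<eta>p coord_vec_tangent[OF c]])
    show ?thesis unfolding lie_coord_def 1 2 sum_subtractf[symmetric] Vp[symmetric]
      by (rule sum.cong) (simp_all add: algebra_simps)
  qed
  obtain w where w: "v = coord_vec A c w p" using v tangent_space_eq_range[OF c] by auto
  have "(THE r. \<exists>V W. open W \<and> p \<in> W \<and> vfield_on A W V \<and> V p = v \<and>
                      r = X p (\<lambda>x. \<eta> x (V x)) - \<eta> p (vfield_bracket A X V p)) = ?r"
  proof (rule the_equality)
    show "\<exists>V W. open W \<and> p \<in> W \<and> vfield_on A W V \<and> V p = v \<and> ?r = X p (\<lambda>x. \<eta> x (V x)) - \<eta> p (vfield_bracket A X V p)"
      by (intro exI[of _ "coord_vec A c w"] exI[of _ "fst c"] conjI chart_open[OF c(1)] c(2)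
          coord_vec_vfield[OF c(1)] w[symmetric]
          eq[OF chart_open[OF c(1)] c(2) coord_vec_vfield[OF c(1)] w[symmetric], symmetric])
  next
    fix r
    assume "\<exists>V W. open W \<and> p \<in> W \<and> vfield_on A W V \<and> V p = v \<and> r = X p (\<lambda>x. \<eta> x (V x)) - \<eta> p (vfield_bracket A X V p)"
    then obtain V W' where "open W'" "p \<in> W'" "vfield_on A W' V" "V p = v"
      and r: "r = X p (\<lambda>x. \<eta> x (V x)) - \<eta> p (vfield_bracket A X V p)" by auto
    from this(1-4) show "r = ?r" unfolding r by (rule eq[of W'])
  qed
  then show ?thesis unfolding lie_derivative_def if_P[OF v] .
qed

end

section \<open>Bivector fields and the bracket of one-forms\<close>

locale bivector_manifold = manifold A for A :: "('m::{t2_space,second_countable_topology}, 'e::euclidean_space) atlas" +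
  fixes P :: "'m bivector"
  assumes bivector: "bivector_field A P"
begin

lemma P_skew: "\<xi> \<in> cotangent_space A p \<Longrightarrow> \<zeta> \<in> cotangent_space A p \<Longrightarrow> P p \<xi> \<zeta> = - P p \<zeta> \<xi>"
  using bivector unfolding bivector_field_def by blast

lemma P_lincomb:
  "\<xi> \<in> cotangent_space A p \<Longrightarrow> \<zeta> \<in> cotangent_space A p \<Longrightarrow> \<theta> \<in> cotangent_space A p \<Longrightarrow>
   P p (\<lambda>X. a * \<xi> X + b * \<zeta> X) \<theta> = a * P p \<xi> \<theta> + b * P p \<zeta> \<theta>"
  using bivector unfolding bivector_field_def by blast

lemma P_lincomb_right:
  "\<xi> \<in> cotangent_space A p \<Longrightarrow> \<zeta> \<in> cotangent_space A p \<Longrightarrow> \<theta> \<in> cotangent_space A p \<Longrightarrow>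
   P p \<theta> (\<lambda>X. a * \<xi> X + b * \<zeta> X) = a * P p \<theta> \<xi> + b * P p \<theta> \<zeta>"
  using P_skew[of \<theta> p "\<lambda>X. a * \<xi> X + b * \<zeta> X"] P_lincomb[of \<xi> p \<zeta> \<theta> a b] P_skew[of \<theta> p \<xi>] P_skew[of \<theta> p \<zeta>]
  by (simp add: cotangent_lincomb_mem)

lemma P_zero: "\<theta> \<in> cotangent_space A p \<Longrightarrow> P p (\<lambda>X. 0) \<theta> = 0"
  using P_lincomb[of "\<lambda>X. 0" p "\<lambda>X. 0" \<theta> 0 0] by (simp add: cotangent_zero)

lemma P_scale: "\<xi> \<in> cotangent_space A p \<Longrightarrow> \<theta> \<in> cotangent_space A p \<Longrightarrow> P p (\<lambda>X. a * \<xi> X) \<theta> = a * P p \<xi> \<theta>"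
  using P_lincomb[of \<xi> p \<xi> \<theta> a 0] by simp

lemma P_sum:
  assumes "\<And>i. i \<in> I \<Longrightarrow> \<xi> i \<in> cotangent_space A p" "\<theta> \<in> cotangent_space A p"
  shows "P p (\<lambda>X. \<Sum>i\<in>I. a i * \<xi> i X) \<theta> = (\<Sum>i\<in>I. a i * P p (\<xi> i) \<theta>)"
  using assms(1)
proof (induction I rule: infinite_finite_induct)
  case (insert i I)
  then show ?case
    using P_lincomb[of "\<xi> i" p "\<lambda>X. \<Sum>i\<in>I. a i * \<xi> i X" \<theta> "a i" 1] assms(2) by (simp add: cotangent_sum_mem)
qed (simp_all add: P_zero assms(2))

lemma P_sum_right:
  assumes "\<And>i. i \<in> I \<Longrightarrow> \<xi> i \<in> cotangent_space A p" "\<theta> \<in> cotangent_space A p"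
  shows "P p \<theta> (\<lambda>X. \<Sum>i\<in>I. a i * \<xi> i X) = (\<Sum>i\<in>I. a i * P p \<theta> (\<xi> i))"
proof -
  have "(\<lambda>X. \<Sum>i\<in>I. a i * \<xi> i X) \<in> cotangent_space A p"
    by (rule cotangent_sum_mem) (rule assms(1))
  from P_skew[OF assms(2) this]
  have "P p \<theta> (\<lambda>X. \<Sum>i\<in>I. a i * \<xi> i X) = - (\<Sum>i\<in>I. a i * P p (\<xi> i) \<theta>)"
    by (simp only: P_sum[of I \<xi> p \<theta> a] assms)
  also have "\<dots> = (\<Sum>i\<in>I. a i * P p \<theta> (\<xi> i))"
    unfolding sum_negf[symmetric] by (rule sum.cong) (simp_all add: P_skew[OF assms(2) assms(1)])
  finally show ?thesis .
qed

lemma P_smooth: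
  assumes "open W" "oneform_on A W \<omega>" "oneform_on A W \<eta>"
  shows "smooth_fun_on A W (\<lambda>p. P p (\<omega> p) (\<eta> p))"
proof (rule smooth_fun_on_charts[OF assms(1)])
  fix c assume c: "c \<in> A"
  have o: "open (fst c \<inter> W)" using chart_open[OF c] assms(1) by blast
  have "smooth_fun_on A (fst c \<inter> W) (\<lambda>p. \<Sum>i\<in>Basis. \<omega> p (coord_vec A c i p) *
      (\<Sum>j\<in>Basis. \<eta> p (coord_vec A c j p) * P p (coord_form A c i p) (coord_form A c j p)))"
  proof (rule smooth_fun_on_sum[OF o], rule smooth_fun_on_mult[OF o],
         rule_tac [2] smooth_fun_on_sum[OF o], rule_tac [2] smooth_fun_on_mult[OF o])
    fix i j :: 'e assume "i \<in> Basis" "j \<in> Basis"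
    then have "smooth_fun_on A (fst c) (\<lambda>p. P p (coord_form A c i p) (coord_form A c j p))"
      using bivector c unfolding bivector_field_def by blast
    then show "smooth_fun_on A (fst c \<inter> W) (\<lambda>p. P p (coord_form A c i p) (coord_form A c j p))"
      by (rule smooth_fun_on_subset) simp
  qed (use assms c in \<open>auto simp: oneform_on_def\<close>)
  then show "smooth_fun_on A (fst c \<inter> W) (\<lambda>p. P p (\<omega> p) (\<eta> p))"
  proof (rule smooth_fun_on_cong[OF o, THEN iffD1, rotated])
    fix p assume p: "p \<in> fst c \<inter> W"
    have m: "\<omega> p \<in> cotangent_space A p" "\<eta> p \<in> cotangent_space A p"
      using p oneform_onD[OF assms(2)] oneform_onD[OF assms(3)] by auto
    have "P p (\<omega> p) (\<eta> p) = P p (\<lambda>X. \<Sum>i\<in>Basis. \<omega> p (coord_vec A c i p) * coord_form A c i p X) (\<eta> p)"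
      using cotangent_expand[OF c _ m(1)] p by simp
    also have "\<dots> = (\<Sum>i\<in>Basis. \<omega> p (coord_vec A c i p) * P p (coord_form A c i p) (\<eta> p))"
      by (rule P_sum[OF coord_form_mem m(2)])
    also have "\<dots> = (\<Sum>i\<in>Basis. \<omega> p (coord_vec A c i p) *
        P p (coord_form A c i p) (\<lambda>X. \<Sum>j\<in>Basis. \<eta> p (coord_vec A c j p) * coord_form A c j p X))"
      using cotangent_expand[OF c _ m(2)] p by simp
    finally show "(\<Sum>i\<in>Basis. \<omega> p (coord_vec A c i p) *
      (\<Sum>j\<in>Basis. \<eta> p (coord_vec A c j p) * P p (coord_form A c i p) (coord_form A c j p))) = P p (\<omega> p) (\<eta> p)"
      by (simp add: P_sum_right[OF coord_form_mem coord_form_mem])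
  qed
qed

text \<open>
  The components of the vector are read off from the values of the bivector on coordinate forms;
  covectors separate tangent vectors, which gives uniqueness.
\<close>

lemma sharp_exists:
  assumes "\<omega> p \<in> cotangent_space A p"
  shows "sharp A P \<omega> p \<in> tangent_space A p \<and> (\<forall>\<eta>\<in>cotangent_space A p. \<eta> (sharp A P \<omega> p) = P p (\<omega> p) \<eta>)"
proof -
  obtain c where c: "c \<in> A" "p \<in> fst c" by (rule chart_cover)
  define X where "X = coord_vec A c (\<Sum>b\<in>Basis. P p (\<omega> p) (coord_form A c b p) *\<^sub>R b) p"
  have X: "X \<in> tangent_space A p" unfolding X_def by (rule coord_vec_tangent[OF c])
  have "\<eta> X = P p (\<omega> p) \<eta>" if \<eta>: "\<eta> \<in> cotangent_space A p" for \<eta>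
  proof -
    have "P p (\<omega> p) \<eta> = P p (\<omega> p) (\<lambda>X. \<Sum>j\<in>Basis. \<eta> (coord_vec A c j p) * coord_form A c j p X)"
      using cotangent_expand[OF c \<eta>] by simp
    also have "\<dots> = (\<Sum>j\<in>Basis. \<eta> (coord_vec A c j p) * P p (\<omega> p) (coord_form A c j p))"
      by (rule P_sum_right[OF coord_form_mem assms])
    also have "\<dots> = \<eta> X"
      unfolding cotangent_apply[OF c \<eta> X] unfolding X_def coord_vec_coord[OF c]
      by (simp add: mult.commute)
    finally show ?thesis by simp
  qed
  with X have ex: "X \<in> tangent_space A p \<and> (\<forall>\<eta>\<in>cotangent_space A p. \<eta> X = P p (\<omega> p) \<eta>)" by blast
  show ?thesis unfolding sharp_def
    by (rule theI2[of _ X]) (use ex in \<open>auto intro!: tangent_eqI\<close>)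
qed

lemma sharp_mem: "\<omega> p \<in> cotangent_space A p \<Longrightarrow> sharp A P \<omega> p \<in> tangent_space A p"
  using sharp_exists by blast

lemma sharp_apply:
  "\<omega> p \<in> cotangent_space A p \<Longrightarrow> \<eta> \<in> cotangent_space A p \<Longrightarrow> \<eta> (sharp A P \<omega> p) = P p (\<omega> p) \<eta>"
  using sharp_exists by blast

lemma sharp_fun: "\<omega> p \<in> cotangent_space A p \<Longrightarrow> sharp A P \<omega> p u = P p (\<omega> p) (differential A u p)"
  using sharp_apply[OF _ differential_mem] differential_apply[OF sharp_mem] by metis

text \<open>
  The components of the sharp of a one-form are values of the bivector field on smooth one-forms.
\<close>

lemma sharp_vfield:
  assumes "open W" "oneform_on A W \<omega>"
  shows "vfield_on A W (sharp A P \<omega>)"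
  unfolding vfield_on_def
proof (intro conjI ballI)
  fix p assume "p \<in> W"
  then show "sharp A P \<omega> p \<in> tangent_space A p" using sharp_mem oneform_onD[OF assms(2)] by blast
next
  fix c and b :: 'e assume c: "c \<in> A" and "b \<in> Basis"
  have o: "open (fst c \<inter> W)" using chart_open[OF c] assms(1) by blast
  have "smooth_fun_on A (fst c \<inter> W) (\<lambda>p. P p (\<omega> p) (coord_form A c b p))"
    by (rule P_smooth[OF o oneform_on_subset[OF assms(2)] oneform_on_subset[OF coord_form_oneform[OF c]]]) auto
  then show "smooth_fun_on A (fst c \<inter> W) (\<lambda>p. sharp A P \<omega> p (\<lambda>x. snd c x \<bullet> b))"
    by (rule smooth_fun_on_cong[OF o, THEN iffD1, rotated])
       (use sharp_fun[of \<omega>] oneform_onD[OF assms(2)] in \<open>auto simp: coord_form_def\<close>)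
qed

lemma form_bracket_coord:
  assumes c: "c \<in> A" "p \<in> fst c" and W: "open W" "p \<in> W"
    and \<omega>: "oneform_on A W \<omega>" and \<eta>: "oneform_on A W \<eta>" and v: "v \<in> tangent_space A p"
  shows "form_bracket A P \<omega> \<eta> p v = lie_coord A c (sharp A P \<omega>) \<eta> p v - lie_coord A c (sharp A P \<eta>) \<omega> p v
    - v (\<lambda>x. P x (\<omega> x) (\<eta> x))"
  unfolding form_bracket_def
    lie_derivative_coord[OF c W sharp_vfield[OF W(1) \<omega>] \<eta> v]
    lie_derivative_coord[OF c W sharp_vfield[OF W(1) \<eta>] \<omega> v] differential_apply[OF v] ..

text \<open>
  The connection is evaluated on global extensions of a local coframe, and this lemma returns from the
  bracket of the extensions to that of the coframe. The coordinate expression involves germs only.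
\<close>

lemma form_bracket_local:
  assumes W: "open W" "p \<in> W" and \<omega>: "oneform_on A W \<omega>" and \<eta>: "oneform_on A W \<eta>"
    and \<omega>': "oneform_on A W \<omega>'" and \<eta>': "oneform_on A W \<eta>'"
    and eq: "\<forall>\<^sub>F x in nhds p. \<omega>' x = \<omega> x" "\<forall>\<^sub>F x in nhds p. \<eta>' x = \<eta> x"
    and v: "v \<in> tangent_space A p"
  shows "form_bracket A P \<omega>' \<eta>' p v = form_bracket A P \<omega> \<eta> p v"
proof -
  obtain c where c: "c \<in> A" "p \<in> fst c" by (rule chart_cover)
  have eqp: "\<omega>' p = \<omega> p" "\<eta>' p = \<eta> p" using eventually_nhds_x_imp_x[OF eq(1)] eventually_nhds_x_imp_x[OF eq(2)] by simp_all
  then have sp: "sharp A P \<omega>' p = sharp A P \<omega> p" "sharp A P \<eta>' p = sharp A P \<eta> p" by (simp_all add: sharp_def)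
  have s: "sharp A P \<omega> p \<in> tangent_space A p" "sharp A P \<eta> p \<in> tangent_space A p"
    using sharp_mem oneform_onD W \<omega> \<eta> by auto
  have 1: "sharp A P \<omega> p (\<lambda>x. \<eta>' x (coord_vec A c b x)) = sharp A P \<omega> p (\<lambda>x. \<eta> x (coord_vec A c b x))" for b
    by (rule tangent_cong[OF s(1) eventually_mono[OF eq(2)]]) simp
  have 2: "sharp A P \<eta> p (\<lambda>x. \<omega>' x (coord_vec A c b x)) = sharp A P \<eta> p (\<lambda>x. \<omega> x (coord_vec A c b x))" for b
    by (rule tangent_cong[OF s(2) eventually_mono[OF eq(1)]]) simp
  have 3: "v (\<lambda>x. sharp A P \<omega>' x u) = v (\<lambda>x. sharp A P \<omega> x u)" for u
    by (rule tangent_cong[OF v eventually_mono[OF eq(1)]]) (simp add: sharp_def)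
  have 4: "v (\<lambda>x. sharp A P \<eta>' x u) = v (\<lambda>x. sharp A P \<eta> x u)" for u
    by (rule tangent_cong[OF v eventually_mono[OF eq(2)]]) (simp add: sharp_def)
  have 5: "v (\<lambda>x. P x (\<omega>' x) (\<eta>' x)) = v (\<lambda>x. P x (\<omega> x) (\<eta> x))"
    by (rule tangent_cong[OF v eventually_mono[OF eventually_conj[OF eq]]]) simp
  show ?thesis
    unfolding form_bracket_coord[OF c W \<omega> \<eta> v] form_bracket_coord[OF c W \<omega>' \<eta>' v] lie_coord_def sp eqp 1 2 3 4 5 ..
qed

end

section \<open>Metrics, cometrics and orthonormal coframes\<close>

text \<open>
  The pointwise content of a semi-Riemannian metric. For the warped metric it is verified by splitting
  tangent vectors of the product into horizontal and vertical parts.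
\<close>

locale metric_manifold = manifold A for A :: "('m::{t2_space,second_countable_topology}, 'e::euclidean_space) atlas" +
  fixes g :: "'m metric"
  assumes g_sym: "X \<in> tangent_space A p \<Longrightarrow> Y \<in> tangent_space A p \<Longrightarrow> g p X Y = g p Y X"
    and g_lincomb: "X \<in> tangent_space A p \<Longrightarrow> Y \<in> tangent_space A p \<Longrightarrow> Z \<in> tangent_space A p \<Longrightarrow>
      g p (\<lambda>u. a * X u + b * Y u) Z = a * g p X Z + b * g p Y Z"
    and g_nondegenerate: "X \<in> tangent_space A p \<Longrightarrow> (\<And>Y. Y \<in> tangent_space A p \<Longrightarrow> g p X Y = 0) \<Longrightarrow> X = (\<lambda>u. 0)"
begin

lemma g_cotangent:
  assumes "Y \<in> tangent_space A p"
  shows "(\<lambda>X. if X \<in> tangent_space A p then g p X Y else 0) \<in> cotangent_space A p"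
  using assms by (simp add: cotangent_space_def tangent_lincomb g_lincomb)

lemma metric_sharp_unique:
  assumes "X \<in> tangent_space A p" "\<And>Y. Y \<in> tangent_space A p \<Longrightarrow> g p X Y = \<xi> Y"
  shows "metric_sharp A g p \<xi> = X"
  unfolding metric_sharp_def
proof (rule the_equality)
  fix X' assume X': "X' \<in> tangent_space A p \<and> (\<forall>Y\<in>tangent_space A p. g p X' Y = \<xi> Y)"
  have "(\<lambda>u. 1 * X' u + (-1) * X u) = (\<lambda>u. 0)"
    by (rule g_nondegenerate[of _ p]) (use X' assms g_lincomb[of X' p X _ 1 "-1"] tangent_lincomb[of X' p X 1 "-1"] in simp_all)
  then have "X' u = X u" for u by (drule_tac fun_cong[of _ _ u]) simp
  then show "X' = X" by blast
qed (use assms in blast)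

text \<open>
  In a chart the map taking a vector to the components of the covector \<open>g (v, _)\<close> is a linear
  endomorphism of the model space. Nondegeneracy makes it injective, hence surjective.
\<close>

lemma metric_sharp_exists:
  assumes \<xi>: "\<xi> \<in> cotangent_space A p"
  obtains X where "X \<in> tangent_space A p" "\<And>Y. Y \<in> tangent_space A p \<Longrightarrow> g p X Y = \<xi> Y"
proof -
  obtain c where c: "c \<in> A" "p \<in> fst c" by (rule chart_cover)
  define L where "L = (\<lambda>v. \<Sum>b\<in>Basis. g p (coord_vec A c v p) (coord_vec A c b p) *\<^sub>R b)"
  note T = coord_vec_tangent[OF c]
  have add: "g p (coord_vec A c (v + w) p) Z = g p (coord_vec A c v p) Z + g p (coord_vec A c w p) Z"
    if "Z \<in> tangent_space A p" for v w Z
    using g_lincomb[OF T T that, of 1 v 1 w] coord_vec_linear[OF c, of 1 v 1 w] by simp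
  have sc: "g p (coord_vec A c (r *\<^sub>R v) p) Z = r * g p (coord_vec A c v p) Z"
    if "Z \<in> tangent_space A p" for v r Z
    using g_lincomb[OF T T that, of r v 0 v] coord_vec_linear[OF c, of r v 0 v] by simp
  have lin: "linear L"
    by (rule linearI) (simp_all add: L_def add[OF T] sc[OF T] scaleR_add_left sum.distrib scaleR_sum_right)
  have exp: "g p X Y = (\<Sum>b\<in>Basis. Y (\<lambda>x. snd c x \<bullet> b) * g p X (coord_vec A c b p))"
    if X: "X \<in> tangent_space A p" and Y: "Y \<in> tangent_space A p" for X Y
  proof -
    have "g p Y X = (\<Sum>b\<in>Basis. Y (\<lambda>x. snd c x \<bullet> b) * g p (coord_vec A c b p) X)"
      using cotangent_apply[OF c g_cotangent[OF X] Y] Y T by simp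
    then show ?thesis using g_sym[OF X Y] g_sym[OF X T] by simp
  qed
  have inner: "L v \<bullet> b = g p (coord_vec A c v p) (coord_vec A c b p)" if "b \<in> Basis" for v b
    using that unfolding L_def by (simp add: inner_sum_left_Basis)
  have "v = 0" if "L v = 0" for v
  proof -
    have "g p (coord_vec A c v p) (coord_vec A c b p) = 0" if "b \<in> Basis" for b
      using inner[OF that, of v] \<open>L v = 0\<close> by simp
    then have "coord_vec A c v p = (\<lambda>u. 0)"
      using exp[OF T, of _ v] by (intro g_nondegenerate[OF T]) simp
    then have "v \<bullet> b = 0" for b using coord_vec_coord[OF c, of v b] by simp
    then show ?thesis by (metis inner_eq_zero_iff)
  qed
  then have "inj L" using lin by (simp add: linear_injective_0)
  with lin have "surj L" by (simp add: linear_injective_imp_surjective)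
  then obtain v where v: "L v = (\<Sum>b\<in>Basis. \<xi> (coord_vec A c b p) *\<^sub>R b)" by (metis surjD)
  have "g p (coord_vec A c v p) (coord_vec A c b p) = \<xi> (coord_vec A c b p)" if "b \<in> Basis" for b
    using inner[OF that, of v] that unfolding v by (simp add: inner_sum_left_Basis)
  then have "g p (coord_vec A c v p) Y = \<xi> Y" if "Y \<in> tangent_space A p" for Y
    using exp[OF T that, of v] cotangent_apply[OF c \<xi> that] by simp
  then show ?thesis using that[OF T] by blast
qed

lemma metric_sharp_mem: "\<xi> \<in> cotangent_space A p \<Longrightarrow> metric_sharp A g p \<xi> \<in> tangent_space A p"
  using metric_sharp_exists metric_sharp_unique by metis

lemma g_metric_sharp:
  "\<xi> \<in> cotangent_space A p \<Longrightarrow> Y \<in> tangent_space A p \<Longrightarrow> g p (metric_sharp A g p \<xi>) Y = \<xi> Y"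
  using metric_sharp_exists metric_sharp_unique by metis

lemma cometric_left:
  "\<xi> \<in> cotangent_space A p \<Longrightarrow> \<zeta> \<in> cotangent_space A p \<Longrightarrow> cometric A g p \<xi> \<zeta> = \<xi> (metric_sharp A g p \<zeta>)"
  by (simp add: cometric_def g_metric_sharp metric_sharp_mem)

lemma cometric_right:
  "\<xi> \<in> cotangent_space A p \<Longrightarrow> \<zeta> \<in> cotangent_space A p \<Longrightarrow> cometric A g p \<xi> \<zeta> = \<zeta> (metric_sharp A g p \<xi>)"
  unfolding cometric_def using g_sym[OF metric_sharp_mem metric_sharp_mem] g_metric_sharp metric_sharp_mem by metis

lemma cometric_sym:
  "\<xi> \<in> cotangent_space A p \<Longrightarrow> \<zeta> \<in> cotangent_space A p \<Longrightarrow> cometric A g p \<xi> \<zeta> = cometric A g p \<zeta> \<xi>"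
  using cometric_left cometric_right by metis

end

lemma semi_riemannian_imp_metric_manifold:
  assumes "smooth_manifold A" "semi_riemannian_metric A g q"
  shows "metric_manifold A g"
proof -
  interpret manifold A by unfold_locales (rule assms(1))
  show ?thesis
  proof unfold_locales
    fix X p Y Z a b assume "X \<in> tangent_space A p" "Y \<in> tangent_space A p"
    then show "g p X Y = g p Y X" using assms(2) unfolding semi_riemannian_metric_def by blast
  next
    fix X p Y Z a b assume "X \<in> tangent_space A p" "Y \<in> tangent_space A p" "Z \<in> tangent_space A p"
    then show "g p (\<lambda>u. a * X u + b * Y u) Z = a * g p X Z + b * g p Y Z"
      using assms(2) unfolding semi_riemannian_metric_def by blast
  next
    fix X p assume "X \<in> tangent_space A p" "\<And>Y. Y \<in> tangent_space A p \<Longrightarrow> g p X Y = 0"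
    then show "X = (\<lambda>u. 0)" using assms(2) unfolding semi_riemannian_metric_def by blast
  qed
qed

text \<open>
  The index is the largest dimension of a negative definite subspace. The set of these dimensions is
  nonempty, as it contains that of the zero space, and bounded by the dimension of the model space; so
  its maximum is one of them.
\<close>

lemma index_le_dimension:
  fixes A :: "('m::{t2_space,second_countable_topology}, 'e::euclidean_space) atlas"
  assumes "smooth_manifold A" "semi_riemannian_metric A g q"
  shows "q \<le> DIM('e)"
proof -
  interpret manifold A by unfold_locales (rule assms(1))
  obtain c where c: "c \<in> A" "(undefined :: 'm) \<in> fst c" by (rule chart_cover)
  define B where "B = (\<lambda>v w. g undefined (coord_vec A c v undefined) (coord_vec A c w undefined))"
  have "form_index B = q" using assms(2) c unfolding semi_riemannian_metric_def B_def by blast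
  moreover define D where "D = {dim W | W. subspace W \<and> (\<forall>v\<in>W. v \<noteq> 0 \<longrightarrow> B v v < 0)}"
  have "D \<subseteq> {..DIM('e)}" using dim_subset_UNIV by (auto simp: D_def)
  moreover have "D \<noteq> {}" using subspace_0 by (auto simp: D_def intro!: exI[of _ "{0}"])
  ultimately show ?thesis unfolding form_index_def D_def[symmetric]
    using Max_in[of D] finite_subset[of D "{..DIM('e)}"] by auto
qed

text \<open>
  A pseudo-orthonormal basis at a single point. The index type is arbitrary because the coframe of a
  product is indexed by a sum type.
\<close>

locale orthonormal_covectors = metric_manifold A g
  for A :: "('m::{t2_space,second_countable_topology}, 'e::euclidean_space) atlas" and g +
  fixes p :: 'm and I :: "'i set" and e :: "'i \<Rightarrow> 'm covec" and \<epsilon> :: "'i \<Rightarrow> real"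
  assumes finite_I: "finite I" and card_I: "card I = DIM('e)"
    and e_mem: "i \<in> I \<Longrightarrow> e i \<in> cotangent_space A p"
    and e_orthonormal: "i \<in> I \<Longrightarrow> j \<in> I \<Longrightarrow> cometric A g p (e i) (e j) = (if i = j then \<epsilon> i else 0)"
    and eps_square: "i \<in> I \<Longrightarrow> \<epsilon> i * \<epsilon> i = 1"
begin

text \<open>
  The metric duals of the covectors are linearly independent, because pairing a combination with \<open>e j\<close>
  recovers its \<open>j\<close>-th coefficient up to the sign \<open>\<epsilon> j\<close>. There are as many of them as the dimension, so they
  span, and the same pairing identifies the coefficients.
\<close>

lemma frame_expand:
  assumes v: "v \<in> tangent_space A p"
  shows "v = (\<lambda>u. \<Sum>i\<in>I. (\<epsilon> i * e i v) * metric_sharp A g p (e i) u)"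
proof -
  obtain c where c: "c \<in> A" "p \<in> fst c" by (rule chart_cover)
  define E where "E = (\<lambda>i. metric_sharp A g p (e i))"
  have E: "E i \<in> tangent_space A p" if "i \<in> I" for i unfolding E_def by (rule metric_sharp_mem[OF e_mem[OF that]])
  have eE: "e j (E i) = (if i = j then \<epsilon> i else 0)" if "i \<in> I" "j \<in> I" for i j
    using e_orthonormal[OF that(2,1)] cometric_left[OF e_mem[OF that(2)] e_mem[OF that(1)]] by (auto simp: E_def)
  have "\<forall>i\<in>I. \<exists>w. E i = coord_vec A c w p" using E tangent_space_eq_range[OF c] by auto
  then obtain w where w: "\<And>i. i \<in> I \<Longrightarrow> E i = coord_vec A c (w i) p" by (auto dest: bchoice)
  have comb: "coord_vec A c (\<Sum>i\<in>I. a i *\<^sub>R w i) p = (\<lambda>u. \<Sum>i\<in>I. a i * E i u)" for a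
    unfolding coord_vec_sum[OF c] using w by simp
  have coeff: "e j (\<lambda>u. \<Sum>i\<in>I. a i * E i u) = a j * \<epsilon> j" if "j \<in> I" for a j
  proof -
    have "e j (\<lambda>u. \<Sum>i\<in>I. a i * E i u) = (\<Sum>i\<in>I. a i * e j (E i))"
      by (rule cotangent_sum[OF e_mem[OF that]]) (rule E)
    also have "\<dots> = (\<Sum>i\<in>I. if i = j then a j * \<epsilon> j else 0)"
      by (rule sum.cong) (use eE that in auto)
    finally show ?thesis using finite_I that by simp
  qed
  have nz: "\<epsilon> i \<noteq> 0" if "i \<in> I" for i using eps_square[OF that] by auto
  have inj: "inj_on w I"
  proof (rule inj_onI)
    fix i j assume ij: "i \<in> I" "j \<in> I" "w i = w j"
    then have "e i (E i) = e i (E j)" using w by simp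
    then show "i = j" using eE[OF ij(1,1)] eE[OF ij(2,1)] nz[OF ij(1)] by metis
  qed
  have "independent (w ` I)"
  proof (rule independent_if_scalars_zero)
    fix f x assume 0: "(\<Sum>x\<in>w ` I. f x *\<^sub>R x) = 0" and x: "x \<in> w ` I"
    from x obtain j where j: "j \<in> I" "x = w j" by blast
    have "(\<Sum>i\<in>I. f (w i) *\<^sub>R w i) = 0" using 0 by (simp add: sum.reindex[OF inj])
    then have "(\<lambda>u. \<Sum>i\<in>I. f (w i) * E i u) = (\<lambda>u. 0)"
      using comb[of "\<lambda>i. f (w i)"] coord_vec_0[OF c] by simp
    then have "f (w j) * \<epsilon> j = 0"
      using coeff[OF j(1), of "\<lambda>i. f (w i)"] cotangent_zero_vec[OF e_mem[OF j(1)]] by simp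
    then show "f x = 0" using nz[OF j(1)] j(2) by simp
  qed (use finite_I in simp)
  moreover have "card (w ` I) = dim (UNIV :: 'e set)" using card_image[OF inj] card_I by simp
  ultimately have span: "UNIV \<subseteq> span (w ` I)"
    using card_eq_dim[of "w ` I" UNIV] finite_I by simp
  obtain x where x: "v = coord_vec A c x p" using v tangent_space_eq_range[OF c] by auto
  have "x \<in> span (w ` I)" using span by auto
  then obtain h where "x = (\<Sum>y\<in>w ` I. h y *\<^sub>R y)" using span_finite[of "w ` I"] finite_I by auto
  then have "x = (\<Sum>i\<in>I. h (w i) *\<^sub>R w i)" by (simp add: sum.reindex[OF inj])
  then have vE: "v = (\<lambda>u. \<Sum>i\<in>I. h (w i) * E i u)" using comb[of "\<lambda>i. h (w i)"] x by simp
  have "\<epsilon> j * e j v = h (w j)" if "j \<in> I" for j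
    using coeff[OF that, of "\<lambda>i. h (w i)"] eps_square[OF that] unfolding vE[symmetric] by (simp add: mult.commute mult.left_commute)
  then have "(\<lambda>u. \<Sum>i\<in>I. h (w i) * E i u) = (\<lambda>u. \<Sum>i\<in>I. (\<epsilon> i * e i v) * E i u)" by simp
  then show ?thesis using vE unfolding E_def by metis
qed

lemma coframe_expand:
  assumes \<xi>: "\<xi> \<in> cotangent_space A p"
  shows "\<xi> = (\<lambda>X. \<Sum>i\<in>I. (\<epsilon> i * cometric A g p \<xi> (e i)) * e i X)"
proof (rule cotangent_eqI[OF \<xi> cotangent_sum_mem])
  fix X assume X: "X \<in> tangent_space A p"
  have "\<xi> X = \<xi> (\<lambda>u. \<Sum>i\<in>I. (\<epsilon> i * e i X) * metric_sharp A g p (e i) u)" using frame_expand[OF X] by metis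
  also have "\<dots> = (\<Sum>i\<in>I. (\<epsilon> i * e i X) * \<xi> (metric_sharp A g p (e i)))"
    by (rule cotangent_sum[OF \<xi> metric_sharp_mem[OF e_mem]])
  also have "\<dots> = (\<Sum>i\<in>I. (\<epsilon> i * cometric A g p \<xi> (e i)) * e i X)"
    by (rule sum.cong) (simp_all add: cometric_left[OF \<xi> e_mem])
  finally show "\<xi> X = \<dots>" .
qed (rule e_mem)

lemma cometric_expand:
  assumes \<xi>: "\<xi> \<in> cotangent_space A p" and \<zeta>: "\<zeta> \<in> cotangent_space A p"
  shows "cometric A g p \<xi> \<zeta> = (\<Sum>i\<in>I. \<epsilon> i * cometric A g p \<xi> (e i) * cometric A g p \<zeta> (e i))"
  unfolding cometric_left[OF \<xi> \<zeta>]
  by (subst coframe_expand[OF \<xi>]) (simp add: cometric_right[OF \<zeta> e_mem])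

end

section \<open>Contravariant connections\<close>

context manifold begin

text \<open>
  Multiplication by a bump function that is 1 near \<open>p\<close> and vanishes off a closed subset of \<open>U\<close>.
\<close>

lemma oneform_extension:
  assumes "open U" "oneform_on A U \<omega>" "p \<in> U"
  obtains \<omega>' where "oneform A \<omega>'" "\<forall>\<^sub>F x in nhds p. \<omega>' x = \<omega> x"
proof -
  obtain \<phi> K where b: "smooth_fun A \<phi>" "closed K" "K \<subseteq> U" "\<And>x. x \<notin> K \<Longrightarrow> \<phi> x = 0" "\<forall>\<^sub>F x in nhds p. \<phi> x = 1"
    using bump_function[OF assms(1,3)] by blast
  have "oneform A (form_scale \<phi> \<omega>)"
    unfolding oneform_on_def
  proof (intro conjI ballI)
    fix x
    show "form_scale \<phi> \<omega> x \<in> cotangent_space A x"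
    proof (cases "x \<in> K")
      case True
      then show ?thesis using b(3) oneform_onD[OF assms(2)] by (auto simp: form_scale_def intro: cotangent_scale)
    qed (simp add: form_scale_def b(4) cotangent_zero)
  next
    fix c and i :: 'e assume c: "c \<in> A" and i: "i \<in> Basis"
    show "smooth_fun_on A (fst c \<inter> UNIV) (\<lambda>p. form_scale \<phi> \<omega> p (coord_vec A c i p))"
    proof (rule smooth_fun_on_local)
      fix x assume x: "x \<in> fst c \<inter> UNIV"
      show "\<exists>V. open V \<and> x \<in> V \<and> smooth_fun_on A V (\<lambda>p. form_scale \<phi> \<omega> p (coord_vec A c i p))"
      proof (cases "x \<in> U")
        case True
        have "smooth_fun_on A (fst c \<inter> U) (\<lambda>p. \<phi> p * \<omega> p (coord_vec A c i p))"
          using assms(2) c i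
          by (intro smooth_fun_on_mult smooth_funD[OF b(1)] open_Int chart_open assms(1)) (simp_all add: oneform_on_def)
        then show ?thesis using True x open_Int[OF chart_open[OF c] assms(1)] by (auto simp: form_scale_def)
      next
        case False
        have "smooth_fun_on A (- K) (\<lambda>p. form_scale \<phi> \<omega> p (coord_vec A c i p))"
          by (rule smooth_fun_on_cong[THEN iffD2, OF _ _ smooth_fun_on_const[of _ 0]])
             (use b(2,4) in \<open>auto simp: form_scale_def\<close>)
        then show ?thesis using False b(2,3) by (intro exI[of _ "- K"]) auto
      qed
    qed (use chart_open[OF c] in simp)
  qed
  moreover have "\<forall>\<^sub>F x in nhds p. form_scale \<phi> \<omega> x = \<omega> x"
    using b(5) by (rule eventually_mono) (simp add: form_scale_def)
  ultimately show ?thesis using that by blast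
qed

text \<open>
  Let \<open>\<phi>\<close> be 1 near \<open>p\<close> and 0 where the forms may differ, so that \<open>\<phi> \<omega> = \<phi> \<omega>'\<close> and \<open>\<phi> \<eta> = \<phi> \<eta>'\<close>. Linearity over
  functions in the first argument gives equality at \<open>p\<close> there. In the second argument the Leibniz rule
  leaves the same extra term \<open>#\<omega>'(\<phi>) \<eta>(p)\<close> on both sides.
\<close>

lemma connection_local:
  assumes D: "contravariant_connection A P D"
    and f: "oneform A \<omega>" "oneform A \<omega>'" "oneform A \<eta>" "oneform A \<eta>'"
    and eq: "\<forall>\<^sub>F x in nhds p. \<omega> x = \<omega>' x" "\<forall>\<^sub>F x in nhds p. \<eta> x = \<eta>' x"
  shows "D \<omega> \<eta> p = D \<omega>' \<eta>' p"
proof -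
  obtain U where U: "open U" "p \<in> U" "\<And>x. x \<in> U \<Longrightarrow> \<omega> x = \<omega>' x" "\<And>x. x \<in> U \<Longrightarrow> \<eta> x = \<eta>' x"
    using eventually_conj[OF eq] unfolding eventually_nhds by blast
  obtain \<phi> K where b: "smooth_fun A \<phi>" "closed K" "K \<subseteq> U" "\<And>x. x \<notin> K \<Longrightarrow> \<phi> x = 0" "\<forall>\<^sub>F x in nhds p. \<phi> x = 1"
    using bump_function[OF U(1,2)] by blast
  have \<phi>p: "\<phi> p = 1" using eventually_nhds_x_imp_x[OF b(5)] .
  have s: "form_scale \<phi> \<omega> = form_scale \<phi> \<omega>'" "form_scale \<phi> \<eta> = form_scale \<phi> \<eta>'"
    unfolding form_scale_def using U(3,4) b(3,4) by (intro ext; metis mult_eq_0_iff subsetD)+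
  have D1: "D (form_scale \<phi> \<alpha>) \<beta> = form_scale \<phi> (D \<alpha> \<beta>)"
    and D2: "D \<alpha> (form_scale \<phi> \<beta>) = form_add (form_scale \<phi> (D \<alpha> \<beta>)) (form_scale (contr_deriv_fun A P \<alpha> \<phi>) \<beta>)"
    if "oneform A \<alpha>" "oneform A \<beta>" for \<alpha> \<beta>
    using D b(1) that unfolding contravariant_connection_def by blast+
  have "form_scale \<phi> (D \<omega> \<eta>) p = form_scale \<phi> (D \<omega>' \<eta>) p"
    using D1[OF f(1,3)] D1[OF f(2,3)] s(1) by simp
  then have 1: "D \<omega> \<eta> p = D \<omega>' \<eta> p" by (simp add: form_scale_def \<phi>p)
  have "form_add (form_scale \<phi> (D \<omega>' \<eta>)) (form_scale (contr_deriv_fun A P \<omega>' \<phi>) \<eta>) p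
     = form_add (form_scale \<phi> (D \<omega>' \<eta>')) (form_scale (contr_deriv_fun A P \<omega>' \<phi>) \<eta>') p"
    using D2[OF f(2,3)] D2[OF f(2,4)] s(2) by simp
  then have 2: "D \<omega>' \<eta> p = D \<omega>' \<eta>' p"
    using U(4)[OF U(2)] by (simp add: form_scale_def form_add_def \<phi>p fun_eq_iff)
  show ?thesis using 1 2 by simp
qed

text \<open>
  Existence and uniqueness of the value described by the definition: all pairs of global extensions
  give the same value, by locality.
\<close>

lemma local_conn_eq:
  assumes D: "contravariant_connection A P D"
    and f: "oneform A \<omega>'" "oneform A \<eta>'"
    and eq: "\<forall>\<^sub>F x in nhds p. \<omega>' x = \<omega> x" "\<forall>\<^sub>F x in nhds p. \<eta>' x = \<eta> x"
  shows "local_conn A D \<omega> \<eta> p = D \<omega>' \<eta>' p"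
  unfolding local_conn_def
proof (rule the_equality)
  show "\<exists>\<omega>'' \<eta>''. oneform A \<omega>'' \<and> oneform A \<eta>'' \<and>
       (\<forall>\<^sub>F x in nhds p. \<omega>'' x = \<omega> x \<and> \<eta>'' x = \<eta> x) \<and> D \<omega>' \<eta>' p = D \<omega>'' \<eta>'' p"
    using f eventually_conj[OF eq] by blast
next
  fix \<xi> assume "\<exists>\<omega>'' \<eta>''. oneform A \<omega>'' \<and> oneform A \<eta>'' \<and>
       (\<forall>\<^sub>F x in nhds p. \<omega>'' x = \<omega> x \<and> \<eta>'' x = \<eta> x) \<and> \<xi> = D \<omega>'' \<eta>'' p"
  then obtain \<omega>'' \<eta>'' where *: "oneform A \<omega>''" "oneform A \<eta>''" "\<forall>\<^sub>F x in nhds p. \<omega>'' x = \<omega> x \<and> \<eta>'' x = \<eta> x"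
    and \<xi>: "\<xi> = D \<omega>'' \<eta>'' p" by blast
  show "\<xi> = D \<omega>' \<eta>' p" unfolding \<xi>
  proof (rule connection_local[OF D *(1) f(1) *(2) f(2)])
    show "\<forall>\<^sub>F x in nhds p. \<omega>'' x = \<omega>' x"
      by (rule eventually_mono[OF eventually_conj[OF *(3) eq(1)]]) auto
    show "\<forall>\<^sub>F x in nhds p. \<eta>'' x = \<eta>' x"
      by (rule eventually_mono[OF eventually_conj[OF *(3) eq(2)]]) auto
  qed
qed

end

locale bivector_metric_manifold = bivector_manifold A P + metric_manifold A g
  for A :: "('m::{t2_space,second_countable_topology}, 'e::euclidean_space) atlas" and P g
begin

text \<open>
  The covector \<open>J \<omega>\<close> is the metric dual of the vector \<open>#\<omega>\<close>: both sides of the defining identity are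
  then the value of \<open>\<eta>\<close> on \<open>#\<omega>\<close>. It is unique since every tangent vector is the metric dual of a covector.
\<close>

lemma J_endo_properties:
  assumes \<omega>: "\<omega> p \<in> cotangent_space A p"
  shows "J_endo A P g \<omega> p \<in> cotangent_space A p"
    and "\<eta> \<in> cotangent_space A p \<Longrightarrow> cometric A g p (J_endo A P g \<omega> p) \<eta> = P p (\<omega> p) \<eta>"
proof -
  define S where "S = sharp A P \<omega> p"
  have S: "S \<in> tangent_space A p" unfolding S_def by (rule sharp_mem[of \<omega>, OF \<omega>])
  \<comment> \<open>\<open>flat\<close> lowers the index of a vector with the metric; it is inverse to \<open>metric_sharp\<close>.\<close>
  define flat where "flat = (\<lambda>Y X. if X \<in> tangent_space A p then g p X Y else 0)"
  have flat: "flat Y \<in> cotangent_space A p" "metric_sharp A g p (flat Y) = Y" if "Y \<in> tangent_space A p" for Y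
  proof -
    show "flat Y \<in> cotangent_space A p" unfolding flat_def by (rule g_cotangent[OF that])
    show "metric_sharp A g p (flat Y) = Y"
      by (rule metric_sharp_unique[OF that]) (simp add: flat_def g_sym[OF that])
  qed
  have ex: "flat S \<in> cotangent_space A p \<and> (\<forall>\<eta>\<in>cotangent_space A p. P p (\<omega> p) \<eta> = cometric A g p (flat S) \<eta>)"
    using flat[OF S] cometric_right[OF flat(1)[OF S]] sharp_apply[of \<omega>, OF \<omega>] by (simp add: S_def)
  have "J_endo A P g \<omega> p \<in> cotangent_space A p \<and>
      (\<forall>\<eta>\<in>cotangent_space A p. P p (\<omega> p) \<eta> = cometric A g p (J_endo A P g \<omega> p) \<eta>)"
    unfolding J_endo_def
  proof (rule theI2[of _ "flat S"])
    fix \<xi> assume \<xi>: "\<xi> \<in> cotangent_space A p \<and> (\<forall>\<eta>\<in>cotangent_space A p. P p (\<omega> p) \<eta> = cometric A g p \<xi> \<eta>)"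
    show "\<xi> = flat S"
    proof (rule cotangent_eqI)
      fix X assume X: "X \<in> tangent_space A p"
      have "\<xi> X = cometric A g p \<xi> (flat X)" using cometric_left[of \<xi> p "flat X"] \<xi> flat[OF X] by simp
      also have "\<dots> = cometric A g p (flat S) (flat X)" using \<xi> ex flat(1)[OF X] by metis
      also have "\<dots> = flat S X" using cometric_left[OF flat(1)[OF S] flat(1)[OF X]] flat(2)[OF X] by simp
      finally show "\<xi> X = flat S X" .
    qed (use \<xi> flat(1)[OF S] in auto)
  qed (use ex in auto)
  then show "J_endo A P g \<omega> p \<in> cotangent_space A p"
    "\<eta> \<in> cotangent_space A p \<Longrightarrow> cometric A g p (J_endo A P g \<omega> p) \<eta> = P p (\<omega> p) \<eta>" by auto
qed

text \<open>
  The Koszul formula for an orthonormal coframe. The products of the coframe elements are constant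
  near \<open>p\<close>, so only the bracket term survives; and it is only needed on the metric dual of \<open>e i\<close>.
\<close>

lemma second_contr_deriv_frame:
  fixes e :: "'i \<Rightarrow> 'm form"
  assumes D: "contravariant_levi_civita A P g D"
    and U: "open U" "p \<in> U" and I: "finite I" "card I = DIM('e)"
    and e: "\<And>i. i \<in> I \<Longrightarrow> oneform_on A U (e i)"
    and on: "\<And>x i j. x \<in> U \<Longrightarrow> i \<in> I \<Longrightarrow> j \<in> I \<Longrightarrow> cometric A g x (e i x) (e j x) = (if i = j then \<epsilon> i else 0)"
    and eps: "\<And>i. i \<in> I \<Longrightarrow> \<epsilon> i * \<epsilon> i = 1"
    and i: "i \<in> I"
  shows "second_contr_deriv A P D (e i) (e i) u p = sharp A P (e i) p (\<lambda>x. sharp A P (e i) x u)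
    + (\<Sum>k\<in>I. \<epsilon> k * form_bracket A P (e i) (e k) p (metric_sharp A g p (e i p)) * sharp A P (e k) p u)"
proof -
  have em: "e k x \<in> cotangent_space A x" if "k \<in> I" "x \<in> U" for k x by (rule oneform_onD[OF e[OF that(1)] that(2)])
  interpret orthonormal_covectors A g p I "\<lambda>k. e k p" \<epsilon>
    by unfold_locales (use U I on eps em in auto)
  have conn: "contravariant_connection A P D" using D by (simp add: contravariant_levi_civita_def)
  have "\<forall>k\<in>I. \<exists>\<omega>. oneform A \<omega> \<and> (\<forall>\<^sub>F x in nhds p. \<omega> x = e k x)"
    using oneform_extension[OF U(1) e U(2)] by metis
  then obtain E where E: "\<And>k. k \<in> I \<Longrightarrow> oneform A (E k)" "\<And>k. k \<in> I \<Longrightarrow> \<forall>\<^sub>F x in nhds p. E k x = e k x"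
    by (metis (no_types))
  have Ep: "E k p = e k p" if "k \<in> I" for k using eventually_nhds_x_imp_x[OF E(2)[OF that]] .
  have mem: "D \<omega> \<eta> p \<in> cotangent_space A p" if "oneform A \<omega>" "oneform A \<eta>" for \<omega> \<eta>
  proof (rule oneform_onD)
    show "oneform A (D \<omega> \<eta>)" using conn that by (simp add: contravariant_connection_def)
  qed simp
  define \<xi> where "\<xi> = D (E i) (E i) p"
  have \<xi>: "\<xi> \<in> cotangent_space A p" unfolding \<xi>_def by (rule mem[OF E(1)[OF i] E(1)[OF i]])
  have lc: "local_conn A D (e i) (e i) p = \<xi>"
    unfolding \<xi>_def by (rule local_conn_eq[OF conn E(1)[OF i] E(1)[OF i] E(2)[OF i] E(2)[OF i]])
  define s where "s = metric_sharp A g p (e i p)"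
  have s: "s \<in> tangent_space A p" unfolding s_def by (rule metric_sharp_mem[OF em[OF i U(2)]])
  have const: "contr_deriv_fun A P (E l) (\<lambda>x. cometric A g x (E j x) (E k x)) p = 0" if "l \<in> I" "j \<in> I" "k \<in> I" for l j k
  proof -
    have T: "sharp A P (E l) p \<in> tangent_space A p" by (rule sharp_mem) (simp add: Ep em U that)
    have "\<forall>\<^sub>F x in nhds p. cometric A g x (E j x) (E k x) = (if j = k then \<epsilon> j else 0)"
      using E(2)[OF that(2)] E(2)[OF that(3)] eventually_nhds_in_open[OF U]
      by eventually_elim (use on that in simp)
    from tangent_cong[OF T this] show ?thesis by (simp add: contr_deriv_fun_def tangent_const[OF T])
  qed
  have metric: "contr_deriv_fun A P \<omega> (\<lambda>x. cometric A g x (\<eta> x) (\<gamma> x)) p =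
          cometric A g p (D \<omega> \<eta> p) (\<gamma> p) + cometric A g p (\<eta> p) (D \<omega> \<gamma> p)"
    if "oneform A \<omega>" "oneform A \<eta>" "oneform A \<gamma>" for \<omega> \<eta> \<gamma>
    using D that unfolding contravariant_levi_civita_def by blast
  have torsion: "D \<omega> \<eta> p v - D \<eta> \<omega> p v = form_bracket A P \<omega> \<eta> p v" if "oneform A \<omega>" "oneform A \<eta>" for \<omega> \<eta> v
  proof -
    have "(\<lambda>p v. D \<omega> \<eta> p v - D \<eta> \<omega> p v) = form_bracket A P \<omega> \<eta>"
      using D that unfolding contravariant_levi_civita_def by blast
    from fun_cong[OF fun_cong[OF this]] show ?thesis .
  qed
  \<comment> \<open>The components of \<open>\<xi> = D e\<^sub>i e\<^sub>i\<close> in the coframe.\<close>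
  have koszul: "cometric A g p \<xi> (e k p) = - form_bracket A P (e i) (e k) p s" if k: "k \<in> I" for k
  proof -
    \<comment> \<open>Metric compatibility, differentiating \<open><e\<^sub>i, e\<^sub>k>\<close> along \<open>e\<^sub>i\<close>.\<close>
    have 1: "cometric A g p \<xi> (e k p) + cometric A g p (e i p) (D (E i) (E k) p) = 0"
      using metric[OF E(1)[OF i] E(1)[OF i] E(1)[OF k]] const[OF i i k] by (simp add: \<xi>_def Ep i k)
    have 2: "cometric A g p (e i p) (D (E i) (E k) p) = D (E i) (E k) p s"
      unfolding s_def by (rule cometric_right[OF em[OF i U(2)] mem[OF E(1)[OF i] E(1)[OF k]]])
    have 3: "cometric A g p (e i p) (D (E k) (E i) p) = D (E k) (E i) p s"
      unfolding s_def by (rule cometric_right[OF em[OF i U(2)] mem[OF E(1)[OF k] E(1)[OF i]]])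
    \<comment> \<open>Metric compatibility, differentiating \<open><e\<^sub>i, e\<^sub>i>\<close> along \<open>e\<^sub>k\<close>.\<close>
    have "cometric A g p (D (E k) (E i) p) (e i p) + cometric A g p (e i p) (D (E k) (E i) p) = 0"
      using metric[OF E(1)[OF k] E(1)[OF i] E(1)[OF i]] const[OF k i i] by (simp add: Ep i)
    then have 4: "D (E k) (E i) p s = 0"
      using 3 cometric_sym[OF em[OF i U(2)] mem[OF E(1)[OF k] E(1)[OF i]]] by simp
    have 5: "form_bracket A P (E i) (E k) p s = form_bracket A P (e i) (e k) p s"
      by (rule form_bracket_local[OF U e[OF i] e[OF k] _ _ E(2)[OF i] E(2)[OF k] s])
         (use E(1) i k in \<open>auto intro: oneform_on_subset\<close>)
    show ?thesis using 1 2 4 5 torsion[OF E(1)[OF i] E(1)[OF k], of s] by simp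
  qed
  have du: "differential A u p \<in> cotangent_space A p" by (rule differential_mem)
  have "contr_deriv_fun A P (local_conn A D (e i) (e i)) u p = P p \<xi> (differential A u p)"
    unfolding contr_deriv_fun_def using sharp_fun[of "local_conn A D (e i) (e i)" p u] \<xi> lc by simp
  also have "\<dots> = P p (\<lambda>X. \<Sum>k\<in>I. (\<epsilon> k * cometric A g p \<xi> (e k p)) * e k p X) (differential A u p)"
    using coframe_expand[OF \<xi>] by metis
  also have "\<dots> = (\<Sum>k\<in>I. (\<epsilon> k * cometric A g p \<xi> (e k p)) * P p (e k p) (differential A u p))"
    by (rule P_sum[OF _ du]) (rule em[OF _ U(2)])
  also have "\<dots> = (\<Sum>k\<in>I. - (\<epsilon> k * form_bracket A P (e i) (e k) p s * sharp A P (e k) p u))"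
    by (rule sum.cong) (simp_all add: koszul sharp_fun em U(2))
  finally show ?thesis
    unfolding second_contr_deriv_def s_def[symmetric] by (simp add: contr_deriv_fun_def sum_negf)
qed

end

section \<open>Smooth maps\<close>

text \<open>
  Smoothness is expressed by pull-back of functions, which is the form in which push-forwards of tangent
  vectors, being operators on functions, use it.
\<close>

locale smooth_map = source: manifold A + target: manifold B
  for A :: "('m::{t2_space,second_countable_topology}, 'e::euclidean_space) atlas"
    and B :: "('n::{t2_space,second_countable_topology}, 'd::euclidean_space) atlas" +
  fixes F :: "'m \<Rightarrow> 'n"
  assumes continuous: "continuous_on UNIV F"
    and smooth_comp: "smooth_at B (F p) u \<Longrightarrow> smooth_at A p (\<lambda>x. u (F x))"
begin

lemma pushforward_apply: "smooth_at B (F p) u \<Longrightarrow> pushforward B F p X u = X (\<lambda>x. u (F x))"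
  by (simp add: pushforward_def comp_def)

lemma open_vimage: "open W \<Longrightarrow> open (F -` W)"
  using continuous by (simp add: open_vimage continuous_on_open_vimage)

lemma smooth_fun_on_comp:
  assumes "open W" "smooth_fun_on B W u"
  shows "smooth_fun_on A (F -` W) (\<lambda>x. u (F x))"
  by (rule source.smooth_fun_on_of_smooth_at[OF open_vimage[OF assms(1)]])
     (use target.smooth_atI[OF assms(1) _ assms(2)] smooth_comp in auto)

text \<open>
  The push-forward is the coordinate vector whose direction is the derivative of \<open>F\<close> in charts: the
  chain rule for \<open>u \<circ> F\<close>. The chart expression of \<open>F\<close> is differentiable because its components are
  coordinate functions composed with \<open>F\<close>.
\<close>

lemma pushforward_tangent:
  assumes X: "X \<in> tangent_space A p"
  shows "pushforward B F p X \<in> tangent_space B (F p)"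
proof -
  obtain c v where c: "c \<in> A" "p \<in> fst c" and Xv: "X = coord_vec A c v p" using X by (rule source.tangentE)
  obtain d where d: "d \<in> B" "F p \<in> fst d" by (rule target.chart_cover)
  define y where "y = (\<lambda>z. snd d (F (chart_inv c z)))"
  define z0 where "z0 = snd c p"
  have inv: "chart_inv c z0 = p" using c by (simp add: z0_def)
  define O' where "O' = snd c ` (fst c \<inter> F -` fst d)"
  have O': "open O'" "z0 \<in> O'" unfolding O'_def z0_def
    using source.chart_image_open[OF c(1) open_vimage[OF target.chart_open[OF d(1)]]] c d by auto
  have "\<exists>D. (y has_derivative D) (at z0)"
  proof -
    have "((\<lambda>z. y z \<bullet> b) has_derivative frechet_derivative (\<lambda>z. y z \<bullet> b) (at z0)) (at z0)" for b
      using source.smooth_at_has_derivative[OF c smooth_comp[OF target.smooth_at_coord[OF d, of b]]]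
      by (simp add: y_def z0_def)
    then show ?thesis
      using has_derivative_componentwise_within[of y "\<lambda>w. \<Sum>b\<in>Basis. frechet_derivative (\<lambda>z. y z \<bullet> b) (at z0) w *\<^sub>R b" z0 UNIV]
      by (auto simp: inner_sum_left_Basis)
  qed
  then obtain D where D: "(y has_derivative D) (at z0)" ..
  have "pushforward B F p X u = coord_vec B d (D v) (F p) u" for u
  proof (cases "smooth_at B (F p) u")
    case True
    have yz: "y z0 = snd d (F p)" by (simp add: y_def inv)
    have "((\<lambda>z. u (chart_inv d z)) has_derivative frechet_derivative (\<lambda>z. u (chart_inv d z)) (at (y z0))) (at (y z0))"
      unfolding yz by (rule target.smooth_at_has_derivative[OF d True])
    from has_derivative_compose[OF D this]
    have "((\<lambda>z. u (F (chart_inv c z))) has_derivative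
        (\<lambda>v. frechet_derivative (\<lambda>z. u (chart_inv d z)) (at (y z0)) (D v))) (at z0)"
      by (rule has_derivative_transform_within_open[OF _ O']) (use c d in \<open>auto simp: O'_def y_def\<close>)
    then have "X (\<lambda>x. u (F x)) = frechet_derivative (\<lambda>z. u (chart_inv d z)) (at (y z0)) (D v)"
      unfolding Xv z0_def by (rule source.coord_vec_eqI[OF smooth_comp[OF True]])
    then show ?thesis
      using pushforward_apply[OF True] target.coord_vec_eq[OF True] by (simp add: yz)
  qed (simp add: pushforward_def coord_vec_def)
  then have "pushforward B F p X = coord_vec B d (D v) (F p)" by blast
  then show ?thesis using target.coord_vec_tangent[OF d] by simp
qed

lemma pushforward_lincomb:
  "pushforward B F p (\<lambda>u. a * X u + b * Y u) = (\<lambda>u. a * pushforward B F p X u + b * pushforward B F p Y u)"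
  by (auto simp: pushforward_def)

lemma pushforward_scale: "pushforward B F p (\<lambda>u. a * X u) = (\<lambda>u. a * pushforward B F p X u)"
  by (auto simp: pushforward_def)

lemma pushforward_zero: "pushforward B F p (\<lambda>u. 0) = (\<lambda>u. 0)"
  by (auto simp: pushforward_def)

lemma pullback_apply: "X \<in> tangent_space A p \<Longrightarrow> pullback_covec A B F p \<xi> X = \<xi> (pushforward B F p X)"
  by (simp add: pullback_covec_def)

lemma pullback_mem:
  assumes "\<xi> \<in> cotangent_space B (F p)"
  shows "pullback_covec A B F p \<xi> \<in> cotangent_space A p"
  using target.cotangent_lincomb[OF assms] pushforward_tangent
  by (simp add: cotangent_space_def pullback_covec_def pushforward_lincomb source.tangent_lincomb)

lemma pullback_lincomb:
  "pullback_covec A B F p (\<lambda>X. a * \<xi> X + b * \<zeta> X)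
    = (\<lambda>X. a * pullback_covec A B F p \<xi> X + b * pullback_covec A B F p \<zeta> X)"
  by (auto simp: pullback_covec_def)

lemma pullback_scale: "pullback_covec A B F p (\<lambda>X. a * \<xi> X) = (\<lambda>X. a * pullback_covec A B F p \<xi> X)"
  by (auto simp: pullback_covec_def)

text \<open>
  In a chart of the target, the components of the pull-back are sums of products of derivatives of the
  coordinates of \<open>F\<close> with components of \<open>\<omega>\<close> composed with \<open>F\<close>.
\<close>

lemma pullback_oneform:
  assumes W: "open W" and \<omega>: "oneform_on B W \<omega>"
  shows "oneform_on A (F -` W) (pullback_form A B F \<omega>)"
  unfolding oneform_on_def
proof (intro conjI ballI)
  fix p assume "p \<in> F -` W"
  then show "pullback_form A B F \<omega> p \<in> cotangent_space A p"
    unfolding pullback_form_def by (intro pullback_mem target.oneform_onD[OF \<omega>]) simp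
next
  fix c and b :: 'e assume c: "c \<in> A" and b: "b \<in> Basis"
  have o: "open (fst c \<inter> F -` W)" using source.chart_open[OF c] open_vimage[OF W] by blast
  show "smooth_fun_on A (fst c \<inter> F -` W) (\<lambda>p. pullback_form A B F \<omega> p (coord_vec A c b p))"
  proof (rule source.smooth_fun_on_local[OF o])
    fix p assume p: "p \<in> fst c \<inter> F -` W"
    obtain d where d: "d \<in> B" "F p \<in> fst d" by (rule target.chart_cover)
    have od: "open (fst d \<inter> W)" using target.chart_open[OF d(1)] W by blast
    define N where "N = fst c \<inter> F -` (fst d \<inter> W)"
    have N: "open N" "p \<in> N" "N \<subseteq> fst c" "N \<subseteq> F -` (fst d \<inter> W)"
      using p d source.chart_open[OF c] open_vimage[OF od] by (auto simp: N_def)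
    have "smooth_fun_on A N (\<lambda>x. \<Sum>j\<in>Basis. coord_vec A c b x (\<lambda>x. snd d (F x) \<bullet> j) * \<omega> (F x) (coord_vec B d j (F x)))"
    proof (rule source.smooth_fun_on_sum[OF N(1)], rule source.smooth_fun_on_mult[OF N(1)])
      fix j :: 'd assume j: "j \<in> Basis"
      have "smooth_fun_on B (fst d \<inter> W) (\<lambda>y. snd d y \<bullet> j)"
        by (rule target.smooth_fun_on_subset[OF target.smooth_fun_on_coord[OF d(1)]]) simp
      then have "smooth_fun_on A N (\<lambda>x. snd d (F x) \<bullet> j)"
        by (rule source.smooth_fun_on_subset[OF smooth_fun_on_comp[OF od] N(4)])
      then show "smooth_fun_on A N (\<lambda>x. coord_vec A c b x (\<lambda>x. snd d (F x) \<bullet> j))"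
        by (rule source.coord_vec_smooth[OF c N(1,3)])
      have "smooth_fun_on B (fst d \<inter> W) (\<lambda>y. \<omega> y (coord_vec B d j y))"
        using \<omega> d(1) j by (simp add: oneform_on_def)
      then show "smooth_fun_on A N (\<lambda>x. \<omega> (F x) (coord_vec B d j (F x)))"
        by (rule source.smooth_fun_on_subset[OF smooth_fun_on_comp[OF od] N(4)])
    qed
    then have "smooth_fun_on A N (\<lambda>p. pullback_form A B F \<omega> p (coord_vec A c b p))"
    proof (rule source.smooth_fun_on_cong[OF N(1), THEN iffD1, rotated])
      fix x assume x: "x \<in> N"
      then have Fx: "F x \<in> fst d" "F x \<in> W" "x \<in> fst c" using N(3,4) by auto
      have T: "coord_vec A c b x \<in> tangent_space A x" by (rule source.coord_vec_tangent[OF c Fx(3)])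
      have "pullback_form A B F \<omega> x (coord_vec A c b x) = \<omega> (F x) (pushforward B F x (coord_vec A c b x))"
        unfolding pullback_form_def by (rule pullback_apply[OF T])
      also have "\<dots> = (\<Sum>j\<in>Basis. pushforward B F x (coord_vec A c b x) (\<lambda>y. snd d y \<bullet> j) * \<omega> (F x) (coord_vec B d j (F x)))"
        by (rule target.cotangent_apply[OF d(1) Fx(1) target.oneform_onD[OF \<omega> Fx(2)] pushforward_tangent[OF T]])
      finally show "(\<Sum>j\<in>Basis. coord_vec A c b x (\<lambda>x. snd d (F x) \<bullet> j) * \<omega> (F x) (coord_vec B d j (F x)))
          = pullback_form A B F \<omega> x (coord_vec A c b x)"
        by (simp add: pushforward_apply target.smooth_at_coord[OF d(1) Fx(1)])
    qed
    then show "\<exists>V. open V \<and> p \<in> V \<and> smooth_fun_on A V (\<lambda>p. pullback_form A B F \<omega> p (coord_vec A c b p))"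
      using N(1,2) by blast
  qed
qed

end

lemma smooth_map_by_charts:
  fixes A :: "('m::{t2_space,second_countable_topology}, 'e::euclidean_space) atlas"
    and B :: "('n::{t2_space,second_countable_topology}, 'd::euclidean_space) atlas"
  assumes "manifold A" "manifold B" and F: "continuous_on UNIV F"
    and loc: "\<And>p. \<exists>c\<in>A. \<exists>d\<in>B. \<exists>V. open V \<and> p \<in> V \<and> V \<subseteq> fst c \<and> F ` V \<subseteq> fst d \<and>
      smooth_on (snd c ` V) (\<lambda>z. snd d (F (chart_inv c z)))"
  shows "smooth_map A B F"
proof -
  interpret source: manifold A by fact
  interpret target: manifold B by fact
  show ?thesis
  proof unfold_locales
    fix p u assume "smooth_at B (F p) u"
    then obtain W where W: "open W" "F p \<in> W" "smooth_fun_on B W u" by (auto simp: smooth_at_def)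
    from loc[of p] obtain c d V where c: "c \<in> A" and d: "d \<in> B"
      and V: "open V" "p \<in> V" "V \<subseteq> fst c" "F ` V \<subseteq> fst d"
      and y: "smooth_on (snd c ` V) (\<lambda>z. snd d (F (chart_inv c z)))" by blast
    define N where "N = V \<inter> F -` W"
    have N: "open N" "p \<in> N" "N \<subseteq> fst c" "N \<subseteq> V"
      using V W Topological_Spaces.open_vimage[OF W(1) F] by (auto simp: N_def)
    have o: "open (snd c ` N)" by (rule source.chart_image_open'[OF c N(1,3)])
    have inv: "chart_inv c (snd c x) = x" if "x \<in> N" for x using source.chart_inv_chart[OF c] that N(3) by blast
    have "smooth_on (snd c ` N) (\<lambda>z. (\<lambda>z. u (chart_inv d z)) (snd d (F (chart_inv c z))))"
    proof (rule smooth_on_compose[OF o target.chart_image_open[OF d W(1)] _ _ target.smooth_fun_onD[OF W(3) d]])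
      show "(\<lambda>z. snd d (F (chart_inv c z))) ` snd c ` N \<subseteq> snd d ` (fst d \<inter> W)"
        using inv V(4) N(4) by (force simp: N_def)
      show "smooth_on (snd c ` N) (\<lambda>z. snd d (F (chart_inv c z)))"
        by (rule smooth_on_subset[OF y]) (use N(4) in auto)
    qed
    then have "smooth_on (snd c ` N) (\<lambda>z. u (F (chart_inv c z)))"
    proof (rule smooth_on_cong[OF o, THEN iffD1, rotated])
      fix z assume "z \<in> snd c ` N"
      then obtain x where x: "x \<in> N" "z = snd c x" by blast
      then have "F x \<in> fst d" using V(4) N(4) by blast
      then show "u (chart_inv d (snd d (F (chart_inv c z)))) = u (F (chart_inv c z))"
        by (simp add: x(2) inv[OF x(1)] target.chart_inv_chart[OF d])
    qed
    then show "smooth_at A p (\<lambda>x. u (F x))"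
      by (rule source.smooth_atI[OF N(1,2) source.smooth_fun_on_chart[OF c N(1,3)]])
  qed (rule F)
qed

section \<open>Product manifolds\<close>

abbreviation prod_chart :: "('m, 'e) chart \<Rightarrow> ('n, 'd) chart \<Rightarrow> ('m \<times> 'n, 'e \<times> 'd) chart" where
  "prod_chart c d \<equiv> (fst c \<times> fst d, \<lambda>x. (snd c (fst x), snd d (snd x)))"

lemma sum_Basis_prod:
  fixes h :: "'a::euclidean_space \<times> 'b::euclidean_space \<Rightarrow> real"
  shows "sum h Basis = (\<Sum>i\<in>Basis. h (i, 0)) + (\<Sum>i\<in>Basis. h (0, i))"
  unfolding Basis_prod_def by (subst sum.union_disjoint) (auto simp: Basis_prod_def sum.reindex inj_on_def)

locale product_manifold = M1: manifold A1 + M2: manifold A2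
  for A1 :: "('m1::{t2_space,second_countable_topology}, 'e1::euclidean_space) atlas"
    and A2 :: "('m2::{t2_space,second_countable_topology}, 'e2::euclidean_space) atlas"
begin

abbreviation (input) "A \<equiv> prod_atlas A1 A2"

lemma prod_chart_mem: "c \<in> A1 \<Longrightarrow> d \<in> A2 \<Longrightarrow> prod_chart c d \<in> A"
  unfolding prod_atlas_def by blast

lemma prod_atlasE:
  assumes "e \<in> A" obtains c d where "c \<in> A1" "d \<in> A2" "e = prod_chart c d"
  using assms unfolding prod_atlas_def by blast

lemma prod_chart_inv:
  assumes "c \<in> A1" "d \<in> A2" "x \<in> fst c" "y \<in> fst d"
  shows "chart_inv (prod_chart c d) (snd c x, snd d y) = (x, y)"
proof -
  have "inj_on (\<lambda>x. (snd c (fst x), snd d (snd x))) (fst c \<times> fst d)"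
    using assms(1,2) by (intro inj_onI) (metis M1.chart_inv_chart M2.chart_inv_chart fst_conv snd_conv mem_Times_iff prod.collapse)
  from inv_into_f_f[OF this, of "(x, y)"] show ?thesis using assms by (simp add: chart_inv_def)
qed

lemma prod_chart_image: "snd (prod_chart c d) ` (U \<times> V) = (snd c ` U) \<times> (snd d ` V)"
  by force

text \<open>
  The inverse of a product chart has prescribed values only on the image of the chart; there it is the
  product of the inverses.
\<close>

lemma prod_chart_inv':
  assumes "c \<in> A1" "d \<in> A2" "U \<subseteq> fst c" "V \<subseteq> fst d" "z \<in> (snd c ` U) \<times> (snd d ` V)"
  shows "chart_inv (prod_chart c d) z = (chart_inv c (fst z), chart_inv d (snd z))"
proof -
  obtain x y where z: "x \<in> U" "y \<in> V" "z = (snd c x, snd d y)" using assms(5) by blast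
  have xy: "x \<in> fst c" "y \<in> fst d" using z assms(3,4) by blast+
  show ?thesis
    unfolding z(3) using prod_chart_inv[OF assms(1,2) xy] M1.chart_inv_chart[OF assms(1) xy(1)] M2.chart_inv_chart[OF assms(2) xy(2)]
    by simp
qed

lemma product_smooth_manifold: "smooth_manifold A"
  unfolding smooth_manifold_def
proof (intro conjI ballI)
  fix e assume "e \<in> A"
  then obtain c d where e: "c \<in> A1" "d \<in> A2" "e = prod_chart c d" by (rule prod_atlasE)
  show "open (fst e)" using e M1.chart_open M2.chart_open by (simp add: open_Times)
  have im: "snd e ` fst e = (snd c ` fst c) \<times> (snd d ` fst d)" unfolding e fst_conv by (rule prod_chart_image)
  show "open (snd e ` fst e)" unfolding im
    using M1.chart_image_open[OF e(1) open_UNIV] M2.chart_image_open[OF e(2) open_UNIV] by (simp add: open_Times)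
  show "homeomorphism (fst e) (snd e ` fst e) (snd e) (chart_inv e)"
  proof (rule homeomorphismI)
    have "continuous_on (fst c \<times> fst d) (\<lambda>x. (snd c (fst x), snd d (snd x)))"
      by (intro continuous_on_Pair
          continuous_on_compose2[OF homeomorphism_cont1[OF M1.chart_homeo[OF e(1)]] continuous_on_fst[OF continuous_on_id]]
          continuous_on_compose2[OF homeomorphism_cont1[OF M2.chart_homeo[OF e(2)]] continuous_on_snd[OF continuous_on_id]]) auto
    then show "continuous_on (fst e) (snd e)" by (simp add: e)
    have "continuous_on (snd e ` fst e) (\<lambda>z. (chart_inv c (fst z), chart_inv d (snd z)))" unfolding im
      by (intro continuous_on_Pair
          continuous_on_compose2[OF homeomorphism_cont2[OF M1.chart_homeo[OF e(1)]] continuous_on_fst[OF continuous_on_id]]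
          continuous_on_compose2[OF homeomorphism_cont2[OF M2.chart_homeo[OF e(2)]] continuous_on_snd[OF continuous_on_id]]) auto
    moreover have "(chart_inv c (fst z), chart_inv d (snd z)) = chart_inv e z" if "z \<in> snd e ` fst e" for z
      using prod_chart_inv'[OF e(1,2) order_refl order_refl, of z] that[unfolded im] unfolding e(3) by simp
    ultimately show "continuous_on (snd e ` fst e) (chart_inv e)"
      by (rule continuous_on_eq)
    have inv: "chart_inv e (snd e z) = z" if "z \<in> fst e" for z
      using prod_chart_inv[OF e(1,2), of "fst z" "snd z"] that by (simp add: e(3) mem_Times_iff)
    show "chart_inv e ` (snd e ` fst e) \<subseteq> fst e" "\<And>x. x \<in> fst e \<Longrightarrow> chart_inv e (snd e x) = x"
      "\<And>y. y \<in> snd e ` fst e \<Longrightarrow> snd e (chart_inv e y) = y"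
      using inv by auto
  qed simp
next
  show "(\<Union>e\<in>A. fst e) = UNIV"
  proof (intro equalityI subset_UNIV subsetI)
    fix z :: "'m1 \<times> 'm2"
    obtain c where c: "c \<in> A1" "fst z \<in> fst c" by (rule M1.chart_cover)
    obtain d where d: "d \<in> A2" "snd z \<in> fst d" by (rule M2.chart_cover)
    show "z \<in> (\<Union>e\<in>A. fst e)" using prod_chart_mem[OF c(1) d(1)] c d
      by (intro UN_I[of "prod_chart c d"]) (auto simp: mem_Times_iff)
  qed
next
  fix e e' assume eA: "e \<in> A" and e'A: "e' \<in> A"
  from eA obtain c d where e: "c \<in> A1" "d \<in> A2" "e = prod_chart c d" by (rule prod_atlasE)
  from e'A obtain c' d' where e': "c' \<in> A1" "d' \<in> A2" "e' = prod_chart c' d'" by (rule prod_atlasE)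
  define S1 where "S1 = snd c ` (fst c \<inter> fst c')"
  define S2 where "S2 = snd d ` (fst d \<inter> fst d')"
  have S: "open S1" "open S2" unfolding S1_def S2_def
    by (rule M1.chart_image_open[OF e(1) M1.chart_open[OF e'(1)]], rule M2.chart_image_open[OF e(2) M2.chart_open[OF e'(2)]])
  have im: "snd e ` (fst e \<inter> fst e') = S1 \<times> S2"
    unfolding e(3) e'(3) S1_def S2_def fst_conv Times_Int_Times by (rule prod_chart_image)
  have oS: "open (S1 \<times> S2)" using S by (rule open_Times)
  have f: "smooth_on (S1 \<times> S2) fst" and s: "smooth_on (S1 \<times> S2) snd"
    by (rule smooth_on_bounded_linear[OF oS bounded_linear_fst], rule smooth_on_bounded_linear[OF oS bounded_linear_snd])
  have "smooth_on (S1 \<times> S2) (\<lambda>z. ((\<lambda>z. snd c' (chart_inv c z)) (fst z), (\<lambda>z. snd d' (chart_inv d z)) (snd z)))"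
    by (intro smooth_on_Pair oS smooth_on_compose[OF oS S(1) _ f M1.transition_smooth[OF e(1) e'(1), folded S1_def]]
          smooth_on_compose[OF oS S(2) _ s M2.transition_smooth[OF e(2) e'(2), folded S2_def]]) auto
  then show "smooth_on (snd e ` (fst e \<inter> fst e')) (snd e' \<circ> chart_inv e)" unfolding im
    by (rule smooth_on_cong[OF oS, THEN iffD1, rotated])
       (use prod_chart_inv'[OF e(1,2), of "fst c \<inter> fst c'" "fst d \<inter> fst d'"] in \<open>simp add: S1_def S2_def e(3) e'(3)\<close>)
qed

end

sublocale product_manifold \<subseteq> M: manifold "prod_atlas A1 A2"
  by unfold_locales (rule product_smooth_manifold)

context product_manifold begin

lemma smooth_map_fst: "smooth_map A A1 fst"
proof (rule smooth_map_by_charts[OF M.manifold_axioms M1.manifold_axioms])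
  fix p :: "'m1 \<times> 'm2"
  obtain c where c: "c \<in> A1" "fst p \<in> fst c" by (rule M1.chart_cover)
  obtain d where d: "d \<in> A2" "snd p \<in> fst d" by (rule M2.chart_cover)
  have e: "prod_chart c d \<in> A" by (rule prod_chart_mem[OF c(1) d(1)])
  have o: "open (snd c ` fst c \<times> snd d ` fst d)"
    using M1.chart_image_open[OF c(1) open_UNIV] M2.chart_image_open[OF d(1) open_UNIV] by (simp add: open_Times)
  have "smooth_on (snd (prod_chart c d) ` fst (prod_chart c d)) (\<lambda>z. snd c (fst (chart_inv (prod_chart c d) z)))"
    unfolding fst_conv prod_chart_image
    by (rule smooth_on_cong[OF o, THEN iffD1, OF _ smooth_on_bounded_linear[OF o bounded_linear_fst]])
       (use prod_chart_inv[OF c(1) d(1)] in auto)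
  then show "\<exists>c\<in>A. \<exists>d\<in>A1. \<exists>V. open V \<and> p \<in> V \<and> V \<subseteq> fst c \<and> fst ` V \<subseteq> fst d \<and>
      smooth_on (snd c ` V) (\<lambda>z. snd d (fst (chart_inv c z)))"
    using c d M.chart_open[OF e]
    by (intro bexI[OF _ e] bexI[OF _ c(1)] exI[of _ "fst (prod_chart c d)"]) (auto simp: mem_Times_iff)
qed (intro continuous_intros)

lemma smooth_map_snd: "smooth_map A A2 snd"
proof (rule smooth_map_by_charts[OF M.manifold_axioms M2.manifold_axioms])
  fix p :: "'m1 \<times> 'm2"
  obtain c where c: "c \<in> A1" "fst p \<in> fst c" by (rule M1.chart_cover)
  obtain d where d: "d \<in> A2" "snd p \<in> fst d" by (rule M2.chart_cover)
  have e: "prod_chart c d \<in> A" by (rule prod_chart_mem[OF c(1) d(1)])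
  have o: "open (snd c ` fst c \<times> snd d ` fst d)"
    using M1.chart_image_open[OF c(1) open_UNIV] M2.chart_image_open[OF d(1) open_UNIV] by (simp add: open_Times)
  have "smooth_on (snd (prod_chart c d) ` fst (prod_chart c d)) (\<lambda>z. snd d (snd (chart_inv (prod_chart c d) z)))"
    unfolding fst_conv prod_chart_image
    by (rule smooth_on_cong[OF o, THEN iffD1, OF _ smooth_on_bounded_linear[OF o bounded_linear_snd]])
       (use prod_chart_inv[OF c(1) d(1)] in auto)
  then show "\<exists>c\<in>A. \<exists>d\<in>A2. \<exists>V. open V \<and> p \<in> V \<and> V \<subseteq> fst c \<and> snd ` V \<subseteq> fst d \<and>
      smooth_on (snd c ` V) (\<lambda>z. snd d (snd (chart_inv c z)))"
    using c d M.chart_open[OF e]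
    by (intro bexI[OF _ e] bexI[OF _ d(1)] exI[of _ "fst (prod_chart c d)"]) (auto simp: mem_Times_iff)
qed (intro continuous_intros)

lemma smooth_map_slice1: "smooth_map A1 A (\<lambda>x. (x, y))"
proof (rule smooth_map_by_charts[OF M1.manifold_axioms M.manifold_axioms])
  fix p
  obtain c where c: "c \<in> A1" "p \<in> fst c" by (rule M1.chart_cover)
  obtain d where d: "d \<in> A2" "y \<in> fst d" by (rule M2.chart_cover)
  have o: "open (snd c ` fst c)" using M1.chart_image_open[OF c(1) open_UNIV] by simp
  have "smooth_on (snd c ` fst c) (\<lambda>z. (z, snd d y))"
    by (intro smooth_on_Pair o smooth_on_const smooth_on_bounded_linear[OF o bounded_linear_ident])
  then have "smooth_on (snd c ` fst c) (\<lambda>z. snd (prod_chart c d) (chart_inv c z, y))"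
    by (rule smooth_on_cong[OF o, THEN iffD1, rotated]) (use M1.chart_inv_chart[OF c(1)] in auto)
  then show "\<exists>c\<in>A1. \<exists>d\<in>A. \<exists>V. open V \<and> p \<in> V \<and> V \<subseteq> fst c \<and> (\<lambda>x. (x, y)) ` V \<subseteq> fst d \<and>
      smooth_on (snd c ` V) (\<lambda>z. snd d (chart_inv c z, y))"
    using c d M1.chart_open[OF c(1)]
    by (intro bexI[OF _ c(1)] bexI[OF _ prod_chart_mem[OF c(1) d(1)]] exI[of _ "fst c"]) auto
qed (intro continuous_intros)

lemma smooth_map_slice2: "smooth_map A2 A (\<lambda>y. (x, y))"
proof (rule smooth_map_by_charts[OF M2.manifold_axioms M.manifold_axioms])
  fix p
  obtain c where c: "c \<in> A1" "x \<in> fst c" by (rule M1.chart_cover)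
  obtain d where d: "d \<in> A2" "p \<in> fst d" by (rule M2.chart_cover)
  have o: "open (snd d ` fst d)" using M2.chart_image_open[OF d(1) open_UNIV] by simp
  have "smooth_on (snd d ` fst d) (\<lambda>z. (snd c x, z))"
    by (intro smooth_on_Pair o smooth_on_const smooth_on_bounded_linear[OF o bounded_linear_ident])
  then have "smooth_on (snd d ` fst d) (\<lambda>z. snd (prod_chart c d) (x, chart_inv d z))"
    by (rule smooth_on_cong[OF o, THEN iffD1, rotated]) (use M2.chart_inv_chart[OF d(1)] in auto)
  then show "\<exists>c\<in>A2. \<exists>d\<in>A. \<exists>V. open V \<and> p \<in> V \<and> V \<subseteq> fst c \<and> (\<lambda>y. (x, y)) ` V \<subseteq> fst d \<and>
      smooth_on (snd c ` V) (\<lambda>z. snd d (x, chart_inv c z))"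
    using c d M2.chart_open[OF d(1)]
    by (intro bexI[OF _ d(1)] bexI[OF _ prod_chart_mem[OF c(1) d(1)]] exI[of _ "fst d"]) auto
qed (intro continuous_intros)

end

text \<open>
  All lifting and restricting between the product and its factors goes through four smooth maps: the two
  projections and, through each point, the two inclusions of slices.
\<close>

sublocale product_manifold \<subseteq> pr1: smooth_map "prod_atlas A1 A2" A1 fst
  by (rule smooth_map_fst)

sublocale product_manifold \<subseteq> pr2: smooth_map "prod_atlas A1 A2" A2 snd
  by (rule smooth_map_snd)

sublocale product_manifold \<subseteq> sl1: smooth_map A1 "prod_atlas A1 A2" "\<lambda>x. (x, y)" for y
  by (rule smooth_map_slice1)

sublocale product_manifold \<subseteq> sl2: smooth_map A2 "prod_atlas A1 A2" "\<lambda>y. (x, y)" for x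
  by (rule smooth_map_slice2)

context product_manifold begin

abbreviation (input) "horiz x y \<equiv> pushforward A (\<lambda>x'. (x', y)) x"
abbreviation (input) "vert x y \<equiv> pushforward A (\<lambda>y'. (x, y')) y"
abbreviation (input) "dfst x y \<equiv> pushforward A1 fst (x, y)"
abbreviation (input) "dsnd x y \<equiv> pushforward A2 snd (x, y)"
abbreviation (input) "res1 x y \<equiv> pullback_covec A1 A (\<lambda>x'. (x', y)) x"
abbreviation (input) "res2 x y \<equiv> pullback_covec A2 A (\<lambda>y'. (x, y')) y"

lemma smooth_at_fst: "smooth_at A1 x u \<Longrightarrow> smooth_at A (x, y) (\<lambda>z. u (fst z))"
  using pr1.smooth_comp[of "(x, y)" u] by simp

lemma smooth_at_snd: "smooth_at A2 y u \<Longrightarrow> smooth_at A (x, y) (\<lambda>z. u (snd z))"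
  using pr2.smooth_comp[of "(x, y)" u] by simp

lemma dfst_mem: "Z \<in> tangent_space A (x, y) \<Longrightarrow> dfst x y Z \<in> tangent_space A1 x"
  using pr1.pushforward_tangent[of Z "(x, y)"] by simp

lemma dsnd_mem: "Z \<in> tangent_space A (x, y) \<Longrightarrow> dsnd x y Z \<in> tangent_space A2 y"
  using pr2.pushforward_tangent[of Z "(x, y)"] by simp

text \<open>
  The projection restricted to a slice is the identity of the factor or constant; the four cases follow
  from the definition of push-forwards as composition. Both sides are 0 on functions that are not
  smooth at the point.
\<close>

lemma dfst_horiz: assumes "X \<in> tangent_space A1 x" shows "dfst x y (horiz x y X) = X"
proof
  fix u show "dfst x y (horiz x y X) u = X u"
    using M1.tangent_not_smooth[OF assms, of u] smooth_at_fst[of x u y] by (simp add: pushforward_def comp_def)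
qed

lemma dsnd_vert: assumes "Y \<in> tangent_space A2 y" shows "dsnd x y (vert x y Y) = Y"
proof
  fix u show "dsnd x y (vert x y Y) u = Y u"
    using M2.tangent_not_smooth[OF assms, of u] smooth_at_snd[of y u x] by (simp add: pushforward_def comp_def)
qed

lemma dsnd_horiz: assumes "X \<in> tangent_space A1 x" shows "dsnd x y (horiz x y X) = (\<lambda>u. 0)"
proof
  fix u show "dsnd x y (horiz x y X) u = 0"
    using M1.tangent_const[OF assms] smooth_at_snd[of y u x] by (simp add: pushforward_def comp_def)
qed

lemma dfst_vert: assumes "Y \<in> tangent_space A2 y" shows "dfst x y (vert x y Y) = (\<lambda>u. 0)"
proof
  fix u show "dfst x y (vert x y Y) u = 0"
    using M2.tangent_const[OF assms] smooth_at_fst[of x u y] by (simp add: pushforward_def comp_def)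
qed

lemma prod_coord_smooth_at:
  assumes "c \<in> A1" "d \<in> A2" "x \<in> fst c" "y \<in> fst d"
  shows "smooth_at A (x, y) (\<lambda>z. snd (prod_chart c d) z \<bullet> b)"
  by (rule M.smooth_at_coord[OF prod_chart_mem[OF assms(1,2)]]) (use assms in simp)

lemma horiz_coord:
  assumes c: "c \<in> A1" "d \<in> A2" "x \<in> fst c" "y \<in> fst d" and X: "X \<in> tangent_space A1 x"
  shows "horiz x y X (\<lambda>z. snd (prod_chart c d) z \<bullet> b) = X (\<lambda>x. snd c x \<bullet> fst b)"
proof -
  have "horiz x y X (\<lambda>z. snd (prod_chart c d) z \<bullet> b) = X (\<lambda>x'. snd c x' \<bullet> fst b + snd d y \<bullet> snd b)"
    using sl1.pushforward_apply[OF prod_coord_smooth_at[OF c], of X b] by (simp add: inner_prod_def)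
  then show ?thesis
    using M1.tangent_add[OF X M1.smooth_at_coord[OF c(1,3)] M1.smooth_at_const] M1.tangent_const[OF X] by simp
qed

lemma vert_coord:
  assumes c: "c \<in> A1" "d \<in> A2" "x \<in> fst c" "y \<in> fst d" and Y: "Y \<in> tangent_space A2 y"
  shows "vert x y Y (\<lambda>z. snd (prod_chart c d) z \<bullet> b) = Y (\<lambda>y. snd d y \<bullet> snd b)"
proof -
  have "vert x y Y (\<lambda>z. snd (prod_chart c d) z \<bullet> b) = Y (\<lambda>y'. snd c x \<bullet> fst b + snd d y' \<bullet> snd b)"
    using sl2.pushforward_apply[OF prod_coord_smooth_at[OF c], of Y b] by (simp add: inner_prod_def)
  then show ?thesis
    using M2.tangent_add[OF Y M2.smooth_at_const M2.smooth_at_coord[OF c(2,4)]] M2.tangent_const[OF Y] by simp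
qed

text \<open>
  Two tangent vectors are equal if they agree on the coordinates of a product chart, each of which is the
  sum of a coordinate of one factor and a coordinate of the other.
\<close>

lemma tangent_decompose:
  assumes Z: "Z \<in> tangent_space A (x, y)"
  shows "Z = (\<lambda>u. horiz x y (dfst x y Z) u + vert x y (dsnd x y Z) u)"
proof -
  obtain c where c: "c \<in> A1" "x \<in> fst c" by (rule M1.chart_cover)
  obtain d where d: "d \<in> A2" "y \<in> fst d" by (rule M2.chart_cover)
  have xy: "(x, y) \<in> fst (prod_chart c d)" using c d by simp
  note X = dfst_mem[OF Z] and Y = dsnd_mem[OF Z]
  have "(\<lambda>u. 1 * horiz x y (dfst x y Z) u + 1 * vert x y (dsnd x y Z) u) \<in> tangent_space A (x, y)"
    by (rule M.tangent_lincomb[OF sl1.pushforward_tangent[OF X] sl2.pushforward_tangent[OF Y]])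
  then have R: "(\<lambda>u. horiz x y (dfst x y Z) u + vert x y (dsnd x y Z) u) \<in> tangent_space A (x, y)" by simp
  show ?thesis
  proof (rule M.tangent_coord_eqI[OF prod_chart_mem[OF c(1) d(1)] xy Z R])
    fix b :: "'e1 \<times> 'e2"
    have s1: "smooth_at A1 x (\<lambda>x. snd c x \<bullet> fst b)" by (rule M1.smooth_at_coord[OF c])
    have s2: "smooth_at A2 y (\<lambda>y. snd d y \<bullet> snd b)" by (rule M2.smooth_at_coord[OF d])
    have "Z (\<lambda>z. snd (prod_chart c d) z \<bullet> b) = Z (\<lambda>z. snd c (fst z) \<bullet> fst b + snd d (snd z) \<bullet> snd b)"
      by (simp add: inner_prod_def)
    also have "\<dots> = Z (\<lambda>z. snd c (fst z) \<bullet> fst b) + Z (\<lambda>z. snd d (snd z) \<bullet> snd b)"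
      by (rule M.tangent_add[OF Z smooth_at_fst[OF s1] smooth_at_snd[OF s2]])
    also have "\<dots> = dfst x y Z (\<lambda>x. snd c x \<bullet> fst b) + dsnd x y Z (\<lambda>y. snd d y \<bullet> snd b)"
      using pr1.pushforward_apply[of "(x, y)" "\<lambda>x. snd c x \<bullet> fst b" Z] pr2.pushforward_apply[of "(x, y)" "\<lambda>y. snd d y \<bullet> snd b" Z] s1 s2
      by simp
    finally show "Z (\<lambda>z. snd (prod_chart c d) z \<bullet> b) =
      horiz x y (dfst x y Z) (\<lambda>z. snd (prod_chart c d) z \<bullet> b) + vert x y (dsnd x y Z) (\<lambda>z. snd (prod_chart c d) z \<bullet> b)"
      unfolding horiz_coord[OF c(1) d(1) c(2) d(2) X] vert_coord[OF c(1) d(1) c(2) d(2) Y] .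
  qed
qed

lemma hlift_apply: "Z \<in> tangent_space A (x, y) \<Longrightarrow> hlift A1 A2 \<omega> (x, y) Z = \<omega> x (dfst x y Z)"
  by (simp add: pullback_form_def pr1.pullback_apply)

lemma vlift_apply: "Z \<in> tangent_space A (x, y) \<Longrightarrow> vlift A1 A2 \<omega> (x, y) Z = \<omega> y (dsnd x y Z)"
  by (simp add: pullback_form_def pr2.pullback_apply)

lemma hlift_mem: "\<omega> x \<in> cotangent_space A1 x \<Longrightarrow> hlift A1 A2 \<omega> (x, y) \<in> cotangent_space A (x, y)"
  using pr1.pullback_mem[of "\<omega> x" "(x, y)"] by (simp add: pullback_form_def)

lemma vlift_mem: "\<omega> y \<in> cotangent_space A2 y \<Longrightarrow> vlift A1 A2 \<omega> (x, y) \<in> cotangent_space A (x, y)"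
  using pr2.pullback_mem[of "\<omega> y" "(x, y)"] by (simp add: pullback_form_def)

lemma res1_hlift: assumes "\<omega> x \<in> cotangent_space A1 x" shows "res1 x y (hlift A1 A2 \<omega> (x, y)) = \<omega> x"
  by (rule M1.cotangent_eqI[OF sl1.pullback_mem[OF hlift_mem[of \<omega>, OF assms]] assms])
     (simp add: sl1.pullback_apply hlift_apply sl1.pushforward_tangent dfst_horiz)

lemma res2_hlift: assumes "\<omega> x \<in> cotangent_space A1 x" shows "res2 x y (hlift A1 A2 \<omega> (x, y)) = (\<lambda>X. 0)"
  by (rule M2.cotangent_eqI[OF sl2.pullback_mem[OF hlift_mem[of \<omega>, OF assms]] M2.cotangent_zero])
     (simp add: sl2.pullback_apply hlift_apply sl2.pushforward_tangent dfst_vert M1.cotangent_zero_vec[OF assms])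

lemma res2_vlift: assumes "\<omega> y \<in> cotangent_space A2 y" shows "res2 x y (vlift A1 A2 \<omega> (x, y)) = \<omega> y"
  by (rule M2.cotangent_eqI[OF sl2.pullback_mem[OF vlift_mem[of \<omega>, OF assms]] assms])
     (simp add: sl2.pullback_apply vlift_apply sl2.pushforward_tangent dsnd_vert)

lemma res1_vlift: assumes "\<omega> y \<in> cotangent_space A2 y" shows "res1 x y (vlift A1 A2 \<omega> (x, y)) = (\<lambda>X. 0)"
  by (rule M1.cotangent_eqI[OF sl1.pullback_mem[OF vlift_mem[of \<omega>, OF assms]] M1.cotangent_zero])
     (simp add: sl1.pullback_apply vlift_apply sl1.pushforward_tangent dsnd_horiz M2.cotangent_zero_vec[OF assms])

lemma coord_vec_horiz:
  assumes c: "c \<in> A1" "d \<in> A2" "x \<in> fst c" "y \<in> fst d"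
  shows "coord_vec A (prod_chart c d) (b, 0) (x, y) = horiz x y (coord_vec A1 c b x)"
proof -
  have xy: "(x, y) \<in> fst (prod_chart c d)" using c by simp
  note m = prod_chart_mem[OF c(1,2)]
  show ?thesis
    by (rule M.tangent_coord_eqI[OF m xy M.coord_vec_tangent[OF m xy] sl1.pushforward_tangent[OF M1.coord_vec_tangent[OF c(1,3)]]])
       (unfold M.coord_vec_coord[OF m xy] horiz_coord[OF c M1.coord_vec_tangent[OF c(1,3)]]
          M1.coord_vec_coord[OF c(1,3)], simp add: inner_prod_def)
qed

lemma coord_vec_vert:
  assumes c: "c \<in> A1" "d \<in> A2" "x \<in> fst c" "y \<in> fst d"
  shows "coord_vec A (prod_chart c d) (0, b) (x, y) = vert x y (coord_vec A2 d b y)"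
proof -
  have xy: "(x, y) \<in> fst (prod_chart c d)" using c by simp
  note m = prod_chart_mem[OF c(1,2)]
  show ?thesis
    by (rule M.tangent_coord_eqI[OF m xy M.coord_vec_tangent[OF m xy] sl2.pushforward_tangent[OF M2.coord_vec_tangent[OF c(2,4)]]])
       (unfold M.coord_vec_coord[OF m xy] vert_coord[OF c M2.coord_vec_tangent[OF c(2,4)]]
          M2.coord_vec_coord[OF c(2,4)], simp add: inner_prod_def)
qed

text \<open>
  Along a horizontal vector the second factor of such a product is constant. All functions that occur
  in the brackets of lifts have this form.
\<close>

lemma horiz_prod:
  assumes X: "X \<in> tangent_space A1 x" and u: "smooth_at A1 x u" and w: "smooth_at A2 y w"
  shows "horiz x y X (\<lambda>z. u (fst z) * w (snd z)) = X u * w y"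
proof -
  have "smooth_at A (x, y) (\<lambda>z. u (fst z) * w (snd z))"
    by (rule M.smooth_at_mult[OF smooth_at_fst[OF u] smooth_at_snd[OF w]])
  then show ?thesis by (simp add: sl1.pushforward_apply M1.tangent_cmult(2)[OF X u])
qed

lemma vert_prod:
  assumes Y: "Y \<in> tangent_space A2 y" and u: "smooth_at A1 x u" and w: "smooth_at A2 y w"
  shows "vert x y Y (\<lambda>z. u (fst z) * w (snd z)) = u x * Y w"
proof -
  have "smooth_at A (x, y) (\<lambda>z. u (fst z) * w (snd z))"
    by (rule M.smooth_at_mult[OF smooth_at_fst[OF u] smooth_at_snd[OF w]])
  then show ?thesis by (simp add: sl2.pushforward_apply M2.tangent_cmult(1)[OF Y w])
qed

lemma horiz_fst: "X \<in> tangent_space A1 x \<Longrightarrow> smooth_at A1 x u \<Longrightarrow> horiz x y X (\<lambda>z. u (fst z)) = X u"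
  by (simp add: sl1.pushforward_apply smooth_at_fst)

lemma vert_fst: "Y \<in> tangent_space A2 y \<Longrightarrow> smooth_at A1 x u \<Longrightarrow> vert x y Y (\<lambda>z. u (fst z)) = 0"
  by (simp add: sl2.pushforward_apply smooth_at_fst M2.tangent_const)

lemma res1_coord_form:
  assumes c: "c \<in> A1" "d \<in> A2" "x \<in> fst c" "y \<in> fst d"
  shows "res1 x y (coord_form A (prod_chart c d) b (x, y)) = coord_form A1 c (fst b) x"
proof (rule M1.cotangent_eqI[OF sl1.pullback_mem[OF M.coord_form_mem] M1.coord_form_mem])
  fix X assume X: "X \<in> tangent_space A1 x"
  show "res1 x y (coord_form A (prod_chart c d) b (x, y)) X = coord_form A1 c (fst b) x X"
    unfolding sl1.pullback_apply[OF X] M.coord_form_apply[OF sl1.pushforward_tangent[OF X]] M1.coord_form_apply[OF X]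
    by (rule horiz_coord[OF c X])
qed

lemma res2_coord_form:
  assumes c: "c \<in> A1" "d \<in> A2" "x \<in> fst c" "y \<in> fst d"
  shows "res2 x y (coord_form A (prod_chart c d) b (x, y)) = coord_form A2 d (snd b) y"
proof (rule M2.cotangent_eqI[OF sl2.pullback_mem[OF M.coord_form_mem] M2.coord_form_mem])
  fix Y assume Y: "Y \<in> tangent_space A2 y"
  show "res2 x y (coord_form A (prod_chart c d) b (x, y)) Y = coord_form A2 d (snd b) y Y"
    unfolding sl2.pullback_apply[OF Y] M.coord_form_apply[OF sl2.pushforward_tangent[OF Y]] M2.coord_form_apply[OF Y]
    by (rule vert_coord[OF c Y])
qed

end

section \<open>Warped products\<close>

text \<open>
  On the second factor, \<open>f\<^sup>2\<close> scales the metric and \<open>\<nu>\<close> the bivector field.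
\<close>

locale warped_product =
  product_manifold A1 A2 + B1: bivector_metric_manifold A1 P1 g1 + B2: bivector_metric_manifold A2 P2 g2
  for A1 :: "('m1::{t2_space,second_countable_topology}, 'e1::euclidean_space) atlas"
    and A2 :: "('m2::{t2_space,second_countable_topology}, 'e2::euclidean_space) atlas"
    and P1 g1 P2 g2 +
  fixes f \<nu> :: "'m1 \<Rightarrow> real"
  assumes f_pos: "f x > 0" and f_smooth: "smooth_fun A1 f" and \<nu>_smooth: "smooth_fun A1 \<nu>"
begin

abbreviation (input) "P \<equiv> warped_bivector A1 A2 P1 P2 \<nu>"
abbreviation (input) "g \<equiv> warped_metric A1 A2 g1 g2 f"

lemma P_eq: "P (x, y) \<xi> \<zeta> = P1 x (res1 x y \<xi>) (res1 x y \<zeta>) + \<nu> x * P2 y (res2 x y \<xi>) (res2 x y \<zeta>)"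
  by (simp add: warped_bivector_def)

lemma g_eq: "g (x, y) X Y = g1 x (dfst x y X) (dfst x y Y) + (f x)\<^sup>2 * g2 y (dsnd x y X) (dsnd x y Y)"
  by (simp add: warped_metric_def pullback_metric_def)

lemma product_bivector_field: "bivector_field A P"
  unfolding bivector_field_def
proof (intro conjI allI ballI)
  fix z :: "'m1 \<times> 'm2" and \<xi> \<zeta> assume m: "\<xi> \<in> cotangent_space A z" "\<zeta> \<in> cotangent_space A z"
  obtain x y where z: "z = (x, y)" by (cases z)
  note m' = m[unfolded z]
  show "P z \<xi> \<zeta> = - P z \<zeta> \<xi>"
    unfolding z P_eq B1.P_skew[OF sl1.pullback_mem[OF m'(1)] sl1.pullback_mem[OF m'(2)]]
      B2.P_skew[OF sl2.pullback_mem[OF m'(1)] sl2.pullback_mem[OF m'(2)]] by simp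
  fix \<theta> a b assume t: "\<theta> \<in> cotangent_space A z"
  show "P z (\<lambda>X. a * \<xi> X + b * \<zeta> X) \<theta> = a * P z \<xi> \<theta> + b * P z \<zeta> \<theta>"
    unfolding z P_eq sl1.pullback_lincomb sl2.pullback_lincomb
      B1.P_lincomb[OF sl1.pullback_mem[OF m'(1)] sl1.pullback_mem[OF m'(2)] sl1.pullback_mem[OF t[unfolded z]]]
      B2.P_lincomb[OF sl2.pullback_mem[OF m'(1)] sl2.pullback_mem[OF m'(2)] sl2.pullback_mem[OF t[unfolded z]]]
    by (simp add: algebra_simps)
next
  fix e and i j :: "'e1 \<times> 'e2" assume "e \<in> A"
  then obtain c d where e: "c \<in> A1" "d \<in> A2" "e = prod_chart c d" by (rule prod_atlasE)
  have o: "open (fst c \<times> fst d)" using M1.chart_open[OF e(1)] M2.chart_open[OF e(2)] by (rule open_Times)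
  have "smooth_fun_on A (fst -` fst c) (\<lambda>z. P1 (fst z) (coord_form A1 c (fst i) (fst z)) (coord_form A1 c (fst j) (fst z)))"
    by (rule pr1.smooth_fun_on_comp[OF M1.chart_open[OF e(1)]])
       (rule B1.P_smooth[OF M1.chart_open[OF e(1)] M1.coord_form_oneform[OF e(1)] M1.coord_form_oneform[OF e(1)]])
  then have s1: "smooth_fun_on A (fst c \<times> fst d) (\<lambda>z. P1 (fst z) (coord_form A1 c (fst i) (fst z)) (coord_form A1 c (fst j) (fst z)))"
    by (rule M.smooth_fun_on_subset) auto
  have "smooth_fun_on A (snd -` fst d) (\<lambda>z. P2 (snd z) (coord_form A2 d (snd i) (snd z)) (coord_form A2 d (snd j) (snd z)))"
    by (rule pr2.smooth_fun_on_comp[OF M2.chart_open[OF e(2)]])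
       (rule B2.P_smooth[OF M2.chart_open[OF e(2)] M2.coord_form_oneform[OF e(2)] M2.coord_form_oneform[OF e(2)]])
  then have s2: "smooth_fun_on A (fst c \<times> fst d) (\<lambda>z. P2 (snd z) (coord_form A2 d (snd i) (snd z)) (coord_form A2 d (snd j) (snd z)))"
    by (rule M.smooth_fun_on_subset) auto
  have "smooth_fun_on A (fst -` UNIV) (\<lambda>z. \<nu> (fst z))"
    by (rule pr1.smooth_fun_on_comp[OF open_UNIV M1.smooth_funD[OF \<nu>_smooth]])
  then have s3: "smooth_fun_on A (fst c \<times> fst d) (\<lambda>z. \<nu> (fst z))"
    by (rule M.smooth_fun_on_subset) auto
  show "smooth_fun_on A (fst e) (\<lambda>p. P p (coord_form A e i p) (coord_form A e j p))"
    unfolding e(3) fst_conv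
  proof (rule M.smooth_fun_on_cong[OF o, THEN iffD1, rotated])
    show "smooth_fun_on A (fst c \<times> fst d) (\<lambda>z. P1 (fst z) (coord_form A1 c (fst i) (fst z)) (coord_form A1 c (fst j) (fst z))
      + \<nu> (fst z) * P2 (snd z) (coord_form A2 d (snd i) (snd z)) (coord_form A2 d (snd j) (snd z)))"
      by (rule M.smooth_fun_on_add[OF o s1 M.smooth_fun_on_mult[OF o s3 s2]])
    fix z assume z: "z \<in> fst c \<times> fst d"
    obtain x y where xy: "z = (x, y)" by (cases z)
    show "P1 (fst z) (coord_form A1 c (fst i) (fst z)) (coord_form A1 c (fst j) (fst z))
      + \<nu> (fst z) * P2 (snd z) (coord_form A2 d (snd i) (snd z)) (coord_form A2 d (snd j) (snd z)) =
      P z (coord_form A (prod_chart c d) i z) (coord_form A (prod_chart c d) j z)"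
      using z unfolding xy P_eq by (simp add: res1_coord_form[OF e(1,2)] res2_coord_form[OF e(1,2)])
  qed
qed

lemma g1_zero: "X \<in> tangent_space A1 x \<Longrightarrow> g1 x (\<lambda>u. 0) X = 0"
  using B1.g_lincomb[OF M1.tangent_zero M1.tangent_zero, of X x 0 0] by simp

lemma g2_zero: "Y \<in> tangent_space A2 y \<Longrightarrow> g2 y (\<lambda>u. 0) Y = 0"
  using B2.g_lincomb[OF M2.tangent_zero M2.tangent_zero, of Y y 0 0] by simp

lemma g_horiz:
  assumes "Z \<in> tangent_space A (x, y)" "X \<in> tangent_space A1 x"
  shows "g (x, y) (horiz x y X) Z = g1 x X (dfst x y Z)"
  unfolding g_eq dfst_horiz[OF assms(2)] dsnd_horiz[OF assms(2)] g2_zero[OF dsnd_mem[OF assms(1)]] by simp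

lemma g_vert:
  assumes "Z \<in> tangent_space A (x, y)" "Y \<in> tangent_space A2 y"
  shows "g (x, y) (vert x y Y) Z = (f x)\<^sup>2 * g2 y Y (dsnd x y Z)"
  unfolding g_eq dfst_vert[OF assms(2)] dsnd_vert[OF assms(2)] g1_zero[OF dfst_mem[OF assms(1)]] by simp

text \<open>
  Nondegeneracy: testing \<open>X\<close> against horizontal vectors gives \<open>g1 (X\<^sub>1, _) = 0\<close>, testing it against vertical
  vectors gives \<open>f\<^sup>2 g2 (X\<^sub>2, _) = 0\<close>.
\<close>

lemma product_metric: "metric_manifold A g"
proof unfold_locales
  fix p :: "'m1 \<times> 'm2" and X Y
  obtain x y where p: "p = (x, y)" by (cases p)
  assume X: "X \<in> tangent_space A p"
  note X' = X[unfolded p]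
  show sym: "g p X Y = g p Y X" if "Y \<in> tangent_space A p" for Y
    using that B1.g_sym[OF dfst_mem[OF X'] dfst_mem[of Y]] B2.g_sym[OF dsnd_mem[OF X'] dsnd_mem[of Y]]
    unfolding p g_eq by simp
  {
    fix Z a b assume Y: "Y \<in> tangent_space A p" and Z: "Z \<in> tangent_space A p"
    note Y' = Y[unfolded p] and Z' = Z[unfolded p]
    show "g p (\<lambda>u. a * X u + b * Y u) Z = a * g p X Z + b * g p Y Z"
      unfolding p g_eq pr1.pushforward_lincomb pr2.pushforward_lincomb
        B1.g_lincomb[OF dfst_mem[OF X'] dfst_mem[OF Y'] dfst_mem[OF Z']]
        B2.g_lincomb[OF dsnd_mem[OF X'] dsnd_mem[OF Y'] dsnd_mem[OF Z']]
      by (simp add: algebra_simps)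
  }
  assume 0: "\<And>Y. Y \<in> tangent_space A p \<Longrightarrow> g p X Y = 0"
  have 1: "dfst x y X = (\<lambda>u. 0)"
  proof (rule B1.g_nondegenerate[OF dfst_mem[OF X']])
    fix V assume V: "V \<in> tangent_space A1 x"
    have h: "horiz x y V \<in> tangent_space A p" unfolding p by (rule sl1.pushforward_tangent[OF V])
    have "g1 x V (dfst x y X) = g p (horiz x y V) X" unfolding p by (rule g_horiz[OF X' V, symmetric])
    also have "\<dots> = 0" using sym[OF h] 0[OF h] by simp
    finally show "g1 x (dfst x y X) V = 0" using B1.g_sym[OF dfst_mem[OF X'] V] by simp
  qed
  have 2: "dsnd x y X = (\<lambda>u. 0)"
  proof (rule B2.g_nondegenerate[OF dsnd_mem[OF X']])
    fix V assume V: "V \<in> tangent_space A2 y"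
    have h: "vert x y V \<in> tangent_space A p" unfolding p by (rule sl2.pushforward_tangent[OF V])
    have "(f x)\<^sup>2 * g2 y V (dsnd x y X) = g p (vert x y V) X" unfolding p by (rule g_vert[OF X' V, symmetric])
    also have "\<dots> = 0" using sym[OF h] 0[OF h] by simp
    finally show "g2 y (dsnd x y X) V = 0" using B2.g_sym[OF dsnd_mem[OF X'] V] f_pos[of x] by simp
  qed
  show "X = (\<lambda>u. 0)"
    using tangent_decompose[OF X'] unfolding 1 2 sl1.pushforward_zero sl2.pushforward_zero by simp
qed

end

sublocale warped_product \<subseteq> W: bivector_metric_manifold "prod_atlas A1 A2" "warped_bivector A1 A2 P1 P2 \<nu>" "warped_metric A1 A2 g1 g2 f"
proof -
  interpret metric_manifold "prod_atlas A1 A2" "warped_metric A1 A2 g1 g2 f" by (rule product_metric)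
  show "bivector_metric_manifold (prod_atlas A1 A2) (warped_bivector A1 A2 P1 P2 \<nu>) (warped_metric A1 A2 g1 g2 f)"
    by unfold_locales (rule product_bivector_field)
qed

context warped_product begin

lemma sharp_hlift:
  assumes \<omega>: "\<omega> x \<in> cotangent_space A1 x"
  shows "sharp A P (hlift A1 A2 \<omega>) (x, y) = horiz x y (sharp A1 P1 \<omega> x)"
proof (rule M.tangent_eqI)
  note h = hlift_mem[of \<omega>, OF \<omega>] and S = B1.sharp_mem[of \<omega>, OF \<omega>]
  show "sharp A P (hlift A1 A2 \<omega>) (x, y) \<in> tangent_space A (x, y)" by (rule W.sharp_mem[of "hlift A1 A2 \<omega>", OF h])
  show "horiz x y (sharp A1 P1 \<omega> x) \<in> tangent_space A (x, y)" by (rule sl1.pushforward_tangent[OF S])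
  fix \<xi> assume \<xi>: "\<xi> \<in> cotangent_space A (x, y)"
  have "\<xi> (sharp A P (hlift A1 A2 \<omega>) (x, y)) = P1 x (\<omega> x) (res1 x y \<xi>)"
    unfolding W.sharp_apply[of "hlift A1 A2 \<omega>", OF h \<xi>] P_eq res1_hlift[of \<omega>, OF \<omega>] res2_hlift[of \<omega>, OF \<omega>]
      B2.P_zero[OF sl2.pullback_mem[OF \<xi>]] by simp
  also have "\<dots> = \<xi> (horiz x y (sharp A1 P1 \<omega> x))"
    unfolding B1.sharp_apply[of \<omega>, OF \<omega> sl1.pullback_mem[OF \<xi>], symmetric] sl1.pullback_apply[OF S] ..
  finally show "\<xi> (sharp A P (hlift A1 A2 \<omega>) (x, y)) = \<xi> (horiz x y (sharp A1 P1 \<omega> x))" .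
qed

lemma metric_sharp_hlift:
  assumes \<omega>: "\<omega> x \<in> cotangent_space A1 x"
  shows "metric_sharp A g (x, y) (hlift A1 A2 \<omega> (x, y)) = horiz x y (metric_sharp A1 g1 x (\<omega> x))"
proof (rule W.metric_sharp_unique)
  note S = B1.metric_sharp_mem[OF \<omega>]
  show "horiz x y (metric_sharp A1 g1 x (\<omega> x)) \<in> tangent_space A (x, y)" by (rule sl1.pushforward_tangent[OF S])
  fix Z assume Z: "Z \<in> tangent_space A (x, y)"
  show "g (x, y) (horiz x y (metric_sharp A1 g1 x (\<omega> x))) Z = hlift A1 A2 \<omega> (x, y) Z"
    unfolding g_horiz[OF Z S] hlift_apply[OF Z] by (rule B1.g_metric_sharp[OF \<omega> dfst_mem[OF Z]])
qed

text \<open>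
  The lift that preserves inner products (\<open>cometric_wlift\<close>): the cometric of the second factor is
  divided by \<open>f\<^sup>2\<close>.
\<close>

definition wlift :: "'m2 form \<Rightarrow> ('m1 \<times> 'm2) form" where
  "wlift \<omega> = form_scale (f \<circ> fst) (vlift A1 A2 \<omega>)"

lemma wlift_eq: "wlift \<omega> (x, y) = (\<lambda>X. f x * vlift A1 A2 \<omega> (x, y) X)"
  by (simp add: wlift_def form_scale_def)

lemma wlift_mem: "\<omega> y \<in> cotangent_space A2 y \<Longrightarrow> wlift \<omega> (x, y) \<in> cotangent_space A (x, y)"
  unfolding wlift_eq by (rule M.cotangent_scale[OF vlift_mem])

lemma wlift_apply: "Z \<in> tangent_space A (x, y) \<Longrightarrow> wlift \<omega> (x, y) Z = f x * \<omega> y (dsnd x y Z)"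
  by (simp add: wlift_eq vlift_apply)

lemma sharp_wlift:
  assumes \<omega>: "\<omega> y \<in> cotangent_space A2 y"
  shows "sharp A P (wlift \<omega>) (x, y) = (\<lambda>u. (f x * \<nu> x) * vert x y (sharp A2 P2 \<omega> y) u)"
proof (rule M.tangent_eqI)
  note h = wlift_mem[of \<omega>, OF \<omega>] and S = B2.sharp_mem[of \<omega>, OF \<omega>]
  note V = sl2.pushforward_tangent[OF S]
  show "sharp A P (wlift \<omega>) (x, y) \<in> tangent_space A (x, y)" by (rule W.sharp_mem[of "wlift \<omega>", OF h])
  show "(\<lambda>u. (f x * \<nu> x) * vert x y (sharp A2 P2 \<omega> y) u) \<in> tangent_space A (x, y)" by (rule M.tangent_scale[OF V])
  fix \<xi> assume \<xi>: "\<xi> \<in> cotangent_space A (x, y)"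
  have r1: "res1 x y (wlift \<omega> (x, y)) = (\<lambda>X. 0)"
    unfolding wlift_eq sl1.pullback_scale res1_vlift[of \<omega>, OF \<omega>] by simp
  have r2: "res2 x y (wlift \<omega> (x, y)) = (\<lambda>X. f x * \<omega> y X)"
    unfolding wlift_eq sl2.pullback_scale res2_vlift[of \<omega>, OF \<omega>] ..
  have "\<xi> (sharp A P (wlift \<omega>) (x, y)) = (f x * \<nu> x) * P2 y (\<omega> y) (res2 x y \<xi>)"
    unfolding W.sharp_apply[of "wlift \<omega>", OF h \<xi>] P_eq r1 r2
      B1.P_zero[OF sl1.pullback_mem[OF \<xi>]] B2.P_scale[OF \<omega> sl2.pullback_mem[OF \<xi>]] by simp
  also have "\<dots> = \<xi> (\<lambda>u. (f x * \<nu> x) * vert x y (sharp A2 P2 \<omega> y) u)"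
    unfolding B2.sharp_apply[of \<omega>, OF \<omega> sl2.pullback_mem[OF \<xi>], symmetric] sl2.pullback_apply[OF S]
      M.cotangent_scale_vec[OF \<xi> V] ..
  finally show "\<xi> (sharp A P (wlift \<omega>) (x, y)) = \<xi> (\<lambda>u. (f x * \<nu> x) * vert x y (sharp A2 P2 \<omega> y) u)" .
qed

text \<open>
  The factor is \<open>f\<close> from the lift times \<open>1 / f\<^sup>2\<close> from the inverse of the metric.
\<close>

lemma metric_sharp_wlift:
  assumes \<omega>: "\<omega> y \<in> cotangent_space A2 y"
  shows "metric_sharp A g (x, y) (wlift \<omega> (x, y)) = (\<lambda>u. (1 / f x) * vert x y (metric_sharp A2 g2 y (\<omega> y)) u)"
proof (rule W.metric_sharp_unique)
  note S = B2.metric_sharp_mem[OF \<omega>]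
  note V = sl2.pushforward_tangent[OF S, of x]
  show "(\<lambda>u. (1 / f x) * vert x y (metric_sharp A2 g2 y (\<omega> y)) u) \<in> tangent_space A (x, y)" by (rule M.tangent_scale[OF V])
  fix Z assume Z: "Z \<in> tangent_space A (x, y)"
  have "g (x, y) (\<lambda>u. (1 / f x) * vert x y (metric_sharp A2 g2 y (\<omega> y)) u) Z
      = (1 / f x) * g (x, y) (vert x y (metric_sharp A2 g2 y (\<omega> y))) Z"
    using W.g_lincomb[OF V V Z, of "1 / f x" 0] by simp
  also have "\<dots> = (1 / f x) * ((f x)\<^sup>2 * \<omega> y (dsnd x y Z))"
    unfolding g_vert[OF Z S] B2.g_metric_sharp[OF \<omega> dsnd_mem[OF Z]] ..
  also have "\<dots> = wlift \<omega> (x, y) Z" unfolding wlift_apply[OF Z] using f_pos[of x] by (simp add: power2_eq_square)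
  finally show "g (x, y) (\<lambda>u. (1 / f x) * vert x y (metric_sharp A2 g2 y (\<omega> y)) u) Z = wlift \<omega> (x, y) Z" .
qed

lemma cometric_hlift:
  assumes \<omega>: "\<omega> x \<in> cotangent_space A1 x" and \<eta>: "\<eta> x \<in> cotangent_space A1 x"
  shows "cometric A g (x, y) (hlift A1 A2 \<omega> (x, y)) (hlift A1 A2 \<eta> (x, y)) = cometric A1 g1 x (\<omega> x) (\<eta> x)"
  unfolding W.cometric_right[OF hlift_mem[of \<omega>, OF \<omega>] hlift_mem[of \<eta>, OF \<eta>]] metric_sharp_hlift[of \<omega>, OF \<omega>]
    hlift_apply[OF sl1.pushforward_tangent[OF B1.metric_sharp_mem[OF \<omega>]]] dfst_horiz[OF B1.metric_sharp_mem[OF \<omega>]]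
    B1.cometric_right[OF \<omega> \<eta>] ..

lemma cometric_hlift_wlift:
  assumes \<omega>: "\<omega> x \<in> cotangent_space A1 x" and \<eta>: "\<eta> y \<in> cotangent_space A2 y"
  shows "cometric A g (x, y) (hlift A1 A2 \<omega> (x, y)) (wlift \<eta> (x, y)) = 0"
  unfolding W.cometric_right[OF hlift_mem[of \<omega>, OF \<omega>] wlift_mem[of \<eta>, OF \<eta>]] metric_sharp_hlift[of \<omega>, OF \<omega>]
    wlift_apply[OF sl1.pushforward_tangent[OF B1.metric_sharp_mem[OF \<omega>]]] dsnd_horiz[OF B1.metric_sharp_mem[OF \<omega>]]
    M2.cotangent_zero_vec[OF \<eta>] by simp

lemma cometric_wlift:
  assumes \<omega>: "\<omega> y \<in> cotangent_space A2 y" and \<eta>: "\<eta> y \<in> cotangent_space A2 y"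
  shows "cometric A g (x, y) (wlift \<omega> (x, y)) (wlift \<eta> (x, y)) = cometric A2 g2 y (\<omega> y) (\<eta> y)"
proof -
  note S = B2.metric_sharp_mem[OF \<omega>]
  show ?thesis
    unfolding W.cometric_right[OF wlift_mem[of \<omega>, OF \<omega>] wlift_mem[of \<eta>, OF \<eta>]] metric_sharp_wlift[of \<omega>, OF \<omega>]
      M.cotangent_scale_vec[OF wlift_mem[of \<eta>, OF \<eta>] sl2.pushforward_tangent[OF S]]
      wlift_apply[OF sl2.pushforward_tangent[OF S]] dsnd_vert[OF S] B2.cometric_right[OF \<omega> \<eta>]
    using f_pos[of x] by simp
qed

lemma hlift_oneform: "open U \<Longrightarrow> oneform_on A1 U \<omega> \<Longrightarrow> oneform_on A (U \<times> V) (hlift A1 A2 \<omega>)"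
  by (rule M.oneform_on_subset[OF pr1.pullback_oneform]) auto

lemma wlift_oneform:
  assumes "open U" "open V" "oneform_on A2 V \<omega>"
  shows "oneform_on A (U \<times> V) (wlift \<omega>)"
  unfolding wlift_def
proof (rule M.form_scale_oneform)
  show "open (U \<times> V)" using assms(1,2) by (rule open_Times)
  have "smooth_fun_on A (fst -` UNIV) (\<lambda>z. f (fst z))"
    by (rule pr1.smooth_fun_on_comp[OF open_UNIV M1.smooth_funD[OF f_smooth]])
  then show "smooth_fun_on A (U \<times> V) (f \<circ> fst)" unfolding comp_def by (rule M.smooth_fun_on_subset) auto
  show "oneform_on A (U \<times> V) (vlift A1 A2 \<omega>)"
    by (rule M.oneform_on_subset[OF pr2.pullback_oneform[OF assms(2,3)]]) auto
qed

lemma P_hlift: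
  assumes "\<omega> x \<in> cotangent_space A1 x" "\<eta> x \<in> cotangent_space A1 x"
  shows "P (x, y) (hlift A1 A2 \<omega> (x, y)) (hlift A1 A2 \<eta> (x, y)) = P1 x (\<omega> x) (\<eta> x)"
  unfolding P_eq res1_hlift[of \<omega>, OF assms(1)] res1_hlift[of \<eta>, OF assms(2)]
    res2_hlift[of \<omega>, OF assms(1)] res2_hlift[of \<eta>, OF assms(2)] B2.P_zero[OF M2.cotangent_zero] by simp

lemma res1_wlift: "\<omega> y \<in> cotangent_space A2 y \<Longrightarrow> res1 x y (wlift \<omega> (x, y)) = (\<lambda>X. 0)"
  unfolding wlift_eq sl1.pullback_scale by (simp add: res1_vlift)

lemma res2_wlift: "\<omega> y \<in> cotangent_space A2 y \<Longrightarrow> res2 x y (wlift \<omega> (x, y)) = (\<lambda>X. f x * \<omega> y X)"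
  unfolding wlift_eq sl2.pullback_scale by (simp add: res2_vlift)

lemma P_hlift_wlift:
  assumes "\<omega> x \<in> cotangent_space A1 x" "\<eta> y \<in> cotangent_space A2 y"
  shows "P (x, y) (hlift A1 A2 \<omega> (x, y)) (wlift \<eta> (x, y)) = 0"
  unfolding P_eq res1_hlift[of \<omega>, OF assms(1)] res2_hlift[of \<omega>, OF assms(1)]
    res1_wlift[of \<eta>, OF assms(2)] res2_wlift[of \<eta>, OF assms(2)]
    B2.P_zero[OF M2.cotangent_scale[OF assms(2)]]
    B1.P_skew[OF assms(1) M1.cotangent_zero] B1.P_zero[OF assms(1)] by simp

lemma P_wlift:
  assumes "\<omega> y \<in> cotangent_space A2 y" "\<eta> y \<in> cotangent_space A2 y"
  shows "P (x, y) (wlift \<omega> (x, y)) (wlift \<eta> (x, y)) = (f x * f x * \<nu> x) * P2 y (\<omega> y) (\<eta> y)"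
proof -
  have "P2 y (\<lambda>X. f x * \<omega> y X) (\<lambda>X. f x * \<eta> y X) = f x * (f x * P2 y (\<omega> y) (\<eta> y))"
    using B2.P_scale[OF assms(1) M2.cotangent_scale[OF assms(2)], of "f x" "f x"]
      B2.P_lincomb_right[OF assms(2) assms(2) assms(1), of "f x" 0] by simp
  then show ?thesis
    unfolding P_eq res1_wlift[of \<omega>, OF assms(1)] res1_wlift[of \<eta>, OF assms(2)]
      res2_wlift[of \<omega>, OF assms(1)] res2_wlift[of \<eta>, OF assms(2)] B1.P_zero[OF M1.cotangent_zero] by simp
qed

section \<open>Brackets of lifted one-forms\<close>

context
  fixes U1 :: "'m1 set" and U2 :: "'m2 set" and x :: 'm1 and y :: 'm2
  assumes U: "open U1" "x \<in> U1" "open U2" "y \<in> U2"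
begin

lemma f_at: "smooth_at A1 x f" by (rule M1.smooth_fun_smooth_at[OF f_smooth])

lemma f\<nu>_at: "smooth_at A1 x (\<lambda>x. f x * \<nu> x)"
  by (rule M1.smooth_at_mult[OF f_at M1.smooth_fun_smooth_at[OF \<nu>_smooth]])

lemma sharp_factor1:
  assumes \<omega>: "oneform_on A1 U1 \<omega>" and u1: "smooth_at A1 x u1"
  shows "\<omega> x \<in> cotangent_space A1 x" "sharp A1 P1 \<omega> x \<in> tangent_space A1 x"
    "smooth_at A1 x (\<lambda>x. sharp A1 P1 \<omega> x u1)"
proof -
  show "\<omega> x \<in> cotangent_space A1 x" by (rule M1.oneform_onD[OF \<omega> U(2)])
  then show "sharp A1 P1 \<omega> x \<in> tangent_space A1 x" by (rule B1.sharp_mem)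
  show "smooth_at A1 x (\<lambda>x. sharp A1 P1 \<omega> x u1)"
    by (rule M1.vfield_apply_smooth_at[OF U(1,2) B1.sharp_vfield[OF U(1) \<omega>] u1])
qed

lemma sharp_factor2:
  assumes \<omega>: "oneform_on A2 U2 \<omega>" and u2: "smooth_at A2 y u2"
  shows "\<omega> y \<in> cotangent_space A2 y" "sharp A2 P2 \<omega> y \<in> tangent_space A2 y"
    "smooth_at A2 y (\<lambda>y. sharp A2 P2 \<omega> y u2)"
proof -
  show "\<omega> y \<in> cotangent_space A2 y" by (rule M2.oneform_onD[OF \<omega> U(4)])
  then show "sharp A2 P2 \<omega> y \<in> tangent_space A2 y" by (rule B2.sharp_mem)
  show "smooth_at A2 y (\<lambda>y. sharp A2 P2 \<omega> y u2)"
    by (rule M2.vfield_apply_smooth_at[OF U(3,4) B2.sharp_vfield[OF U(3) \<omega>] u2])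
qed

context
  fixes c d
  assumes cd: "c \<in> A1" "d \<in> A2" "x \<in> fst c" "y \<in> fst d"
begin

abbreviation (input) "e \<equiv> prod_chart c d"

lemma eventually_in_charts: "\<forall>\<^sub>F z in nhds (x, y). fst z \<in> fst c \<and> snd z \<in> fst d \<and> fst z \<in> U1 \<and> snd z \<in> U2"
proof -
  have "open ((fst c \<inter> U1) \<times> (fst d \<inter> U2))"
    by (intro open_Times open_Int U M1.chart_open M2.chart_open cd)
  from eventually_nhds_in_open[OF this, of "(x, y)"] U cd show ?thesis
    by (auto elim!: eventually_mono)
qed

lemma tangent_cong_charts:
  assumes "V \<in> tangent_space A (x, y)"
    and "\<And>x' y'. x' \<in> fst c \<Longrightarrow> y' \<in> fst d \<Longrightarrow> x' \<in> U1 \<Longrightarrow> y' \<in> U2 \<Longrightarrow> F (x', y') = G (x', y')"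
  shows "V F = V G"
  by (rule M.tangent_cong[OF assms(1) eventually_mono[OF eventually_in_charts]]) (use assms(2) in \<open>auto simp: split_paired_all\<close>)

lemma hlift_coord_vec:
  assumes \<omega>: "oneform_on A1 U1 \<omega>" and z: "x' \<in> fst c" "y' \<in> fst d" "x' \<in> U1"
  shows "hlift A1 A2 \<omega> (x', y') (coord_vec A e (b, 0) (x', y')) = \<omega> x' (coord_vec A1 c b x')"
    and "hlift A1 A2 \<omega> (x', y') (coord_vec A e (0, b') (x', y')) = 0"
  unfolding coord_vec_horiz[OF cd(1,2) z(1,2)] coord_vec_vert[OF cd(1,2) z(1,2)]
  using M1.coord_vec_tangent[OF cd(1) z(1)] M2.coord_vec_tangent[OF cd(2) z(2)]
    M1.cotangent_zero_vec[OF M1.oneform_onD[OF \<omega> z(3)]]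
  by (simp_all add: hlift_apply sl1.pushforward_tangent sl2.pushforward_tangent dfst_horiz dfst_vert)

lemma wlift_coord_vec:
  assumes \<omega>: "oneform_on A2 U2 \<omega>" and z: "x' \<in> fst c" "y' \<in> fst d" "y' \<in> U2"
  shows "wlift \<omega> (x', y') (coord_vec A e (0, b') (x', y')) = f x' * \<omega> y' (coord_vec A2 d b' y')"
    and "wlift \<omega> (x', y') (coord_vec A e (b, 0) (x', y')) = 0"
  unfolding coord_vec_horiz[OF cd(1,2) z(1,2)] coord_vec_vert[OF cd(1,2) z(1,2)]
  using M1.coord_vec_tangent[OF cd(1) z(1)] M2.coord_vec_tangent[OF cd(2) z(2)]
    M2.cotangent_zero_vec[OF M2.oneform_onD[OF \<omega> z(3)]]
  by (simp_all add: wlift_apply sl1.pushforward_tangent sl2.pushforward_tangent dsnd_horiz dsnd_vert)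

lemma sharp_hlift_coord:
  assumes \<omega>: "oneform_on A1 U1 \<omega>" and z: "x' \<in> fst c" "y' \<in> fst d" "x' \<in> U1"
  shows "sharp A P (hlift A1 A2 \<omega>) (x', y') (\<lambda>z. snd e z \<bullet> b) = sharp A1 P1 \<omega> x' (\<lambda>x. snd c x \<bullet> fst b)"
  unfolding sharp_hlift[of \<omega>, OF M1.oneform_onD[OF \<omega> z(3)]]
  by (rule horiz_coord[OF cd(1,2) z(1,2) B1.sharp_mem[of \<omega>, OF M1.oneform_onD[OF \<omega> z(3)]]])

lemma sharp_wlift_coord:
  assumes \<omega>: "oneform_on A2 U2 \<omega>" and z: "x' \<in> fst c" "y' \<in> fst d" "y' \<in> U2"
  shows "sharp A P (wlift \<omega>) (x', y') (\<lambda>z. snd e z \<bullet> b)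
     = (f x' * \<nu> x') * sharp A2 P2 \<omega> y' (\<lambda>y. snd d y \<bullet> snd b)"
  unfolding sharp_wlift[of \<omega>, OF M2.oneform_onD[OF \<omega> z(3)]]
    vert_coord[OF cd(1,2) z(1,2) B2.sharp_mem[of \<omega>, OF M2.oneform_onD[OF \<omega> z(3)]]] ..

lemma comp_smooth1: "oneform_on A1 U1 \<omega> \<Longrightarrow> smooth_at A1 x (\<lambda>x. \<omega> x (coord_vec A1 c b x))"
  using M1.pairing_smooth[of "fst c \<inter> U1" \<omega> "coord_vec A1 c b"] U cd M1.chart_open[OF cd(1)] M1.coord_vec_vfield[OF cd(1), of b]
  by (intro M1.smooth_atI[of "fst c \<inter> U1"]) (auto intro: M1.oneform_on_subset M1.vfield_on_subset)

lemma comp_smooth2: "oneform_on A2 U2 \<omega> \<Longrightarrow> smooth_at A2 y (\<lambda>y. \<omega> y (coord_vec A2 d b y))"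
  using M2.pairing_smooth[of "fst d \<inter> U2" \<omega> "coord_vec A2 d b"] U cd M2.chart_open[OF cd(2)] M2.coord_vec_vfield[OF cd(2), of b]
  by (intro M2.smooth_atI[of "fst d \<inter> U2"]) (auto intro: M2.oneform_on_subset M2.vfield_on_subset)

text \<open>
  By locality, since near the point the components of a horizontal lift and of its sharp are lifted
  from the first factor or vanish.
\<close>

lemma tangent_hlift_comp:
  assumes V: "V \<in> tangent_space A (x, y)" and \<omega>: "oneform_on A1 U1 \<omega>"
  shows "V (\<lambda>z. hlift A1 A2 \<omega> z (coord_vec A e (b, 0) z)) = V (\<lambda>z. \<omega> (fst z) (coord_vec A1 c b (fst z)))"
    and "V (\<lambda>z. hlift A1 A2 \<omega> z (coord_vec A e (0, b') z)) = 0"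
    and "V (\<lambda>z. sharp A P (hlift A1 A2 \<omega>) z (\<lambda>z. snd e z \<bullet> b'')) = V (\<lambda>z. sharp A1 P1 \<omega> (fst z) (\<lambda>x. snd c x \<bullet> fst b''))"
proof -
  show "V (\<lambda>z. hlift A1 A2 \<omega> z (coord_vec A e (b, 0) z)) = V (\<lambda>z. \<omega> (fst z) (coord_vec A1 c b (fst z)))"
    by (rule tangent_cong_charts[OF V]) (simp add: hlift_coord_vec[OF \<omega>])
  have "V (\<lambda>z. hlift A1 A2 \<omega> z (coord_vec A e (0, b') z)) = V (\<lambda>z. 0)"
    by (rule tangent_cong_charts[OF V]) (simp add: hlift_coord_vec[OF \<omega>])
  then show "V (\<lambda>z. hlift A1 A2 \<omega> z (coord_vec A e (0, b') z)) = 0" using M.tangent_const[OF V] by simp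
  show "V (\<lambda>z. sharp A P (hlift A1 A2 \<omega>) z (\<lambda>z. snd e z \<bullet> b'')) = V (\<lambda>z. sharp A1 P1 \<omega> (fst z) (\<lambda>x. snd c x \<bullet> fst b''))"
  proof (rule tangent_cong_charts[OF V])
    fix x' y' assume z: "x' \<in> fst c" "y' \<in> fst d" "x' \<in> U1"
    from sharp_hlift_coord[OF \<omega> z, of b'']
    show "sharp A P (hlift A1 A2 \<omega>) (x', y') (\<lambda>z. snd e z \<bullet> b'') = sharp A1 P1 \<omega> (fst (x', y')) (\<lambda>x. snd c x \<bullet> fst b'')"
      by simp
  qed
qed

lemma tangent_wlift_comp:
  assumes V: "V \<in> tangent_space A (x, y)" and \<omega>: "oneform_on A2 U2 \<omega>"
  shows "V (\<lambda>z. wlift \<omega> z (coord_vec A e (0, b') z)) = V (\<lambda>z. f (fst z) * \<omega> (snd z) (coord_vec A2 d b' (snd z)))"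
    and "V (\<lambda>z. wlift \<omega> z (coord_vec A e (b, 0) z)) = 0"
    and "V (\<lambda>z. sharp A P (wlift \<omega>) z (\<lambda>z. snd e z \<bullet> b''))
      = V (\<lambda>z. (f (fst z) * \<nu> (fst z)) * sharp A2 P2 \<omega> (snd z) (\<lambda>y. snd d y \<bullet> snd b''))"
proof -
  show "V (\<lambda>z. wlift \<omega> z (coord_vec A e (0, b') z)) = V (\<lambda>z. f (fst z) * \<omega> (snd z) (coord_vec A2 d b' (snd z)))"
    by (rule tangent_cong_charts[OF V]) (simp add: wlift_coord_vec[OF \<omega>])
  have "V (\<lambda>z. wlift \<omega> z (coord_vec A e (b, 0) z)) = V (\<lambda>z. 0)"
    by (rule tangent_cong_charts[OF V]) (simp add: wlift_coord_vec[OF \<omega>])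
  then show "V (\<lambda>z. wlift \<omega> z (coord_vec A e (b, 0) z)) = 0" using M.tangent_const[OF V] by simp
  show "V (\<lambda>z. sharp A P (wlift \<omega>) z (\<lambda>z. snd e z \<bullet> b''))
      = V (\<lambda>z. (f (fst z) * \<nu> (fst z)) * sharp A2 P2 \<omega> (snd z) (\<lambda>y. snd d y \<bullet> snd b''))"
  proof (rule tangent_cong_charts[OF V])
    fix x' y' assume z: "x' \<in> fst c" "y' \<in> fst d" "y' \<in> U2"
    from sharp_wlift_coord[OF \<omega> z, of b'']
    show "sharp A P (wlift \<omega>) (x', y') (\<lambda>z. snd e z \<bullet> b'') = (f (fst (x', y')) * \<nu> (fst (x', y'))) *
        sharp A2 P2 \<omega> (snd (x', y')) (\<lambda>y. snd d y \<bullet> snd b'')"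
      by simp
  qed
qed

lemma bracket_coord:
  assumes "oneform_on A (U1 \<times> U2) \<omega>" "oneform_on A (U1 \<times> U2) \<eta>" "v \<in> tangent_space A (x, y)"
  shows "form_bracket A P \<omega> \<eta> (x, y) v =
    lie_coord A e (sharp A P \<omega>) \<eta> (x, y) v - lie_coord A e (sharp A P \<eta>) \<omega> (x, y) v - v (\<lambda>z. P z (\<omega> z) (\<eta> z))"
  by (rule W.form_bracket_coord[OF prod_chart_mem[OF cd(1,2)] _ open_Times[OF U(1,3)] _ assms]) (use U cd in auto)

end

text \<open>
  In a product chart all terms with vertical indices vanish, and the others are functions on the first
  factor.
\<close>

lemma bracket_hlift_hlift:
  assumes \<omega>: "oneform_on A1 U1 \<omega>" and \<eta>: "oneform_on A1 U1 \<eta>" and S: "S \<in> tangent_space A1 x"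
  shows "form_bracket A P (hlift A1 A2 \<omega>) (hlift A1 A2 \<eta>) (x, y) (horiz x y S) = form_bracket A1 P1 \<omega> \<eta> x S"
proof -
  obtain c where c: "c \<in> A1" "x \<in> fst c" by (rule M1.chart_cover)
  obtain d where d: "d \<in> A2" "y \<in> fst d" by (rule M2.chart_cover)
  note cd = c(1) d(1) c(2) d(2)
  have hS: "horiz x y S \<in> tangent_space A (x, y)" by (rule sl1.pushforward_tangent[OF S])
  have half: "lie_coord A (prod_chart c d) (sharp A P (hlift A1 A2 \<omega>)) (hlift A1 A2 \<eta>) (x, y) (horiz x y S)
    = lie_coord A1 c (sharp A1 P1 \<omega>) \<eta> x S"
    if \<omega>: "oneform_on A1 U1 \<omega>" and \<eta>: "oneform_on A1 U1 \<eta>" for \<omega> \<eta>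
  proof -
    note m = sharp_factor1[OF \<omega> M1.smooth_at_coord[OF c]]
    have hX: "horiz x y (sharp A1 P1 \<omega> x) \<in> tangent_space A (x, y)" by (rule sl1.pushforward_tangent[OF m(2)])
    show ?thesis
      unfolding lie_coord_def sum_Basis_prod
        tangent_hlift_comp(1,2)[OF cd hX \<eta>] tangent_hlift_comp(3)[OF cd hS \<omega>]
        hlift_coord_vec[OF cd \<eta> cd(3,4) U(2)] horiz_coord[OF cd S]
        sharp_hlift[of \<omega>, OF m(1)] horiz_fst[OF m(2) comp_smooth1[OF cd \<eta>]] horiz_fst[OF S m(3)]
      by simp
  qed
  have "horiz x y S (\<lambda>z. P z (hlift A1 A2 \<omega> z) (hlift A1 A2 \<eta> z)) = horiz x y S (\<lambda>z. P1 (fst z) (\<omega> (fst z)) (\<eta> (fst z)))"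
    by (rule tangent_cong_charts[OF cd hS])
       (simp add: P_hlift[of \<omega> _ \<eta>] M1.oneform_onD[OF \<omega>] M1.oneform_onD[OF \<eta>])
  also have "\<dots> = S (\<lambda>x. P1 x (\<omega> x) (\<eta> x))"
    by (rule horiz_fst[OF S M1.smooth_atI[OF U(1,2) B1.P_smooth[OF U(1) \<omega> \<eta>]]])
  finally have last: "horiz x y S (\<lambda>z. P z (hlift A1 A2 \<omega> z) (hlift A1 A2 \<eta> z)) = S (\<lambda>x. P1 x (\<omega> x) (\<eta> x))" .
  show ?thesis
    unfolding bracket_coord[OF cd hlift_oneform[OF U(1) \<omega>] hlift_oneform[OF U(1) \<eta>] hS]
      B1.form_bracket_coord[OF c U(1,2) \<omega> \<eta> S] half[OF \<omega> \<eta>] half[OF \<eta> \<omega>] last ..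
qed

text \<open>
  The argument is the metric dual of a lifted covector, up to the choice of \<open>T\<close>. It is vertical, so \<open>f\<close>
  and \<open>\<nu>\<close> are differentiated neither by it nor by the vertical sharps: they come out of the
  coordinate expression as constants. The component of the bracket along the differential of \<open>\<nu>\<close> is
  horizontal and is not seen by \<open>T\<close>.
\<close>

lemma bracket_wlift_wlift:
  assumes \<omega>: "oneform_on A2 U2 \<omega>" and \<eta>: "oneform_on A2 U2 \<eta>" and T: "T \<in> tangent_space A2 y"
  shows "form_bracket A P (wlift \<omega>) (wlift \<eta>) (x, y) (\<lambda>u. (1 / f x) * vert x y T u) = (f x * \<nu> x) * form_bracket A2 P2 \<omega> \<eta> y T"
proof -
  obtain c where c: "c \<in> A1" "x \<in> fst c" by (rule M1.chart_cover)
  obtain d where d: "d \<in> A2" "y \<in> fst d" by (rule M2.chart_cover)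
  note cd = c(1) d(1) c(2) d(2)
  have vT: "vert x y T \<in> tangent_space A (x, y)" by (rule sl2.pushforward_tangent[OF T])
  have V: "(\<lambda>u. (1 / f x) * vert x y T u) \<in> tangent_space A (x, y)" by (rule M.tangent_scale[OF vT])
  have f0: "f x \<noteq> 0" using f_pos[of x] by simp
  have half: "lie_coord A (prod_chart c d) (sharp A P (wlift \<omega>)) (wlift \<eta>) (x, y) (\<lambda>u. (1 / f x) * vert x y T u)
    = (f x * \<nu> x) * lie_coord A2 d (sharp A2 P2 \<omega>) \<eta> y T"
    if \<omega>: "oneform_on A2 U2 \<omega>" and \<eta>: "oneform_on A2 U2 \<eta>" for \<omega> \<eta>
  proof -
    note m = sharp_factor2[OF \<omega> M2.smooth_at_coord[OF d]]
    have hX: "vert x y (sharp A2 P2 \<omega> y) \<in> tangent_space A (x, y)" by (rule sl2.pushforward_tangent[OF m(2)])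
    show ?thesis
      unfolding lie_coord_def sum_Basis_prod
        tangent_wlift_comp(1,2)[OF cd hX \<eta>] tangent_wlift_comp(3)[OF cd vT \<omega>]
        wlift_coord_vec[OF cd \<eta> cd(3,4) U(4)] vert_coord[OF cd T]
        sharp_wlift[of \<omega>, OF m(1)] vert_prod[OF m(2) f_at comp_smooth2[OF cd \<eta>]] vert_prod[OF T f\<nu>_at m(3)]
      using f0 by (simp add: sum_distrib_left sum_distrib_right field_simps)
  qed
  have "vert x y T (\<lambda>z. P z (wlift \<omega> z) (wlift \<eta> z)) = vert x y T (\<lambda>z. (f (fst z) * f (fst z) * \<nu> (fst z)) * P2 (snd z) (\<omega> (snd z)) (\<eta> (snd z)))"
    by (rule tangent_cong_charts[OF cd vT])
       (simp add: P_wlift[of \<omega> _ \<eta>] M2.oneform_onD[OF \<omega>] M2.oneform_onD[OF \<eta>])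
  also have "\<dots> = (f x * f x * \<nu> x) * T (\<lambda>y. P2 y (\<omega> y) (\<eta> y))"
    by (rule vert_prod[OF T _ M2.smooth_atI[OF U(3,4) B2.P_smooth[OF U(3) \<omega> \<eta>]]])
       (intro M1.smooth_at_mult f_at M1.smooth_fun_smooth_at[OF \<nu>_smooth])
  finally have last: "vert x y T (\<lambda>z. P z (wlift \<omega> z) (wlift \<eta> z)) = (f x * f x * \<nu> x) * T (\<lambda>y. P2 y (\<omega> y) (\<eta> y))" .
  show ?thesis
    unfolding bracket_coord[OF cd wlift_oneform[OF U(1,3) \<omega>] wlift_oneform[OF U(1,3) \<eta>] V]
      B2.form_bracket_coord[OF d U(3,4) \<omega> \<eta> T] half[OF \<omega> \<eta>] half[OF \<eta> \<omega>] last
    using f0 by (simp add: right_diff_distrib)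
qed

text \<open>
  The Lie derivative of a horizontal lift along a vertical field vanishes. In that of \<open>f \<eta>\<^sup>v\<close> along the
  horizontal field \<open>(#\<omega>)\<^sup>h\<close> only the derivative of \<open>f\<close> survives.
\<close>

lemma lie_coord_mixed:
  assumes \<omega>: "oneform_on A1 U1 \<omega>" and \<eta>: "oneform_on A2 U2 \<eta>" and V: "V \<in> tangent_space A (x, y)"
    and cd: "c \<in> A1" "d \<in> A2" "x \<in> fst c" "y \<in> fst d"
  shows "lie_coord A (prod_chart c d) (sharp A P (wlift \<eta>)) (hlift A1 A2 \<omega>) (x, y) V = 0"
    and "lie_coord A (prod_chart c d) (sharp A P (hlift A1 A2 \<omega>)) (wlift \<eta>) (x, y) V
      = sharp A1 P1 \<omega> x f * \<eta> y (dsnd x y V)"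
    and "V (\<lambda>z. P z (hlift A1 A2 \<omega> z) (wlift \<eta> z)) = 0" "V (\<lambda>z. P z (wlift \<eta> z) (hlift A1 A2 \<omega> z)) = 0"
proof -
  note m1 = sharp_factor1[OF \<omega> M1.smooth_at_coord[OF cd(1,3)]]
  note m2 = sharp_factor2[OF \<eta> M2.smooth_at_coord[OF cd(2,4)]]
  have h1: "horiz x y (sharp A1 P1 \<omega> x) \<in> tangent_space A (x, y)" by (rule sl1.pushforward_tangent[OF m1(2)])
  have h2: "vert x y (sharp A2 P2 \<eta> y) \<in> tangent_space A (x, y)" by (rule sl2.pushforward_tangent[OF m2(2)])
  have z1: "V (\<lambda>z. sharp A P (wlift \<eta>) z (\<lambda>z. snd (prod_chart c d) z \<bullet> (b, 0))) = 0" for b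
  proof -
    have "V (\<lambda>z. sharp A P (wlift \<eta>) z (\<lambda>z. snd (prod_chart c d) z \<bullet> (b, 0))) = V (\<lambda>z. 0)"
    proof (rule tangent_cong_charts[OF cd V])
      fix x' y' assume z: "x' \<in> fst c" "y' \<in> fst d" "x' \<in> U1" "y' \<in> U2"
      have "sharp A2 P2 \<eta> y' \<in> tangent_space A2 y'" by (rule B2.sharp_mem[of \<eta>, OF M2.oneform_onD[OF \<eta> z(4)]])
      then show "sharp A P (wlift \<eta>) (x', y') (\<lambda>z. snd (prod_chart c d) z \<bullet> (b, 0)) = 0"
        unfolding sharp_wlift_coord[OF cd \<eta> z(1,2,4)] by (simp add: M2.tangent_const)
    qed
    then show ?thesis by (simp add: M.tangent_const[OF V])
  qed
  have z2: "V (\<lambda>z. sharp A P (hlift A1 A2 \<omega>) z (\<lambda>z. snd (prod_chart c d) z \<bullet> (0, b))) = 0" for b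
  proof -
    have "V (\<lambda>z. sharp A P (hlift A1 A2 \<omega>) z (\<lambda>z. snd (prod_chart c d) z \<bullet> (0, b))) = V (\<lambda>z. 0)"
    proof (rule tangent_cong_charts[OF cd V])
      fix x' y' assume z: "x' \<in> fst c" "y' \<in> fst d" "x' \<in> U1" "y' \<in> U2"
      have "sharp A1 P1 \<omega> x' \<in> tangent_space A1 x'" by (rule B1.sharp_mem[of \<omega>, OF M1.oneform_onD[OF \<omega> z(3)]])
      then show "sharp A P (hlift A1 A2 \<omega>) (x', y') (\<lambda>z. snd (prod_chart c d) z \<bullet> (0, b)) = 0"
        unfolding sharp_hlift_coord[OF cd \<omega> z(1,2,3)] by (simp add: M1.tangent_const)
    qed
    then show ?thesis by (simp add: M.tangent_const[OF V])
  qed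
  show "lie_coord A (prod_chart c d) (sharp A P (wlift \<eta>)) (hlift A1 A2 \<omega>) (x, y) V = 0"
    unfolding lie_coord_def sum_Basis_prod z1 tangent_hlift_comp(1,2)[OF cd h2 \<omega>] hlift_coord_vec[OF cd \<omega> cd(3,4) U(2)]
      sharp_wlift[of \<eta>, OF m2(1)] vert_fst[OF m2(2) comp_smooth1[OF cd \<omega>]] by simp
  have dc: "V (\<lambda>z. snd (prod_chart c d) z \<bullet> (0, b)) = dsnd x y V (\<lambda>y. snd d y \<bullet> b)" for b
    using pr2.pushforward_apply[of "(x, y)" "\<lambda>y. snd d y \<bullet> b" V] M2.smooth_at_coord[OF cd(2,4)] by (simp add: inner_prod_def)
  have "lie_coord A (prod_chart c d) (sharp A P (hlift A1 A2 \<omega>)) (wlift \<eta>) (x, y) V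
    = (\<Sum>b\<in>Basis. sharp A1 P1 \<omega> x f * \<eta> y (coord_vec A2 d b y) * dsnd x y V (\<lambda>y. snd d y \<bullet> b))"
    unfolding lie_coord_def sum_Basis_prod z2 dc tangent_wlift_comp(1,2)[OF cd h1 \<eta>] wlift_coord_vec[OF cd \<eta> cd(3,4) U(4)]
      sharp_hlift[of \<omega>, OF m1(1)] horiz_prod[OF m1(2) f_at comp_smooth2[OF cd \<eta>]] by simp
  also have "\<dots> = sharp A1 P1 \<omega> x f * \<eta> y (dsnd x y V)"
    unfolding M2.cotangent_apply[OF cd(2,4) m2(1) dsnd_mem[OF V]] sum_distrib_left
    by (rule sum.cong) simp_all
  finally show "lie_coord A (prod_chart c d) (sharp A P (hlift A1 A2 \<omega>)) (wlift \<eta>) (x, y) V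
      = sharp A1 P1 \<omega> x f * \<eta> y (dsnd x y V)" .
  have "V (\<lambda>z. P z (hlift A1 A2 \<omega> z) (wlift \<eta> z)) = V (\<lambda>z. 0)"
    by (rule tangent_cong_charts[OF cd V])
       (simp add: P_hlift_wlift M1.oneform_onD[OF \<omega>] M2.oneform_onD[OF \<eta>])
  then show "V (\<lambda>z. P z (hlift A1 A2 \<omega> z) (wlift \<eta> z)) = 0" by (simp add: M.tangent_const[OF V])
  have "V (\<lambda>z. P z (wlift \<eta> z) (hlift A1 A2 \<omega> z)) = V (\<lambda>z. 0)"
  proof (rule tangent_cong_charts[OF cd V])
    fix x' y' assume z: "x' \<in> fst c" "y' \<in> fst d" "x' \<in> U1" "y' \<in> U2"
    note n1 = M1.oneform_onD[OF \<omega> z(3)] and n2 = M2.oneform_onD[OF \<eta> z(4)]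
    show "P (x', y') (wlift \<eta> (x', y')) (hlift A1 A2 \<omega> (x', y')) = 0"
      using W.P_skew[OF wlift_mem[of \<eta>, OF n2] hlift_mem[of \<omega>, OF n1]] P_hlift_wlift[of \<omega> _ \<eta>, OF n1 n2] by simp
  qed
  then show "V (\<lambda>z. P z (wlift \<eta> z) (hlift A1 A2 \<omega> z)) = 0" by (simp add: M.tangent_const[OF V])
qed

lemma bracket_hlift_wlift:
  assumes \<omega>: "oneform_on A1 U1 \<omega>" and \<eta>: "oneform_on A2 U2 \<eta>" and V: "V \<in> tangent_space A (x, y)"
  shows "form_bracket A P (hlift A1 A2 \<omega>) (wlift \<eta>) (x, y) V = sharp A1 P1 \<omega> x f * \<eta> y (dsnd x y V)"
    and "form_bracket A P (wlift \<eta>) (hlift A1 A2 \<omega>) (x, y) V = - (sharp A1 P1 \<omega> x f * \<eta> y (dsnd x y V))"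
proof -
  obtain c where c: "c \<in> A1" "x \<in> fst c" by (rule M1.chart_cover)
  obtain d where d: "d \<in> A2" "y \<in> fst d" by (rule M2.chart_cover)
  note cd = c(1) d(1) c(2) d(2)
  note h = hlift_oneform[OF U(1) \<omega>, of U2] and w = wlift_oneform[OF U(1,3) \<eta>]
  show "form_bracket A P (hlift A1 A2 \<omega>) (wlift \<eta>) (x, y) V = sharp A1 P1 \<omega> x f * \<eta> y (dsnd x y V)"
    unfolding bracket_coord[OF cd h w V] lie_coord_mixed[OF \<omega> \<eta> V cd] by simp
  show "form_bracket A P (wlift \<eta>) (hlift A1 A2 \<omega>) (x, y) V = - (sharp A1 P1 \<omega> x f * \<eta> y (dsnd x y V))"
    unfolding bracket_coord[OF cd w h V] lie_coord_mixed[OF \<omega> \<eta> V cd] by simp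
qed

end

section \<open>The Laplacian of a warped product\<close>

context
  fixes D1 D2 D and U1 :: "'m1 set" and U2 :: "'m2 set" and x :: 'm1 and y :: 'm2
    and I1 :: "'i set" and I2 :: "'j set" and dx dy \<epsilon>1 \<epsilon>2 u1 u2
  assumes U: "open U1" "x \<in> U1" "open U2" "y \<in> U2"
    and LC: "contravariant_levi_civita A1 P1 g1 D1" "contravariant_levi_civita A2 P2 g2 D2" "contravariant_levi_civita A P g D"
    and I: "finite I1" "card I1 = DIM('e1)" "finite I2" "card I2 = DIM('e2)"
    and dx: "\<And>i. i \<in> I1 \<Longrightarrow> oneform_on A1 U1 (dx i)" and dy: "\<And>j. j \<in> I2 \<Longrightarrow> oneform_on A2 U2 (dy j)"
    and dx_on: "\<And>x i j. x \<in> U1 \<Longrightarrow> i \<in> I1 \<Longrightarrow> j \<in> I1 \<Longrightarrow> cometric A1 g1 x (dx i x) (dx j x) = (if i = j then \<epsilon>1 i else 0)"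
    and dy_on: "\<And>y i j. y \<in> U2 \<Longrightarrow> i \<in> I2 \<Longrightarrow> j \<in> I2 \<Longrightarrow> cometric A2 g2 y (dy i y) (dy j y) = (if i = j then \<epsilon>2 i else 0)"
    and eps: "\<And>i. i \<in> I1 \<Longrightarrow> \<epsilon>1 i * \<epsilon>1 i = 1" "\<And>j. j \<in> I2 \<Longrightarrow> \<epsilon>2 j * \<epsilon>2 j = 1"
    and u1: "smooth_fun A1 u1" and u2: "smooth_fun A2 u2"
begin

abbreviation (input) "E \<equiv> case_sum (\<lambda>i. hlift A1 A2 (dx i)) (\<lambda>j. wlift (dy j))"
abbreviation (input) "\<epsilon> \<equiv> case_sum \<epsilon>1 \<epsilon>2"
abbreviation (input) "u \<equiv> (\<lambda>z. u1 (fst z) + u2 (snd z))"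

lemma dx_mem: "i \<in> I1 \<Longrightarrow> x' \<in> U1 \<Longrightarrow> dx i x' \<in> cotangent_space A1 x'"
  by (rule M1.oneform_onD[OF dx])

lemma dy_mem: "j \<in> I2 \<Longrightarrow> y' \<in> U2 \<Longrightarrow> dy j y' \<in> cotangent_space A2 y'"
  by (rule M2.oneform_onD[OF dy])

lemma u_smooth_at: "smooth_at A (x', y') u"
  by (rule M.smooth_at_add[OF smooth_at_fst[OF M1.smooth_fun_smooth_at[OF u1]] smooth_at_snd[OF M2.smooth_fun_smooth_at[OF u2]]])

lemma horiz_u: assumes X: "X \<in> tangent_space A1 x'" shows "horiz x' y' X u = X u1"
  using M1.tangent_add[OF X M1.smooth_fun_smooth_at[OF u1] M1.smooth_at_const] M1.tangent_const[OF X]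
  by (simp add: sl1.pushforward_apply[OF u_smooth_at])

lemma vert_u: assumes Y: "Y \<in> tangent_space A2 y'" shows "vert x' y' Y u = Y u2"
  using M2.tangent_add[OF Y M2.smooth_at_const M2.smooth_fun_smooth_at[OF u2]] M2.tangent_const[OF Y]
  by (simp add: sl2.pushforward_apply[OF u_smooth_at])

lemma sharp_hlift_u:
  assumes "i \<in> I1" "x' \<in> U1"
  shows "sharp A P (hlift A1 A2 (dx i)) (x', y') u = sharp A1 P1 (dx i) x' u1"
  unfolding sharp_hlift[of "dx i", OF dx_mem[OF assms]] by (rule horiz_u[OF B1.sharp_mem[of "dx i", OF dx_mem[OF assms]]])

lemma sharp_wlift_u:
  assumes "j \<in> I2" "y' \<in> U2"
  shows "sharp A P (wlift (dy j)) (x', y') u = (f x' * \<nu> x') * sharp A2 P2 (dy j) y' u2"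
  unfolding sharp_wlift[of "dy j", OF dy_mem[OF assms]] vert_u[OF B2.sharp_mem[of "dy j", OF dy_mem[OF assms]]] ..

lemma eventually_in_frame_domain: "\<forall>\<^sub>F z in nhds (x, y). fst z \<in> U1 \<and> snd z \<in> U2"
  using eventually_nhds_in_open[OF open_Times[OF U(1,3)], of "(x, y)"] U by (auto elim!: eventually_mono)

lemma sharp_sharp_hlift_u:
  assumes i: "i \<in> I1"
  shows "sharp A P (hlift A1 A2 (dx i)) (x, y) (\<lambda>z. sharp A P (hlift A1 A2 (dx i)) z u)
      = sharp A1 P1 (dx i) x (\<lambda>x. sharp A1 P1 (dx i) x u1)"
proof -
  note m = sharp_factor1[OF U dx[OF i] M1.smooth_fun_smooth_at[OF u1]]
  have "horiz x y (sharp A1 P1 (dx i) x) (\<lambda>z. sharp A P (hlift A1 A2 (dx i)) z u)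
      = horiz x y (sharp A1 P1 (dx i) x) (\<lambda>z. sharp A1 P1 (dx i) (fst z) u1)"
    by (rule M.tangent_cong[OF sl1.pushforward_tangent[OF m(2)] eventually_mono[OF eventually_in_frame_domain]])
       (use sharp_hlift_u[OF i] in \<open>auto simp: split_paired_all\<close>)
  then show ?thesis unfolding sharp_hlift[of "dx i", OF m(1)] horiz_fst[OF m(2,3)] .
qed

lemma sharp_sharp_wlift_u:
  assumes j: "j \<in> I2"
  shows "sharp A P (wlift (dy j)) (x, y) (\<lambda>z. sharp A P (wlift (dy j)) z u)
      = (f x * \<nu> x)\<^sup>2 * sharp A2 P2 (dy j) y (\<lambda>y. sharp A2 P2 (dy j) y u2)"
proof -
  note m = sharp_factor2[OF U dy[OF j] M2.smooth_fun_smooth_at[OF u2]]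
  have "vert x y (sharp A2 P2 (dy j) y) (\<lambda>z. sharp A P (wlift (dy j)) z u)
      = vert x y (sharp A2 P2 (dy j) y) (\<lambda>z. (f (fst z) * \<nu> (fst z)) * sharp A2 P2 (dy j) (snd z) u2)"
    by (rule M.tangent_cong[OF sl2.pushforward_tangent[OF m(2)] eventually_mono[OF eventually_in_frame_domain]])
       (use sharp_wlift_u[OF j] in \<open>auto simp: split_paired_all\<close>)
  also have "\<dots> = (f x * \<nu> x) * sharp A2 P2 (dy j) y (\<lambda>y. sharp A2 P2 (dy j) y u2)"
    by (rule vert_prod[OF m(2) f\<nu>_at[OF U] m(3)])
  finally show ?thesis unfolding sharp_wlift[of "dy j", OF m(1)] by (simp add: power2_eq_square)
qed

text \<open>
  The formula for an orthonormal coframe, applied to the coframe of lifts, with its sum split into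
  the horizontal and the vertical part.
\<close>

lemma second_contr_deriv_product:
  assumes k: "k \<in> I1 <+> I2"
  shows "second_contr_deriv A P D (E k) (E k) u (x, y) = sharp A P (E k) (x, y) (\<lambda>z. sharp A P (E k) z u)
    + (\<Sum>i\<in>I1. \<epsilon>1 i * form_bracket A P (E k) (hlift A1 A2 (dx i)) (x, y) (metric_sharp A g (x, y) (E k (x, y))) * sharp A1 P1 (dx i) x u1)
    + (\<Sum>j\<in>I2. \<epsilon>2 j * form_bracket A P (E k) (wlift (dy j)) (x, y) (metric_sharp A g (x, y) (E k (x, y))) * ((f x * \<nu> x) * sharp A2 P2 (dy j) y u2))"
proof -
  have "second_contr_deriv A P D (E k) (E k) u (x, y) = sharp A P (E k) (x, y) (\<lambda>z. sharp A P (E k) z u)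
    + (\<Sum>l\<in>I1 <+> I2. \<epsilon> l * form_bracket A P (E k) (E l) (x, y) (metric_sharp A g (x, y) (E k (x, y))) * sharp A P (E l) (x, y) u)"
  proof (rule W.second_contr_deriv_frame[OF LC(3) open_Times[OF U(1,3)], where \<epsilon> = \<epsilon>])
    show "(x, y) \<in> U1 \<times> U2" using U by simp
    show "finite (I1 <+> I2)" using I by simp
    show "card (I1 <+> I2) = DIM('e1 \<times> 'e2)" using I by (simp add: card_Plus)
    show "oneform_on A (U1 \<times> U2) (E i)" if "i \<in> I1 <+> I2" for i
      using that hlift_oneform[OF U(1) dx] wlift_oneform[OF U(1,3) dy] by auto
    show "\<epsilon> i * \<epsilon> i = 1" if "i \<in> I1 <+> I2" for i using that eps by auto
    show "k \<in> I1 <+> I2" by (rule k)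
    fix z i j assume z: "z \<in> U1 \<times> U2" and ij: "i \<in> I1 <+> I2" "j \<in> I1 <+> I2"
    obtain x' y' where z': "z = (x', y')" "x' \<in> U1" "y' \<in> U2" using z by auto
    have sym: "cometric A g (x', y') (wlift (dy b) (x', y')) (hlift A1 A2 (dx a) (x', y')) = 0" if "a \<in> I1" "b \<in> I2" for a b
      using W.cometric_sym[OF wlift_mem[of "dy b", OF dy_mem[OF that(2) z'(3)]] hlift_mem[of "dx a", OF dx_mem[OF that(1) z'(2)]]]
        cometric_hlift_wlift[of "dx a" x' "dy b" y', OF dx_mem[OF that(1) z'(2)] dy_mem[OF that(2) z'(3)]] by simp
    show "cometric A g z (E i z) (E j z) = (if i = j then \<epsilon> i else 0)"
      using ij z'(2,3) unfolding z'(1)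
      by (auto simp: cometric_hlift cometric_wlift cometric_hlift_wlift sym dx_mem dy_mem dx_on dy_on
          split: if_splits)
  qed
  then show ?thesis
    by (simp add: sum.Plus[OF I(1,3)] comp_def sharp_hlift_u[OF _ U(2)] sharp_wlift_u[OF _ U(4)])
qed

text \<open>
  The metric dual of \<open>dx k\<close> is horizontal and the mixed brackets only have values on vertical vectors, so
  the vertical part of the sum vanishes.
\<close>

lemma second_contr_deriv_hlift:
  assumes k: "k \<in> I1"
  shows "second_contr_deriv A P D (hlift A1 A2 (dx k)) (hlift A1 A2 (dx k)) u (x, y)
    = second_contr_deriv A1 P1 D1 (dx k) (dx k) u1 x"
proof -
  note m = dx_mem[OF k U(2)]
  note S = B1.metric_sharp_mem[OF m]
  note hS = sl1.pushforward_tangent[OF S, of y]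
  have "second_contr_deriv A P D (hlift A1 A2 (dx k)) (hlift A1 A2 (dx k)) u (x, y)
    = sharp A1 P1 (dx k) x (\<lambda>x. sharp A1 P1 (dx k) x u1)
    + (\<Sum>i\<in>I1. \<epsilon>1 i * form_bracket A1 P1 (dx k) (dx i) x (metric_sharp A1 g1 x (dx k x)) * sharp A1 P1 (dx i) x u1)"
    using second_contr_deriv_product[OF InlI[OF k]]
    by (simp add: sharp_sharp_hlift_u[OF k] metric_sharp_hlift[of "dx k", OF m] bracket_hlift_hlift[OF U dx[OF k] dx S]
        bracket_hlift_wlift(1)[OF U dx[OF k] dy hS] dsnd_horiz[OF S] M2.cotangent_zero_vec[OF dy_mem[OF _ U(4)]])
  then show ?thesis
    using B1.second_contr_deriv_frame[OF LC(1) U(1,2) I(1,2) dx dx_on eps(1) k] by simp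
qed

text \<open>
  The horizontal part of the sum comes from the mixed brackets, which are evaluated on the metric dual
  of the lift of \<open>dy k\<close> and produce \<open>- \<epsilon>2 k / f\<close> times the derivative of \<open>f\<close>. In the vertical part the bracket and
  the derivative of \<open>u2\<close> each contribute one factor \<open>f \<nu>\<close>.
\<close>

lemma second_contr_deriv_wlift:
  assumes k: "k \<in> I2"
  shows "second_contr_deriv A P D (wlift (dy k)) (wlift (dy k)) u (x, y)
    = (f x * \<nu> x)\<^sup>2 * second_contr_deriv A2 P2 D2 (dy k) (dy k) u2 y
      - \<epsilon>2 k / f x * (\<Sum>i\<in>I1. \<epsilon>1 i * sharp A1 P1 (dx i) x f * sharp A1 P1 (dx i) x u1)"
proof -
  note m = dy_mem[OF k U(4)]
  note S = B2.metric_sharp_mem[OF m]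
  note vS = sl2.pushforward_tangent[OF S, of x]
  define V where "V = (\<lambda>u. (1 / f x) * vert x y (metric_sharp A2 g2 y (dy k y)) u)"
  have gV: "metric_sharp A g (x, y) (wlift (dy k) (x, y)) = V"
    unfolding V_def by (rule metric_sharp_wlift[of "dy k", OF m])
  have V: "V \<in> tangent_space A (x, y)" unfolding V_def by (rule M.tangent_scale[OF vS])
  have dV: "dsnd x y V = (\<lambda>u. (1 / f x) * metric_sharp A2 g2 y (dy k y) u)"
    unfolding V_def pr2.pushforward_scale dsnd_vert[OF S] ..
  have "dy k y (metric_sharp A2 g2 y (dy k y)) = \<epsilon>2 k"
    using B2.cometric_right[OF m m] dy_on[OF U(4) k k] by simp
  then have kV: "dy k y (dsnd x y V) = \<epsilon>2 k / f x"
    unfolding dV M2.cotangent_scale_vec[OF m S] by simp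
  have b1: "form_bracket A P (wlift (dy k)) (hlift A1 A2 (dx i)) (x, y) V = - (sharp A1 P1 (dx i) x f * (\<epsilon>2 k / f x))"
    if "i \<in> I1" for i
    unfolding bracket_hlift_wlift(2)[OF U dx[OF that] dy[OF k] V] kV ..
  have b2: "form_bracket A P (wlift (dy k)) (wlift (dy j)) (x, y) V
      = (f x * \<nu> x) * form_bracket A2 P2 (dy k) (dy j) y (metric_sharp A2 g2 y (dy k y))" if "j \<in> I2" for j
    unfolding V_def by (rule bracket_wlift_wlift[OF U dy[OF k] dy[OF that] S])
  have "second_contr_deriv A P D (wlift (dy k)) (wlift (dy k)) u (x, y)
    = (f x * \<nu> x)\<^sup>2 * sharp A2 P2 (dy k) y (\<lambda>y. sharp A2 P2 (dy k) y u2)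
    + (\<Sum>i\<in>I1. \<epsilon>1 i * - (sharp A1 P1 (dx i) x f * (\<epsilon>2 k / f x)) * sharp A1 P1 (dx i) x u1)
    + (\<Sum>j\<in>I2. \<epsilon>2 j * ((f x * \<nu> x) * form_bracket A2 P2 (dy k) (dy j) y (metric_sharp A2 g2 y (dy k y)))
        * ((f x * \<nu> x) * sharp A2 P2 (dy j) y u2))"
    using second_contr_deriv_product[OF InrI[OF k]]
    by (simp add: sharp_sharp_wlift_u[OF k] gV b1 b2)
  moreover have "(\<Sum>i\<in>I1. \<epsilon>1 i * - (sharp A1 P1 (dx i) x f * (\<epsilon>2 k / f x)) * sharp A1 P1 (dx i) x u1)
      = - (\<epsilon>2 k / f x * (\<Sum>i\<in>I1. \<epsilon>1 i * sharp A1 P1 (dx i) x f * sharp A1 P1 (dx i) x u1))"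
    unfolding sum_distrib_left sum_negf[symmetric] by (rule sum.cong) simp_all
  moreover have "(\<Sum>j\<in>I2. \<epsilon>2 j * ((f x * \<nu> x) * form_bracket A2 P2 (dy k) (dy j) y (metric_sharp A2 g2 y (dy k y)))
        * ((f x * \<nu> x) * sharp A2 P2 (dy j) y u2))
      = (f x * \<nu> x)\<^sup>2 * (\<Sum>j\<in>I2. \<epsilon>2 j * form_bracket A2 P2 (dy k) (dy j) y (metric_sharp A2 g2 y (dy k y)) * sharp A2 P2 (dy j) y u2)"
    unfolding sum_distrib_left by (rule sum.cong) (simp_all add: power2_eq_square)
  ultimately show ?thesis
    using B2.second_contr_deriv_frame[OF LC(2) U(3,4) I(3,4) dy dy_on eps(2) k, of u2] by (simp add: distrib_left)
qed

text \<open>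
  The component of \<open>J dh\<close> along \<open>dx i\<close> is \<open>\<Pi>(dh, dx i) = - #(dx i) h\<close>; the two minus signs cancel.
\<close>

lemma cometric_J:
  "cometric A1 g1 x (J_endo A1 P1 g1 (differential A1 f) x) (J_endo A1 P1 g1 (differential A1 u1) x)
    = (\<Sum>i\<in>I1. \<epsilon>1 i * sharp A1 P1 (dx i) x f * sharp A1 P1 (dx i) x u1)"
proof -
  interpret F: orthonormal_covectors A1 g1 x I1 "\<lambda>i. dx i x" \<epsilon>1
    by unfold_locales (use U I dx_mem dx_on eps in auto)
  have J: "cometric A1 g1 x (J_endo A1 P1 g1 (differential A1 h) x) (dx i x) = - sharp A1 P1 (dx i) x h" if "i \<in> I1" for i h
    using B1.J_endo_properties(2)[of "differential A1 h", OF M1.differential_mem dx_mem[OF that U(2)]]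
      B1.P_skew[OF M1.differential_mem dx_mem[OF that U(2)]] B1.sharp_fun[of "dx i", OF dx_mem[OF that U(2)]] by simp
  show ?thesis
    unfolding F.cometric_expand[OF B1.J_endo_properties(1)[of "differential A1 f", OF M1.differential_mem]
        B1.J_endo_properties(1)[of "differential A1 u1", OF M1.differential_mem]]
    by (rule sum.cong) (simp_all add: J)
qed

lemma contr_laplacian_warped:
  "contr_laplacian A P D (I1 <+> I2) E u (x, y) = contr_laplacian A1 P1 D1 I1 dx u1 x
    + (\<Sum>j\<in>I2. \<epsilon>2 j) / f x * cometric A1 g1 x (J_endo A1 P1 g1 (differential A1 f) x) (J_endo A1 P1 g1 (differential A1 u1) x)
    + (\<nu> x * f x)\<^sup>2 * contr_laplacian A2 P2 D2 I2 dy u2 y"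
proof -
  define K where "K = (\<Sum>i\<in>I1. \<epsilon>1 i * sharp A1 P1 (dx i) x f * sharp A1 P1 (dx i) x u1)"
  have "(\<Sum>j\<in>I2. (f x * \<nu> x)\<^sup>2 * second_contr_deriv A2 P2 D2 (dy j) (dy j) u2 y - \<epsilon>2 j / f x * K)
      = (f x * \<nu> x)\<^sup>2 * (\<Sum>j\<in>I2. second_contr_deriv A2 P2 D2 (dy j) (dy j) u2 y) - (\<Sum>j\<in>I2. \<epsilon>2 j) / f x * K"
    by (simp only: sum_subtractf sum_distrib_left sum_distrib_right sum_divide_distrib)
  then show ?thesis
    unfolding contr_laplacian_def cometric_J sum.Plus[OF I(1,3)]
    by (simp add: comp_def second_contr_deriv_hlift second_contr_deriv_wlift K_def[symmetric] mult.commute[of "f x" "\<nu> x"])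
qed

end

end

lemma sum_signs:
  fixes k q :: nat
  assumes "q \<le> k"
  shows "(\<Sum>i\<in>{1..k}. if i \<le> q then - 1 else 1 :: real) = real k - 2 * real q"
proof -
  have "(\<Sum>i\<in>{1..k}. if i \<le> q then - 1 else 1 :: real) = (\<Sum>i\<in>{1..k}. 1 - 2 * (if i \<in> {1..q} then 1 else 0))"
    by (rule sum.cong) auto
  also have "\<dots> = real k - 2 * (\<Sum>i\<in>{1..k}. if i \<in> {1..q} then 1 else 0)"
    by (simp add: sum_subtractf sum_distrib_left)
  also have "(\<Sum>i\<in>{1..k}. if i \<in> {1..q} then 1 else 0 :: real) = (\<Sum>i\<in>{1..k} \<inter> {1..q}. 1)"
    by (rule sum.inter_restrict[symmetric]) simp
  also have "\<dots> = real q" using assms by (simp add: min_def)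
  finally show ?thesis .
qed

theorem theorem3p6:
  fixes A1 :: "('m1::{t2_space,second_countable_topology}, 'e1::euclidean_space) atlas"
    and A2 :: "('m2::{t2_space,second_countable_topology}, 'e2::euclidean_space) atlas"
    and P1 :: "'m1 bivector" and P2 :: "'m2 bivector"
    and g1 :: "'m1 metric" and g2 :: "'m2 metric"
    and q1 q2 :: nat
    and f1 \<nu>1 u1 :: "'m1 \<Rightarrow> real" and u2 :: "'m2 \<Rightarrow> real"
    and u :: "'m1 \<times> 'm2 \<Rightarrow> real"
    and D1 :: "'m1 form \<Rightarrow> 'm1 form \<Rightarrow> 'm1 form"
    and D2 :: "'m2 form \<Rightarrow> 'm2 form \<Rightarrow> 'm2 form"
    and D :: "('m1 \<times> 'm2) form \<Rightarrow> ('m1 \<times> 'm2) form \<Rightarrow> ('m1 \<times> 'm2) form"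
    and dx :: "nat \<Rightarrow> 'm1 form" and dy :: "nat \<Rightarrow> 'm2 form"
    and U1 :: "'m1 set" and U2 :: "'m2 set"
  defines "A \<equiv> prod_atlas A1 A2"
    and "P \<equiv> warped_bivector A1 A2 P1 P2 \<nu>1"
    and "g \<equiv> warped_metric A1 A2 g1 g2 f1"
    and "k1 \<equiv> DIM('e1)" and "k2 \<equiv> DIM('e2)"
  assumes "poisson_manifold A1 P1" and "poisson_manifold A2 P2"
    and "semi_riemannian_metric A1 g1 q1" and "semi_riemannian_metric A2 g2 q2"
    and "smooth_fun A1 f1" and "\<And>x. f1 x > 0" and "smooth_fun A1 \<nu>1"
    and "contravariant_levi_civita A1 P1 g1 D1"
    and "contravariant_levi_civita A2 P2 g2 D2"
    and "contravariant_levi_civita A P g D"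
    and "orthonormal_coframe_on A1 g1 q1 U1 dx"
    and "orthonormal_coframe_on A2 g2 q2 U2 dy"
    and "smooth_fun A1 u1" and "smooth_fun A2 u2"
    and "u = (\<lambda>z. (u1 \<circ> fst) z + (u2 \<circ> snd) z)"
    and "x \<in> U1" and "y \<in> U2"
  shows "contr_laplacian A P D ({1..k1} <+> {1..k2}) (warped_coframe A1 A2 f1 dx dy) u (x, y) =
    contr_laplacian A1 P1 D1 {1..k1} dx u1 x
    + (real k2 - 2 * real q2) / f1 x *
        cometric A1 g1 x (J_endo A1 P1 g1 (differential A1 f1) x)
                         (J_endo A1 P1 g1 (differential A1 u1) x)
    + (\<nu>1 x * f1 x)\<^sup>2 * contr_laplacian A2 P2 D2 {1..k2} dy u2 y"
proof -
  have poisson: "smooth_manifold A1" "bivector_field A1 P1" "smooth_manifold A2" "bivector_field A2 P2"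
    using \<open>poisson_manifold A1 P1\<close> \<open>poisson_manifold A2 P2\<close> by (simp_all add: poisson_manifold_def)
  interpret G1: metric_manifold A1 g1
    by (rule semi_riemannian_imp_metric_manifold[OF poisson(1) \<open>semi_riemannian_metric A1 g1 q1\<close>])
  interpret G2: metric_manifold A2 g2
    by (rule semi_riemannian_imp_metric_manifold[OF poisson(3) \<open>semi_riemannian_metric A2 g2 q2\<close>])
  interpret warped_product A1 A2 P1 g1 P2 g2 f1 \<nu>1
    by unfold_locales (fact poisson assms)+
  have q2: "q2 \<le> k2"
    unfolding k2_def by (rule index_le_dimension[OF poisson(3) \<open>semi_riemannian_metric A2 g2 q2\<close>])
  note dx = \<open>orthonormal_coframe_on A1 g1 q1 U1 dx\<close>[unfolded orthonormal_coframe_on_def]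
    and dy = \<open>orthonormal_coframe_on A2 g2 q2 U2 dy\<close>[unfolded orthonormal_coframe_on_def]
  have coframe: "warped_coframe A1 A2 f1 dx dy = case_sum (\<lambda>i. hlift A1 A2 (dx i)) (\<lambda>j. wlift (dy j))"
    by (simp add: warped_coframe_def wlift_def)
  have u: "u = (\<lambda>z. u1 (fst z) + u2 (snd z))"
    using \<open>u = (\<lambda>z. (u1 \<circ> fst) z + (u2 \<circ> snd) z)\<close> by (simp add: comp_def)
  have "contr_laplacian A P D ({1..k1} <+> {1..k2}) (warped_coframe A1 A2 f1 dx dy) u (x, y) =
    contr_laplacian A1 P1 D1 {1..k1} dx u1 x
    + (\<Sum>j\<in>{1..k2}. if j \<le> q2 then - 1 else 1) / f1 x *
        cometric A1 g1 x (J_endo A1 P1 g1 (differential A1 f1) x) (J_endo A1 P1 g1 (differential A1 u1) x)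
    + (\<nu>1 x * f1 x)\<^sup>2 * contr_laplacian A2 P2 D2 {1..k2} dy u2 y"
    unfolding coframe u A_def P_def
  proof (rule contr_laplacian_warped[where ?U1.0 = U1 and ?U2.0 = U2
        and ?\<epsilon>1.0 = "\<lambda>i. if i \<le> q1 then - 1 else 1" and ?\<epsilon>2.0 = "\<lambda>j. if j \<le> q2 then - 1 else 1"])
    show "contravariant_levi_civita (prod_atlas A1 A2) (warped_bivector A1 A2 P1 P2 \<nu>1) (warped_metric A1 A2 g1 g2 f1) D"
      using \<open>contravariant_levi_civita A P g D\<close> unfolding A_def P_def g_def .
  qed (use dx dy assms in \<open>auto simp: k1_def k2_def\<close>)
  then show ?thesis unfolding sum_signs[OF q2] .
qed

end
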